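(* Let $n\ge 1$ and $1\le k\le n$. Let $C\subset\mathbb{P}^n\times\mathbb{P}^{n+1}$ be the distinguished rational curve determined by $n+3$ general points, with homogeneous coordinates $x_0,\dots,x_n$ on $\mathbb{P}^n$ and $y_0,\dots,y_{n+1}$ on $\mathbb{P}^{n+1}$ chosen so that $C$ is the zero locus of the $2\times 2$ minors of $$M_1=\begin{pmatrix}x_0&x_1&\cdots&x_{n-1}&y_0&y_1&\cdots&y_n\\ x_1&x_2&\cdots&x_n&y_1&y_2&\cdots&y_{n+1}\end{pmatrix}.$$ Then the $k$-th bilinear secant variety $\operatorname{BS}_k(C)$ is irreducible of dimension $\min\{3k-2,\,2n+1\}$. It is the zero locus in $\mathbb{P}^n\times\mathbb{P}^{n+1}$ of the ideal of maximal, i.e. $(k+1)\times(k+1)$, minors of the matrix $$M_k=\begin{pmatrix}x_0&\cdots&x_{n-k}&y_0&\cdots&y_{n-k+1}\\ x_1&\cdots&x_{n-k+1}&y_1&\cdots&y_{n-k+2}\\ \vdots& &\vdots&\vdots& &\vdots\\ x_k&\cdots&x_n&y_k&\cdots&y_{n+1}\end{pmatrix}$$ (the ideal being zero if $M_k$ has fewer than $k+1$ columns).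
   Context: We work over an algebraically closed field of characteristic zero. Given $n+3$ general points in $\mathbb{P}^n\times\mathbb{P}^{n+1}$, the distinguished rational curve determined by them is the unique irreducible curve of bidegree $(n,n+1)$ through all of them (it exists, and is smooth and rational; bidegree $(a,b)$ means intersection numbers $a$ and $b$ with the pullbacks of hyperplanes from the first and second factor). Up to projective transformations of the two factors, it is the zero locus of the $2\times2$ minors of the matrix $M_1=\begin{pmatrix}x_0&x_1&\cdots&x_{n-1}&y_0&y_1&\cdots&y_n\\ x_1&x_2&\cdots&x_n&y_1&y_2&\cdots&y_{n+1}\end{pmatrix}$. Points $z_1,\dots,z_k\in\mathbb{P}^n\times\mathbb{P}^m$ are called general if their projections to each factor are linearly independent sets; their bilinear span is $\operatorname{BL}(z_1,\dots,z_k)=L^1\times L^2$, where $L^j$ is the linear span of the projections of the points to the $j$-th factor. The bilinear join of subvarieties $X_1,\dots,X_k$ of $\mathbb{P}^n\times\mathbb{P}^m$ is $\operatorname{BJ}(X_1,\dots,X_k)=\overline{\bigcup_{z_i\in X_i}\operatorname{BL}(z_1,\dots,z_k)}$, the union being over $k$-tuples of points $z_1\in X_1,\dots,z_k\in X_k$ whose projections to each of the two factors $\mathbb{P}^n$ and $\mathbb{P}^m$ are linearly independent sets. The $k$-th bilinear secant variety of $X$ is $\operatorname{BS}_k(X)=\operatorname{BJ}(X,\dots,X)$ ($k$ copies). *)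

theory Defs
  imports
    "HOL-Computational_Algebra.Polynomial"
    "HOL-Library.Function_Algebras"
    "HOL-Library.Poly_Mapping"
    "HOL-Library.Extended_Nat"
    "HOL-Analysis.Abstract_Topology"
    "Jordan_Normal_Form.Determinant"
    "Jordan_Normal_Form.DL_Submatrix"
begin

abbreviation lookup :: "('k \<Rightarrow>\<^sub>0 'b::zero) \<Rightarrow> 'k \<Rightarrow> 'b" where "lookup \<equiv> Poly_Mapping.lookup"
abbreviation keys :: "('k \<Rightarrow>\<^sub>0 'b::zero) \<Rightarrow> 'k set" where "keys \<equiv> Poly_Mapping.keys"

section \<open>Projective space\<close>

definition vscale :: "'a::field \<Rightarrow> (nat \<Rightarrow> 'a) \<Rightarrow> (nat \<Rightarrow> 'a)" where
  "vscale c v = (\<lambda>i. c * v i)"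

interpretation fv: vector_space "vscale :: 'a::field \<Rightarrow> (nat \<Rightarrow> 'a) \<Rightarrow> (nat \<Rightarrow> 'a)"
  by unfold_locales (auto simp: vscale_def fun_eq_iff algebra_simps)

text \<open>The vector space of dimension \<open>n + 1\<close> is the space of sequences vanishing beyond index \<open>n\<close>;
  a point of projective \<open>n\<close>-space is the class of its nonzero representatives.\<close>

definition cvec :: "nat \<Rightarrow> (nat \<Rightarrow> 'a::field) set" where
  "cvec n = {v. \<forall>i>n. v i = 0}"

definition proportional :: "nat \<Rightarrow> ((nat \<Rightarrow> 'a::field) \<times> (nat \<Rightarrow> 'a)) set" where
  "proportional n = {(v, w). v \<in> cvec n - {0} \<and> w \<in> cvec n - {0} \<and> (\<exists>c. c \<noteq> 0 \<and> w = vscale c v)}"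

definition Proj :: "nat \<Rightarrow> (nat \<Rightarrow> 'a::field) set set" where
  "Proj n = (cvec n - {0}) // proportional n"

type_synonym 'a bipoint = "(nat \<Rightarrow> 'a) set \<times> (nat \<Rightarrow> 'a) set"

definition indep_points :: "'i set \<Rightarrow> ('i \<Rightarrow> (nat \<Rightarrow> 'a::field) set) \<Rightarrow> bool" where
  "indep_points I p \<longleftrightarrow>
     (\<exists>v. (\<forall>i\<in>I. v i \<in> p i) \<and> inj_on v I \<and> fv.independent (v ` I))"

definition proj_span :: "nat \<Rightarrow> (nat \<Rightarrow> 'a::field) set set \<Rightarrow> (nat \<Rightarrow> 'a) set set" where
  "proj_span n P = {q \<in> Proj n. q \<subseteq> fv.span (\<Union>P)}"

section \<open>Bihomogeneous polynomials and their zero loci\<close>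

text \<open>Polynomials in the variables \<open>Inl 0, Inl 1, \<dots>\<close> (first factor) and
  \<open>Inr 0, Inr 1, \<dots>\<close> (second factor).\<close>

type_synonym 'a bipoly = "((nat + nat) \<Rightarrow>\<^sub>0 nat) \<Rightarrow>\<^sub>0 'a"

definition monom_val :: "('v \<Rightarrow> 'a::comm_semiring_1) \<Rightarrow> ('v \<Rightarrow>\<^sub>0 nat) \<Rightarrow> 'a" where
  "monom_val a m = (\<Prod>v\<in>keys m. a v ^ lookup m v)"

definition poly_val :: "('v \<Rightarrow> 'a::comm_semiring_1) \<Rightarrow> (('v \<Rightarrow>\<^sub>0 nat) \<Rightarrow>\<^sub>0 'a) \<Rightarrow> 'a" where
  "poly_val a f = (\<Sum>m\<in>keys f. lookup f m * monom_val a m)"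

definition pscale :: "'a::field \<Rightarrow> 'a bipoly \<Rightarrow> 'a bipoly" where
  "pscale c f = Poly_Mapping.single 0 c * f"

interpretation pv: vector_space "pscale :: 'a::field \<Rightarrow> 'a bipoly \<Rightarrow> 'a bipoly"
proof unfold_locales
  fix a b :: 'a and x y :: "'a bipoly"
  show "pscale a (x + y) = pscale a x + pscale a y" "pscale (a + b) x = pscale a x + pscale b x"
    by (simp_all add: pscale_def algebra_simps single_add)
  show "pscale a (pscale b x) = pscale (a * b) x"
    by (simp add: pscale_def mult_single flip: mult.assoc)
  show "pscale 1 x = x" by (simp add: pscale_def)
qed

text \<open>A span of the polynomial ring as a module over itself is the ideal generated by a set.\<close>

interpretation ideal: Modules.module "(*) :: 'a::field bipoly \<Rightarrow> 'a bipoly \<Rightarrow> 'a bipoly"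
  by unfold_locales (simp_all add: algebra_simps)

definition bihom :: "nat \<Rightarrow> nat \<Rightarrow> nat \<Rightarrow> nat \<Rightarrow> 'a::field bipoly set" where
  "bihom n m a b = {f. \<forall>t\<in>keys f. keys t \<subseteq> Inl ` {..n} \<union> Inr ` {..m} \<and>
     (\<Sum>i\<le>n. lookup t (Inl i)) = a \<and> (\<Sum>j\<le>m. lookup t (Inr j)) = b}"

definition bihom_forms :: "nat \<Rightarrow> nat \<Rightarrow> 'a::field bipoly set" where
  "bihom_forms n m = {f. \<exists>a b. f \<in> bihom n m a b}"

definition vanishes_at :: "'a::field bipoly \<Rightarrow> 'a bipoint \<Rightarrow> bool" where
  "vanishes_at f z \<longleftrightarrow> (\<forall>v\<in>fst z. \<forall>w\<in>snd z. poly_val (case_sum v w) f = 0)"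

definition zero_locus :: "nat \<Rightarrow> nat \<Rightarrow> 'a::field bipoly set \<Rightarrow> 'a bipoint set" where
  "zero_locus n m F = {z \<in> Proj n \<times> Proj m. \<forall>f\<in>F. vanishes_at f z}"

definition zariski :: "nat \<Rightarrow> nat \<Rightarrow> 'a::field bipoint topology" where
  "zariski n m = topology (\<lambda>U. \<exists>F. F \<subseteq> bihom_forms n m \<and>
     U = Proj n \<times> Proj m - zero_locus n m F)"

lemma poly_val_superset:
  assumes "finite A" "keys f \<subseteq> A"
  shows "poly_val a f = (\<Sum>m\<in>A. lookup f m * monom_val a m)"
  unfolding poly_val_def using assms
  by (intro sum.mono_neutral_left) (auto simp: in_keys_iff)

lemma monom_val_superset:
  assumes "finite A" "keys m \<subseteq> A"
  shows "monom_val a m = (\<Prod>v\<in>A. a v ^ lookup m v)"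
  unfolding monom_val_def using assms
  by (intro prod.mono_neutral_left) (auto simp: in_keys_iff)

lemma monom_val_add: "monom_val a (s + t) = monom_val a s * monom_val a t"
proof -
  let ?A = "keys s \<union> keys t"
  have "monom_val a (s + t) = (\<Prod>v\<in>?A. a v ^ lookup (s + t) v)"
    by (rule monom_val_superset) (simp, rule keys_add)
  also have "\<dots> = (\<Prod>v\<in>?A. a v ^ lookup s v) * (\<Prod>v\<in>?A. a v ^ lookup t v)"
    by (simp add: lookup_add power_add prod.distrib)
  also have "\<dots> = monom_val a s * monom_val a t"
    by (simp add: monom_val_superset[of ?A])
  finally show ?thesis .
qed

lemma poly_val_add: "poly_val a (f + g) = poly_val a f + poly_val a g"
proof -
  let ?A = "keys f \<union> keys g"
  have "poly_val a (f + g) = (\<Sum>m\<in>?A. lookup (f + g) m * monom_val a m)"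
    by (rule poly_val_superset) (simp, rule keys_add)
  also have "\<dots> = (\<Sum>m\<in>?A. lookup f m * monom_val a m) + (\<Sum>m\<in>?A. lookup g m * monom_val a m)"
    by (simp add: lookup_add algebra_simps sum.distrib)
  also have "\<dots> = poly_val a f + poly_val a g"
    by (simp add: poly_val_superset[of ?A])
  finally show ?thesis .
qed

lemma poly_val_zero [simp]: "poly_val a 0 = 0"
  by (simp add: poly_val_def)

lemma poly_val_sum: "poly_val a (sum F A) = (\<Sum>i\<in>A. poly_val a (F i))"
  by (induction A rule: infinite_finite_induct) (auto simp: poly_val_add)

lemma poly_val_single: "poly_val a (Poly_Mapping.single m c) = c * monom_val a m"
  by (simp add: poly_val_def)

lemma poly_mapping_eq_sum_single:
  "f = (\<Sum>m\<in>keys f. Poly_Mapping.single m (lookup f m))"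
  by (rule poly_mapping_eqI) (auto simp: lookup_sum lookup_single when_def in_keys_iff)

lemma poly_val_mult: "poly_val a (f * g) = poly_val a f * poly_val a g"
proof -
  have "f * g = (\<Sum>s\<in>keys f. Poly_Mapping.single s (lookup f s)) *
      (\<Sum>t\<in>keys g. Poly_Mapping.single t (lookup g t))"
    using poly_mapping_eq_sum_single[of f] poly_mapping_eq_sum_single[of g] by simp
  also have "\<dots> = (\<Sum>s\<in>keys f. \<Sum>t\<in>keys g.
      Poly_Mapping.single (s + t) (lookup f s * lookup g t))"
    by (simp add: sum_product mult_single)
  also have "poly_val a \<dots> = poly_val a f * poly_val a g"
    unfolding poly_val_sum poly_val_single monom_val_add
    by (simp add: poly_val_def sum_product ac_simps)
  finally show ?thesis .
qed

lemma monom_val_bihom: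
  assumes "keys t \<subseteq> Inl ` {..n} \<union> Inr ` {..m}"
  shows "monom_val (case_sum (vscale c v) (vscale d w)) t =
    c ^ (\<Sum>i\<le>n. lookup t (Inl i)) * d ^ (\<Sum>j\<le>m. lookup t (Inr j)) * monom_val (case_sum v w) t"
proof -
  let ?A = "Inl ` {..n} \<union> Inr ` {..m} :: (nat + nat) set"
  have split: "monom_val e t = (\<Prod>i\<le>n. e (Inl i) ^ lookup t (Inl i)) *
      (\<Prod>j\<le>m. e (Inr j) ^ lookup t (Inr j))" for e :: "nat + nat \<Rightarrow> 'a"
  proof -
    have "monom_val e t = (\<Prod>u\<in>?A. e u ^ lookup t u)"
      by (rule monom_val_superset) (use assms in auto)
    also have "\<dots> = (\<Prod>u\<in>Inl ` {..n}. e u ^ lookup t u) * (\<Prod>u\<in>Inr ` {..m}. e u ^ lookup t u)"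
      by (rule prod.union_disjoint) auto
    finally show ?thesis by (simp add: prod.reindex)
  qed
  show ?thesis
    by (simp add: split vscale_def power_mult_distrib prod.distrib power_sum ac_simps)
qed

lemma poly_val_bihom:
  assumes "f \<in> bihom n m a b"
  shows "poly_val (case_sum (vscale c v) (vscale d w)) f =
    c ^ a * d ^ b * poly_val (case_sum v w) f"
  unfolding poly_val_def sum_distrib_left
proof (rule sum.cong[OF refl])
  fix t assume "t \<in> keys f"
  then show "lookup f t * monom_val (case_sum (vscale c v) (vscale d w)) t =
      c ^ a * d ^ b * (lookup f t * monom_val (case_sum v w) t)"
    using assms monom_val_bihom[of t n m c v d w] by (auto simp: bihom_def)
qed

lemma Proj_rep:
  assumes "p \<in> Proj n"
  obtains v where "v \<in> p" "v \<in> cvec n" "v \<noteq> 0" "p = {vscale c v |c. c \<noteq> 0}"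
proof -
  from assms obtain v where v: "v \<in> cvec n" "v \<noteq> 0" "p = proportional n `` {v}"
    by (auto simp: Proj_def quotient_def)
  have "p = {vscale c v |c. c \<noteq> 0}"
    using v by (auto simp: proportional_def cvec_def vscale_def fun_eq_iff)
  moreover have "v \<in> p" using calculation by (auto intro: exI[of _ 1])
  ultimately show ?thesis using that v by blast
qed

lemma vanishes_at_iff:
  assumes "f \<in> bihom n m a b" "p \<in> Proj n" "q \<in> Proj m" "v \<in> p" "w \<in> q"
  shows "vanishes_at f (p, q) \<longleftrightarrow> poly_val (case_sum v w) f = 0"
proof -
  obtain v0 where v0: "p = {vscale c v0 |c. c \<noteq> 0}" by (rule Proj_rep[OF assms(2)])
  obtain w0 where w0: "q = {vscale c w0 |c. c \<noteq> 0}" by (rule Proj_rep[OF assms(3)])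
  have "poly_val (case_sum v' w') f = 0 \<longleftrightarrow> poly_val (case_sum v0 w0) f = 0"
    if "v' \<in> p" "w' \<in> q" for v' w'
    using that poly_val_bihom[OF assms(1)] unfolding v0 w0 by fastforce
  then show ?thesis
    using assms(4,5) unfolding vanishes_at_def fst_conv snd_conv by blast
qed

lemma bihom_mult:
  assumes "f \<in> bihom n m a b" "g \<in> bihom n m a' b'"
  shows "f * g \<in> bihom n m (a + a') (b + b')"
proof -
  have "keys t \<subseteq> Inl ` {..n} \<union> Inr ` {..m} \<and>
     (\<Sum>i\<le>n. lookup t (Inl i)) = a + a' \<and> (\<Sum>j\<le>m. lookup t (Inr j)) = b + b'"
    if "t \<in> keys (f * g)" for t
  proof -
    obtain s u where su: "t = s + u" "s \<in> keys f" "u \<in> keys g"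
      using \<open>t \<in> keys (f * g)\<close> keys_mult[of f g] by blast
    have "keys s \<union> keys u \<subseteq> Inl ` {..n} \<union> Inr ` {..m}"
      using su assms unfolding bihom_def by blast
    with keys_add[of s u] have "keys t \<subseteq> Inl ` {..n} \<union> Inr ` {..m}"
      unfolding su(1) by (rule subset_trans)
    with su assms show ?thesis
      by (simp add: bihom_def lookup_add sum.distrib)
  qed
  then show ?thesis by (auto simp: bihom_def)
qed

lemma istopology_zariski:
  "istopology (\<lambda>U. \<exists>F. F \<subseteq> bihom_forms n m \<and>
     U = Proj n \<times> Proj m - zero_locus n m (F :: 'a::field bipoly set))"
  unfolding istopology_def
proof (intro conjI allI impI)
  fix S T :: "'a bipoint set"
  let ?H = "bihom_forms n m :: 'a bipoly set"
  assume "\<exists>F. F \<subseteq> ?H \<and> S = Proj n \<times> Proj m - zero_locus n m F"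
    and "\<exists>F. F \<subseteq> ?H \<and> T = Proj n \<times> Proj m - zero_locus n m F"
  then obtain F G where F: "F \<subseteq> ?H" "S = Proj n \<times> Proj m - zero_locus n m F"
    and G: "G \<subseteq> ?H" "T = Proj n \<times> Proj m - zero_locus n m G" by blast
  let ?P = "{f * g |f g. f \<in> F \<and> g \<in> G}"
  have prod: "vanishes_at (f * g) z \<longleftrightarrow> vanishes_at f z \<or> vanishes_at g z"
    if "f \<in> F" "g \<in> G" "z \<in> Proj n \<times> Proj m" for f g z
  proof -
    obtain a b a' b' where ab: "f \<in> bihom n m a b" "g \<in> bihom n m a' b'"
      using \<open>f \<in> F\<close> \<open>g \<in> G\<close> subsetD[OF F(1)] subsetD[OF G(1)] unfolding bihom_forms_def by blast
    obtain p q where z: "z = (p, q)" "p \<in> Proj n" "q \<in> Proj m"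
      using \<open>z \<in> Proj n \<times> Proj m\<close> by auto
    obtain v w where "v \<in> p" "w \<in> q" by (rule Proj_rep[OF z(2)], rule Proj_rep[OF z(3)])
    then show ?thesis
      using ab z bihom_mult[OF ab] by (simp add: vanishes_at_iff poly_val_mult)
  qed
  have "zero_locus n m ?P = zero_locus n m F \<union> zero_locus n m G"
    using prod unfolding zero_locus_def by blast
  moreover have "?P \<subseteq> ?H"
  proof
    fix h assume "h \<in> ?P"
    then obtain f g where h: "h = f * g" "f \<in> F" "g \<in> G"
      unfolding mem_Collect_eq by (elim exE conjE)
    from h(2,3) obtain a b a' b' where "f \<in> bihom n m a b" "g \<in> bihom n m a' b'"
      using subsetD[OF F(1)] subsetD[OF G(1)] unfolding bihom_forms_def by blast
    then have "h \<in> bihom n m (a + a') (b + b')" unfolding h(1) by (rule bihom_mult)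
    then show "h \<in> ?H" unfolding bihom_forms_def by blast
  qed
  ultimately show "\<exists>F. F \<subseteq> ?H \<and> S \<inter> T = Proj n \<times> Proj m - zero_locus n m F"
    unfolding F(2) G(2) by (intro exI[of _ ?P] conjI) (assumption, simp add: Diff_Un)
next
  fix K :: "'a bipoint set set"
  let ?H = "bihom_forms n m :: 'a bipoly set"
  assume "\<forall>U\<in>K. \<exists>F. F \<subseteq> ?H \<and> U = Proj n \<times> Proj m - zero_locus n m F"
  then have "\<exists>F. \<forall>U\<in>K. F U \<subseteq> ?H \<and> U = Proj n \<times> Proj m - zero_locus n m (F U)"
    by (rule bchoice)
  then obtain F where F: "\<And>U. U \<in> K \<Longrightarrow> F U \<subseteq> ?H"
    "\<And>U. U \<in> K \<Longrightarrow> U = Proj n \<times> Proj m - zero_locus n m (F U)"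
    by auto
  have "(\<lambda>U. U) ` K = (\<lambda>U. Proj n \<times> Proj m - zero_locus n m (F U)) ` K"
    by (rule image_cong[OF refl F(2)])
  then have "\<Union>K = (\<Union>U\<in>K. Proj n \<times> Proj m - zero_locus n m (F U))"
    by (simp only: image_ident)
  also have "\<dots> = Proj n \<times> Proj m - zero_locus n m (\<Union>U\<in>K. F U)"
    by (auto simp: zero_locus_def)
  finally show "\<exists>F. F \<subseteq> ?H \<and> \<Union>K = Proj n \<times> Proj m - zero_locus n m F"
  proof (intro exI conjI)
    show "(\<Union>U\<in>K. F U) \<subseteq> ?H" by (rule UN_least) (rule F(1))
  qed
qed

lemma openin_zariski:
  "openin (zariski n m) U \<longleftrightarrow>
     (\<exists>F. F \<subseteq> bihom_forms n m \<and> U = Proj n \<times> Proj m - zero_locus n m F)"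
  unfolding zariski_def by (subst topology_inverse'[OF istopology_zariski]) (rule refl)

lemma topspace_zariski: "topspace (zariski n m) = (Proj n \<times> Proj m :: 'a::field bipoint set)"
proof
  have one: "(1 :: 'a bipoly) \<in> bihom n m 0 0"
    by (auto simp: bihom_def)
  have nv: "\<not> vanishes_at 1 z" if z: "z \<in> Proj n \<times> Proj m" for z :: "'a bipoint"
  proof -
    obtain p q where pq: "z = (p, q)" "p \<in> Proj n" "q \<in> Proj m" using z by auto
    obtain v w where "v \<in> p" "w \<in> q" by (rule Proj_rep[OF pq(2)], rule Proj_rep[OF pq(3)])
    then show ?thesis
      using pq one by (simp add: vanishes_at_iff poly_val_def monom_val_def)
  qed
  have "openin (zariski n m) (Proj n \<times> Proj m :: 'a bipoint set)"
    unfolding openin_zariski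
    by (rule exI[of _ "{1}"]) (use one nv in \<open>auto simp: zero_locus_def bihom_forms_def\<close>)
  then show "Proj n \<times> Proj m \<subseteq> topspace (zariski n m :: 'a bipoint topology)"
    by (rule openin_subset)
  show "topspace (zariski n m :: 'a bipoint topology) \<subseteq> Proj n \<times> Proj m"
    using openin_topspace[of "zariski n m :: 'a bipoint topology"]
    unfolding openin_zariski by (elim exE conjE) (erule ssubst, rule Diff_subset)
qed

lemma closedin_zariski:
  fixes Z :: "'a::field bipoint set"
  shows "closedin (zariski n m) Z \<longleftrightarrow> (\<exists>F. F \<subseteq> bihom_forms n m \<and> Z = zero_locus n m F)"
proof -
  let ?P = "Proj n \<times> Proj m :: 'a bipoint set"
  have sub: "zero_locus n m F \<subseteq> ?P" for F :: "'a bipoly set"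
    unfolding zero_locus_def by (rule Collect_subset)
  have "Z \<subseteq> ?P \<and> ?P - Z = ?P - zero_locus n m F \<longleftrightarrow> Z = zero_locus n m F"
    for F :: "'a bipoly set"
    using sub[of F] double_diff[of _ ?P ?P] by (metis subset_refl)
  then show ?thesis
    unfolding closedin_def topspace_zariski openin_zariski by metis
qed

section \<open>Irreducibility and dimension\<close>

definition irreducible_in :: "'p topology \<Rightarrow> 'p set \<Rightarrow> bool" where
  "irreducible_in T Z \<longleftrightarrow> Z \<noteq> {} \<and> Z \<subseteq> topspace T \<and>
     (\<forall>A B. closedin T A \<and> closedin T B \<and> Z \<subseteq> A \<union> B \<longrightarrow> Z \<subseteq> A \<or> Z \<subseteq> B)"

text \<open>Krull dimension of a nonempty topological space.\<close>

definition krull_dim :: "'p topology \<Rightarrow> enat" where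
  "krull_dim T = Sup {enat d |d. \<exists>Z :: nat \<Rightarrow> 'p set.
     (\<forall>i\<le>d. closedin T (Z i) \<and> irreducible_in T (Z i)) \<and> (\<forall>i<d. Z i \<subset> Z (Suc i))}"

definition variety_dim :: "nat \<Rightarrow> nat \<Rightarrow> 'a::field bipoint set \<Rightarrow> enat" where
  "variety_dim n m X = krull_dim (subtopology (zariski n m) X)"

section \<open>Bidegree of a curve\<close>

definition vanishing_forms :: "nat \<Rightarrow> nat \<Rightarrow> 'a::field bipoint set \<Rightarrow> 'a bipoly set" where
  "vanishing_forms n m X = {f \<in> bihom_forms n m. \<forall>z\<in>X. vanishes_at f z}"

text \<open>The intersection number of a curve \<open>C\<close> with the divisor of a form \<open>h\<close> not vanishing
  identically on \<open>C\<close> is the length of the intersection scheme, that is the number of intersection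
  points counted with multiplicity. The scheme is cut out by \<open>I(C) + (h)\<close>, and being
  zero-dimensional its length is the dimension of the bidegree \<open>(s, t)\<close> part of the coordinate
  ring modulo \<open>I(C) + (h)\<close> for all large \<open>s\<close> and \<open>t\<close>. The polynomial ring here has
  infinitely many variables, but the forms of bidegree \<open>(s, t)\<close> in the ideal generated there by
  elements of the coordinate ring of the product are those in the ideal generated in
  that coordinate ring.\<close>

definition has_intersection_number ::
  "nat \<Rightarrow> nat \<Rightarrow> 'a::field bipoint set \<Rightarrow> 'a bipoly \<Rightarrow> nat \<Rightarrow> bool" where
  "has_intersection_number n m C h d \<longleftrightarrow> (\<exists>N. \<forall>s\<ge>N. \<forall>t\<ge>N.
     pv.dim (bihom n m s t :: 'a bipoly set) =
     pv.dim (bihom n m s t \<inter> ideal.span (insert h (vanishing_forms n m C))) + d)"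

definition has_bidegree ::
  "nat \<Rightarrow> nat \<Rightarrow> 'a::field bipoint set \<Rightarrow> nat \<Rightarrow> nat \<Rightarrow> bool" where
  "has_bidegree n m C a b \<longleftrightarrow>
     (\<forall>h\<in>bihom n m 1 0. (\<exists>z\<in>C. \<not> vanishes_at h z) \<longrightarrow> has_intersection_number n m C h a) \<and>
     (\<forall>h\<in>bihom n m 0 1. (\<exists>z\<in>C. \<not> vanishes_at h z) \<longrightarrow> has_intersection_number n m C h b)"

definition irreducible_curve :: "nat \<Rightarrow> nat \<Rightarrow> 'a::field bipoint set \<Rightarrow> bool" where
  "irreducible_curve n m C \<longleftrightarrow>
     closedin (zariski n m) C \<and> irreducible_in (zariski n m) C \<and> variety_dim n m C = 1"

section \<open>The distinguished rational curve\<close>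

text \<open>More than \<open>n + 1\<close> points of projective \<open>n\<close>-space are never independent; a configuration of
  \<open>n + 3\<close> points is general when its projections to both factors are in linearly general position:
  any \<open>n + 1\<close> of the projections to the first factor, and any \<open>n + 2\<close> of those to the second
  factor, are independent.\<close>

definition general_configuration :: "nat \<Rightarrow> (nat \<Rightarrow> 'a::field bipoint) \<Rightarrow> bool" where
  "general_configuration n p \<longleftrightarrow>
     (\<forall>i<n + 3. p i \<in> Proj n \<times> Proj (n + 1)) \<and>
     (\<forall>I \<subseteq> {..<n + 3}. card I = n + 1 \<longrightarrow> indep_points I (fst \<circ> p)) \<and>
     (\<forall>I \<subseteq> {..<n + 3}. card I = n + 2 \<longrightarrow> indep_points I (snd \<circ> p))"

definition passes_with_bidegree ::
  "nat \<Rightarrow> (nat \<Rightarrow> 'a::field bipoint) \<Rightarrow> 'a bipoint set \<Rightarrow> bool" where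
  "passes_with_bidegree n p C \<longleftrightarrow>
     irreducible_curve n (n + 1) C \<and> has_bidegree n (n + 1) C n (n + 1) \<and> (\<forall>i<n + 3. p i \<in> C)"

definition distinguished_curve ::
  "nat \<Rightarrow> (nat \<Rightarrow> 'a::field bipoint) \<Rightarrow> 'a bipoint set \<Rightarrow> bool" where
  "distinguished_curve n p C \<longleftrightarrow>
     passes_with_bidegree n p C \<and> (\<forall>D. passes_with_bidegree n p D \<longrightarrow> D = C)"

text \<open>Homogeneous coordinates on the two factors are bases of the spaces of forms of bidegree
  \<open>(1, 0)\<close> and \<open>(0, 1)\<close>.\<close>

definition homogeneous_coordinates ::
  "nat \<Rightarrow> nat \<Rightarrow> (nat \<Rightarrow> 'a::field bipoly) \<Rightarrow> (nat \<Rightarrow> 'a bipoly) \<Rightarrow> bool" where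
  "homogeneous_coordinates n m x y \<longleftrightarrow>
     inj_on x {..n} \<and> pv.independent (x ` {..n}) \<and> pv.span (x ` {..n}) = bihom n m 1 0 \<and>
     inj_on y {..m} \<and> pv.independent (y ` {..m}) \<and> pv.span (y ` {..m}) = bihom n m 0 1"

text \<open>The first \<open>n - k + 1\<close> columns are those in the \<open>x i\<close>, the last \<open>n - k + 2\<close> those in the
  \<open>y j\<close>; used for \<open>k \<le> n\<close> only, where the subtractions do not truncate.\<close>

definition M :: "nat \<Rightarrow> nat \<Rightarrow> (nat \<Rightarrow> 'a::field bipoly) \<Rightarrow> (nat \<Rightarrow> 'a bipoly) \<Rightarrow> 'a bipoly mat" where
  "M n k x y = mat (k + 1) ((n - k + 1) + (n - k + 2))
     (\<lambda>(i, j). if j < n - k + 1 then x (i + j) else y (i + (j - (n - k + 1))))"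

definition minors :: "nat \<Rightarrow> 'r::comm_ring_1 mat \<Rightarrow> 'r set" where
  "minors r A = {det (submatrix A I J) |I J.
     I \<subseteq> {..<dim_row A} \<and> J \<subseteq> {..<dim_col A} \<and> card I = r \<and> card J = r}"

section \<open>Bilinear joins and secant varieties\<close>

definition general_points :: "nat \<Rightarrow> (nat \<Rightarrow> 'a::field bipoint) \<Rightarrow> bool" where
  "general_points k z \<longleftrightarrow> indep_points {..<k} (fst \<circ> z) \<and> indep_points {..<k} (snd \<circ> z)"

definition bilinear_span :: "nat \<Rightarrow> nat \<Rightarrow> nat \<Rightarrow> (nat \<Rightarrow> 'a::field bipoint) \<Rightarrow> 'a bipoint set" where
  "bilinear_span n m k z =
     proj_span n ((fst \<circ> z) ` {..<k}) \<times> proj_span m ((snd \<circ> z) ` {..<k})"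

definition bilinear_join ::
  "nat \<Rightarrow> nat \<Rightarrow> nat \<Rightarrow> (nat \<Rightarrow> 'a::field bipoint set) \<Rightarrow> 'a bipoint set" where
  "bilinear_join n m k X = zariski n m closure_of
     (\<Union>z \<in> {z. (\<forall>i<k. z i \<in> X i) \<and> general_points k z}. bilinear_span n m k z)"

definition bilinear_secant ::
  "nat \<Rightarrow> nat \<Rightarrow> nat \<Rightarrow> 'a::field bipoint set \<Rightarrow> 'a bipoint set" where
  "bilinear_secant n m k X = bilinear_join n m k (\<lambda>_. X)"

end

theory Submission
  imports Defs
begin

text \<open>Write \<open>m = n + 1\<close>. A coordinate vector \<open>\<xi>\<close> pairs with polynomials by \<open>T ^ i \<mapsto> \<xi> i\<close>. A vector in the left
kernel of the Hankel-type matrix at a point with coordinates \<open>(\<xi>, \<eta>)\<close> is then the coefficient vector of a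
polynomial \<open>q \<noteq> 0\<close> of degree at most \<open>k\<close> that annihilates \<open>\<xi>\<close> and \<open>\<eta>\<close>: both vanish on those multiples of
\<open>q\<close> whose degrees they see. So the common zeros of the maximal minors are the pairs with a common
annihilator of degree at most \<open>k\<close> (\<open>maximal_minors_vanish_iff\<close>, \<open>pt_in_locus_iff\<close>).

A point of the curve is annihilated by a nonzero polynomial of degree at most 1, and the product of \<open>k\<close> such
polynomials annihilates the bilinear span of the \<open>k\<close> points; hence the secant variety lies in the zero locus
(\<open>secant_union_subset_locus\<close>). Conversely, if \<open>q\<close> has \<open>k\<close> distinct roots \<open>t r\<close>, Lagrange interpolation
writes the annihilated vectors as combinations of the power vectors \<open>(t r ^ i)\<close>, so the point lies in the
bilinear span of \<open>k\<close> points of the curve (\<open>annihilates_imp_power_sum\<close>,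
\<open>powersum_points_subset_secant_union\<close>). A general \<open>q\<close>, whose roots may collide or lie at infinity, is
deformed to one with distinct finite roots, and Cramer's rule carries \<open>(\<xi>, \<eta>)\<close> along polynomially in the
deformation parameter. A form that vanishes on the general member of such a family vanishes on the special one
(\<open>kernel_lift\<close>, \<open>distinct_root_deformation\<close>, \<open>locus_subset_closure_powersum_points\<close>). So the zero locus
is the closure of the image of the affine space of parameters \<open>a r, b r, t r\<close> under
\<open>\<xi> i = (\<Sum>r<k. a r * t r ^ i)\<close>, \<open>\<eta> i = (\<Sum>r<k. b r * t r ^ i)\<close>; in particular it is irreducible
(\<open>irreducible_image_points\<close>).

For the dimension, a chain \<open>Z 0 \<subset> \<dots> \<subset> Z d\<close> of irreducible closed sets yields \<open>d + 2\<close> forms that are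
algebraically independent on the cone over \<open>Z d\<close>: two coordinates that do not vanish at a point of \<open>Z 0\<close>,
and at each step a form vanishing on \<open>Z i\<close> but not on \<open>Z (i + 1)\<close> (\<open>chain_alg_independent\<close>). By counting
monomials, \<open>N\<close> parameters carry at most \<open>N\<close> algebraically independent polynomial functions, so \<open>d + 2\<close> is
bounded by the number \<open>3 * k\<close> of parameters above and by the number \<open>n + m + 2\<close> of coordinates
(\<open>chain_le_parameters\<close>). A chain of the maximal length comes from switching on the parameters one at a
time in the order \<open>b 0, a 0, t 0, b 1, a 1, t 1, \<dots>\<close>: with \<open>N\<close> parameters free, the points lie in a
Hankel locus that does not contain all points with \<open>N + 1\<close> free parameters, as long as \<open>N + 1\<close> exceeds
neither bound (\<open>stratum_subset_locus\<close>, \<open>stratum_not_subset_locus\<close>).\<close>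

section \<open>Linear systems and maximal minors\<close>

lemma underdetermined_system:
  fixes m :: "'i \<Rightarrow> 'j \<Rightarrow> 'a::field"
  assumes "finite J" "finite I" "card J < card I"
  shows "\<exists>c. (\<exists>i\<in>I. c i \<noteq> 0) \<and> (\<forall>j\<in>J. (\<Sum>i\<in>I. c i * m i j) = 0)"
  using assms
proof (induction J arbitrary: I m rule: finite_induct)
  case empty
  then obtain i where "i \<in> I" by fastforce
  then show ?case by (intro exI[of _ "\<lambda>_. 1"]) auto
next
  case (insert j J)
  show ?case
  proof (cases "\<forall>i\<in>I. m i j = 0")
    case True
    have "card J < card I" using insert by simp
    then obtain c where "\<exists>i\<in>I. c i \<noteq> 0" "\<forall>j\<in>J. (\<Sum>i\<in>I. c i * m i j) = 0"
      using insert.IH[OF insert.prems(1)] by blast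
    then show ?thesis using True by (intro exI[of _ c]) auto
  next
    case False
    then obtain i0 where i0: "i0 \<in> I" "m i0 j \<noteq> 0" by blast
    define m' where "m' i l = m i l - m i j / m i0 j * m i0 l" for i l
    have "card J < card (I - {i0})" using insert i0 by simp
    then obtain c where c: "\<exists>i\<in>I - {i0}. c i \<noteq> 0"
      "\<forall>l\<in>J. (\<Sum>i\<in>I - {i0}. c i * m' i l) = 0"
      using insert.IH[of "I - {i0}" m'] insert.prems(1) by blast
    define s where "s = (\<Sum>i\<in>I - {i0}. c i * m i j / m i0 j)"
    define c' where "c' = c(i0 := - s)"
    have eq: "(\<Sum>i\<in>I. c' i * m i l) = (\<Sum>i\<in>I - {i0}. c i * m' i l)" for l
    proof -
      have "(\<Sum>i\<in>I. c' i * m i l) = - s * m i0 l + (\<Sum>i\<in>I - {i0}. c i * m i l)"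
        unfolding sum.remove[OF insert.prems(1) i0(1)] by (simp add: c'_def)
      also have "\<dots> = (\<Sum>i\<in>I - {i0}. c i * m' i l)"
        by (simp add: m'_def s_def algebra_simps sum_subtractf sum_distrib_left)
      finally show ?thesis .
    qed
    have "\<forall>l\<in>insert j J. (\<Sum>i\<in>I. c' i * m i l) = 0"
      using c(2) i0(2) unfolding eq by (auto simp: m'_def)
    moreover have "\<exists>i\<in>I. c' i \<noteq> 0" using c(1) unfolding c'_def by auto
    ultimately show ?thesis by blast
  qed
qed

text \<open>Take a minimal set of columns that still has trivial left kernel. It cannot have fewer than \<open>r\<close> elements,
because \<open>r\<close> unknowns subject to fewer equations have a nonzero solution; it cannot have more, because
minimality gives for each of its columns a vector killing all the other ones but not this one, and these vectors
would be linearly dependent.\<close>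

lemma full_row_rank_columns:
  fixes a :: "nat \<Rightarrow> nat \<Rightarrow> 'a::field"
  assumes ind: "\<forall>q. (\<forall>j<c. (\<Sum>i<r. q i * a i j) = 0) \<longrightarrow> (\<forall>i<r. q i = 0)"
  shows "\<exists>J\<subseteq>{..<c}. card J = r \<and>
    (\<forall>q. (\<forall>j\<in>J. (\<Sum>i<r. q i * a i j) = 0) \<longrightarrow> (\<forall>i<r. q i = 0))"
proof -
  define P where "P J \<longleftrightarrow> (\<forall>q. (\<forall>j\<in>J. (\<Sum>i<r. q i * a i j) = 0) \<longrightarrow> (\<forall>i<r. q i = 0))" for J
  have "{..<c} \<subseteq> {..<c} \<and> P {..<c}" using ind by (simp add: P_def)
  from ex_has_least_nat[of "\<lambda>J. J \<subseteq> {..<c} \<and> P J", OF this, of card]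
  obtain J where J: "J \<subseteq> {..<c}" "P J"
    and min: "\<And>J'. J' \<subseteq> {..<c} \<Longrightarrow> P J' \<Longrightarrow> card J \<le> card J'"
    by auto
  have fin: "finite J" using J(1) finite_subset by blast
  have "\<not> card J < r"
  proof
    assume "card J < r"
    then obtain q where "\<exists>i\<in>{..<r}. q i \<noteq> 0" "\<forall>j\<in>J. (\<Sum>i<r. q i * a i j) = 0"
      using underdetermined_system[OF fin, of "{..<r}" a] by auto
    then show False using J(2) unfolding P_def by blast
  qed
  moreover have "\<not> r < card J"
  proof
    assume "r < card J"
    have "\<exists>q. (\<forall>l\<in>J - {j}. (\<Sum>i<r. q i * a i l) = 0) \<and> (\<Sum>i<r. q i * a i j) \<noteq> 0"
      if "j \<in> J" for j
    proof -
      have "\<not> P (J - {j})"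
        using min[of "J - {j}"] J(1) card_Diff1_less[OF fin that] by auto
      then obtain q where q: "\<forall>l\<in>J - {j}. (\<Sum>i<r. q i * a i l) = 0" "\<not> (\<forall>i<r. q i = 0)"
        unfolding P_def by blast
      then have "(\<Sum>i<r. q i * a i j) \<noteq> 0"
        using J(2) unfolding P_def by (metis Diff_iff singletonD)
      then show ?thesis using q(1) by blast
    qed
    then obtain q where q: "\<And>j l. j \<in> J \<Longrightarrow> l \<in> J - {j} \<Longrightarrow> (\<Sum>i<r. q j i * a i l) = 0"
      "\<And>j. j \<in> J \<Longrightarrow> (\<Sum>i<r. q j i * a i j) \<noteq> 0" by metis
    obtain d where d: "\<exists>j\<in>J. d j \<noteq> 0" "\<forall>i<r. (\<Sum>j\<in>J. d j * q j i) = 0"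
      using underdetermined_system[of "{..<r}" J q] fin \<open>r < card J\<close> by auto
    then obtain j where j: "j \<in> J" "d j \<noteq> 0" by blast
    have "0 = (\<Sum>i<r. (\<Sum>l\<in>J. d l * q l i) * a i j)" using d(2) by simp
    also have "\<dots> = (\<Sum>l\<in>J. d l * (\<Sum>i<r. q l i * a i j))"
      unfolding sum_distrib_left sum_distrib_right by (subst sum.swap) (simp add: mult.assoc)
    also have "\<dots> = d j * (\<Sum>i<r. q j i * a i j)"
      unfolding sum.remove[OF fin j(1)] using q(1) j(1) by (auto intro!: sum.neutral)
    finally show False using j q(2) by simp
  qed
  ultimately have "card J = r" by simp
  then show ?thesis using J unfolding P_def by blast
qed

text \<open>This also covers matrices with fewer columns than rows, which have no maximal minors: the minors then vanish
vacuously, and the left kernel is nonzero.\<close>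

lemma maximal_minors_vanish_iff:
  fixes A :: "'a::field mat"
  assumes A: "A \<in> carrier_mat r c"
  shows "minors r A \<subseteq> {0} \<longleftrightarrow>
    (\<exists>q. (\<exists>i<r. q i \<noteq> 0) \<and> (\<forall>j<c. (\<Sum>i<r. q i * A $$ (i, j)) = 0))"
proof -
  have sub: "submatrix A {..<r} J \<in> carrier_mat r r"
    and entry: "\<And>i j. i < r \<Longrightarrow> j < r \<Longrightarrow> submatrix A {..<r} J $$ (i, j) = A $$ (i, pick J j)"
    if J: "J \<subseteq> {..<c}" "card J = r" for J
  proof -
    have 1: "{i. i < dim_row A \<and> i \<in> {..<r}} = {..<r}" using A by auto
    have 2: "{j. j < dim_col A \<and> j \<in> J} = J" using A J by auto
    show "submatrix A {..<r} J \<in> carrier_mat r r"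
      by (rule carrier_matI) (simp_all only: dim_submatrix 1 2 card_lessThan J)
    fix i j assume ij: "i < r" "j < r"
    have "pick {..<r} i = i"
    proof -
      have "{a \<in> {..<r}. a < i} = {..<i}" using ij(1) by auto
      then show ?thesis using pick_card_in_set[of i "{..<r}"] ij(1) by simp
    qed
    then show "submatrix A {..<r} J $$ (i, j) = A $$ (i, pick J j)"
      using ij by (subst submatrix_index) (simp_all only: 1 2 card_lessThan J)
  qed
  have image: "pick J ` {..<r} = J" if J: "J \<subseteq> {..<c}" "card J = r" for J
  proof -
    have fin: "finite J" using J finite_subset by blast
    have "pick J ` {..<r} \<subseteq> J" using pick_in_set_le[of _ J] J(2) by auto
    moreover have "inj_on (pick J) {..<r}"
      using pick_eq_iff_inf pick_mono_le[of _ J] J(2)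
      by (intro linorder_inj_onI) (auto simp: nat_neq_iff)
    then have "card (pick J ` {..<r}) = r" by (simp add: card_image)
    ultimately show ?thesis using fin J(2) by (metis card_subset_eq)
  qed
  have kernel: "det (submatrix A {..<r} J) = 0 \<longleftrightarrow>
      (\<exists>q. (\<exists>i<r. q i \<noteq> 0) \<and> (\<forall>j\<in>J. (\<Sum>i<r. q i * A $$ (i, j)) = 0))"
    if J: "J \<subseteq> {..<c}" "card J = r" for J
  proof -
    let ?B = "transpose_mat (submatrix A {..<r} J)"
    have B: "?B \<in> carrier_mat r r" using sub[OF J] by simp
    have mv: "(?B *\<^sub>v v = 0\<^sub>v r) \<longleftrightarrow> (\<forall>j\<in>J. (\<Sum>i<r. v $ i * A $$ (i, j)) = 0)"
      if v: "v \<in> carrier_vec r" for v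
    proof -
      have "(?B *\<^sub>v v) $ l = (\<Sum>i<r. v $ i * A $$ (i, pick J l))" if "l < r" for l
      proof -
        have "(?B *\<^sub>v v) $ l = (\<Sum>i\<in>{0..<r}. submatrix A {..<r} J $$ (i, l) * v $ i)"
          using that carrier_matD[OF sub[OF J]] v by (simp add: scalar_prod_def)
        also have "\<dots> = (\<Sum>i<r. v $ i * A $$ (i, pick J l))"
          using that entry[OF J] by (intro sum.cong) auto
        finally show ?thesis .
      qed
      then have "(?B *\<^sub>v v = 0\<^sub>v r) \<longleftrightarrow> (\<forall>l<r. (\<Sum>i<r. v $ i * A $$ (i, pick J l)) = 0)"
        using B by (auto simp: vec_eq_iff)
      also have "\<dots> \<longleftrightarrow> (\<forall>j\<in>pick J ` {..<r}. (\<Sum>i<r. v $ i * A $$ (i, j)) = 0)" by auto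
      finally show ?thesis unfolding image[OF J] .
    qed
    have "det (submatrix A {..<r} J) = det ?B" using det_transpose[OF sub[OF J]] by simp
    then have "det (submatrix A {..<r} J) = 0 \<longleftrightarrow>
        (\<exists>v. v \<in> carrier_vec r \<and> v \<noteq> 0\<^sub>v r \<and> (\<forall>j\<in>J. (\<Sum>i<r. v $ i * A $$ (i, j)) = 0))"
      using det_0_iff_vec_prod_zero[OF B] mv by auto
    also have "\<dots> \<longleftrightarrow> (\<exists>q. (\<exists>i<r. q i \<noteq> 0) \<and> (\<forall>j\<in>J. (\<Sum>i<r. q i * A $$ (i, j)) = 0))"
    proof (intro iffI; elim exE conjE)
      fix v assume "v \<in> carrier_vec r" "v \<noteq> 0\<^sub>v r" "\<forall>j\<in>J. (\<Sum>i<r. v $ i * A $$ (i, j)) = 0"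
      then show "\<exists>q. (\<exists>i<r. q i \<noteq> 0) \<and> (\<forall>j\<in>J. (\<Sum>i<r. q i * A $$ (i, j)) = 0)"
        by (intro exI[of _ "\<lambda>i. v $ i"]) (auto simp: vec_eq_iff)
    next
      fix q i assume "i < r" "q i \<noteq> 0" "\<forall>j\<in>J. (\<Sum>i<r. q i * A $$ (i, j)) = 0"
      then show "\<exists>v. v \<in> carrier_vec r \<and> v \<noteq> 0\<^sub>v r \<and> (\<forall>j\<in>J. (\<Sum>i<r. v $ i * A $$ (i, j)) = 0)"
        by (intro exI[of _ "vec r q"]) (auto simp: vec_eq_iff)
    qed
    finally show ?thesis .
  qed
  have minors: "minors r A = {det (submatrix A {..<r} J) |J. J \<subseteq> {..<c} \<and> card J = r}"
  proof -
    have "dim_row A = r" "dim_col A = c" using A by auto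
    moreover have "I \<subseteq> {..<r} \<and> J \<subseteq> {..<c} \<and> card I = r \<and> card J = r \<longleftrightarrow>
        I = {..<r} \<and> J \<subseteq> {..<c} \<and> card J = r" for I J
      using card_subset_eq[of "{..<r}" I] by auto
    ultimately show ?thesis unfolding minors_def by simp
  qed
  show ?thesis
  proof
    assume van: "minors r A \<subseteq> {0}"
    show "\<exists>q. (\<exists>i<r. q i \<noteq> 0) \<and> (\<forall>j<c. (\<Sum>i<r. q i * A $$ (i, j)) = 0)"
    proof (rule ccontr)
      assume none: "\<not> ?thesis"
      have "\<exists>J\<subseteq>{..<c}. card J = r \<and>
          (\<forall>q. (\<forall>j\<in>J. (\<Sum>i<r. q i * A $$ (i, j)) = 0) \<longrightarrow> (\<forall>i<r. q i = 0))"
        by (rule full_row_rank_columns) (use none in blast)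
      then obtain J where J: "J \<subseteq> {..<c}" "card J = r"
        and inj: "\<forall>q. (\<forall>j\<in>J. (\<Sum>i<r. q i * A $$ (i, j)) = 0) \<longrightarrow> (\<forall>i<r. q i = 0)"
        by (elim exE conjE)
      have "det (submatrix A {..<r} J) \<noteq> 0"
        unfolding kernel[OF J] using inj by blast
      then show False using van J unfolding minors by blast
    qed
  next
    assume "\<exists>q. (\<exists>i<r. q i \<noteq> 0) \<and> (\<forall>j<c. (\<Sum>i<r. q i * A $$ (i, j)) = 0)"
    then obtain q where q: "\<exists>i<r. q i \<noteq> 0" "\<And>j. j < c \<Longrightarrow> (\<Sum>i<r. q i * A $$ (i, j)) = 0"
      by blast
    have "det (submatrix A {..<r} J) = 0" if J: "J \<subseteq> {..<c}" "card J = r" for J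
      unfolding kernel[OF J] using q J by (intro exI[of _ q]) auto
    then show "minors r A \<subseteq> {0}" unfolding minors by blast
  qed
qed

section \<open>Polynomial functions and algebraic independence\<close>

text \<open>Functions on sequences that are polynomial in the first \<open>N\<close> entries. Closure under the ring operations is
all that is needed to see that forms pull back to such functions under polynomial parametrizations.\<close>

inductive_set polyfun :: "nat \<Rightarrow> ((nat \<Rightarrow> 'a::comm_ring_1) \<Rightarrow> 'a) set" for N where
  const: "(\<lambda>u. c) \<in> polyfun N"
| coord: "i < N \<Longrightarrow> (\<lambda>u. u i) \<in> polyfun N"
| add: "F \<in> polyfun N \<Longrightarrow> G \<in> polyfun N \<Longrightarrow> (\<lambda>u. F u + G u) \<in> polyfun N"
| mult: "F \<in> polyfun N \<Longrightarrow> G \<in> polyfun N \<Longrightarrow> (\<lambda>u. F u * G u) \<in> polyfun N"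

lemma polyfun_power: "F \<in> polyfun N \<Longrightarrow> (\<lambda>u. F u ^ r) \<in> polyfun N"
  by (induction r) (auto intro: polyfun.intros)

lemma polyfun_sum: "(\<And>i. i \<in> I \<Longrightarrow> F i \<in> polyfun N) \<Longrightarrow> (\<lambda>u. \<Sum>i\<in>I. F i u) \<in> polyfun N"
  by (induction I rule: infinite_finite_induct) (auto intro: polyfun.intros)

lemma polyfun_prod: "(\<And>i. i \<in> I \<Longrightarrow> F i \<in> polyfun N) \<Longrightarrow> (\<lambda>u. \<Prod>i\<in>I. F i u) \<in> polyfun N"
  by (induction I rule: infinite_finite_induct) (auto intro: polyfun.intros)

lemma polyfun_poly_val:
  assumes "\<And>x. (\<lambda>u. a u x) \<in> polyfun N"
  shows "(\<lambda>u. poly_val (a u) f) \<in> polyfun N"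
  unfolding poly_val_def monom_val_def
  by (intro polyfun_sum polyfun.mult polyfun.const polyfun_prod polyfun_power assms)

lemma polyfun_poly: "(\<lambda>u. poly p (u 0)) \<in> polyfun (Suc N)"
  by (induction p) (auto intro!: polyfun.intros)

lemma polyfun_line:
  fixes F :: "(nat \<Rightarrow> 'a::comm_ring_1) \<Rightarrow> 'a"
  assumes "F \<in> polyfun N"
  shows "\<exists>p. \<forall>t. F (\<lambda>i. u i + t * d i) = poly p t"
  using assms
proof induction
  case (const c) show ?case by (intro exI[of _ "[:c:]"]) simp
next
  case (coord i) show ?case by (intro exI[of _ "[:u i, d i:]"]) simp
next
  case (add F G)
  then obtain p q where "\<forall>t. F (\<lambda>i. u i + t * d i) = poly p t" "\<forall>t. G (\<lambda>i. u i + t * d i) = poly q t"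
    by blast
  then show ?case by (intro exI[of _ "p + q"]) simp
next
  case (mult F G)
  then obtain p q where "\<forall>t. F (\<lambda>i. u i + t * d i) = poly p t" "\<forall>t. G (\<lambda>i. u i + t * d i) = poly q t"
    by blast
  then show ?case by (intro exI[of _ "p * q"]) simp
qed

definition exponents :: "nat \<Rightarrow> nat \<Rightarrow> (nat \<Rightarrow> nat) set" where
  "exponents d s = PiE {..<d} (\<lambda>_. {..s})"

definition mon :: "nat \<Rightarrow> (nat \<Rightarrow> nat) \<Rightarrow> (nat \<Rightarrow> 'a::comm_ring_1) \<Rightarrow> 'a" where
  "mon d \<alpha> u = (\<Prod>i<d. u i ^ \<alpha> i)"

lemma finite_exponents: "finite (exponents d s)"
  unfolding exponents_def by (intro finite_PiE) auto

lemma exponents_le: "\<alpha> \<in> exponents d s \<Longrightarrow> i < d \<Longrightarrow> \<alpha> i \<le> s"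
  by (auto simp: exponents_def)

lemma card_exponents: "card (exponents d s) = (s + 1) ^ d"
  unfolding exponents_def by (simp add: card_PiE)

text \<open>Polynomials in \<open>N\<close> variables of degree at most \<open>D\<close> in each of them. The bound on the individual degrees,
instead of the total degree, makes the number of monomials a plain power.\<close>

definition box :: "nat \<Rightarrow> nat \<Rightarrow> ((nat \<Rightarrow> 'a::comm_ring_1) \<Rightarrow> 'a) set" where
  "box N D = {F. \<exists>c. \<forall>u. F u = (\<Sum>\<alpha>\<in>exponents N D. c \<alpha> * mon N \<alpha> u)}"

lemma box_scale: "F \<in> box N D \<Longrightarrow> (\<lambda>u. a * F u) \<in> box N D"
proof -
  assume "F \<in> box N D"
  then obtain c where "\<forall>u. F u = (\<Sum>\<alpha>\<in>exponents N D. c \<alpha> * mon N \<alpha> u)" unfolding box_def by blast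
  then show ?thesis unfolding box_def
    by (intro CollectI exI[of _ "\<lambda>\<alpha>. a * c \<alpha>"]) (simp add: sum_distrib_left mult.assoc)
qed

lemma box_add: "F \<in> box N D \<Longrightarrow> G \<in> box N D \<Longrightarrow> (\<lambda>u. F u + G u) \<in> box N D"
proof -
  assume "F \<in> box N D" "G \<in> box N D"
  then obtain c c' where "\<forall>u. F u = (\<Sum>\<alpha>\<in>exponents N D. c \<alpha> * mon N \<alpha> u)"
    "\<forall>u. G u = (\<Sum>\<alpha>\<in>exponents N D. c' \<alpha> * mon N \<alpha> u)" unfolding box_def by blast
  then show ?thesis unfolding box_def
    by (intro CollectI exI[of _ "\<lambda>\<alpha>. c \<alpha> + c' \<alpha>"]) (simp add: sum.distrib algebra_simps)
qed

lemma box_zero: "(\<lambda>u. 0) \<in> box N D"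
  unfolding box_def by (intro CollectI exI[of _ "\<lambda>_. 0"]) simp

lemma box_sum: "(\<And>i. i \<in> I \<Longrightarrow> F i \<in> box N D) \<Longrightarrow> (\<lambda>u. \<Sum>i\<in>I. F i u) \<in> box N D"
  by (induction I rule: infinite_finite_induct) (auto intro: box_zero box_add)

lemma box_mon:
  assumes "\<And>i. i < N \<Longrightarrow> \<alpha> i \<le> D"
  shows "mon N \<alpha> \<in> box N D"
proof -
  let ?b = "restrict \<alpha> {..<N}"
  have "?b \<in> exponents N D" using assms by (auto simp: exponents_def)
  then have "(\<Sum>\<beta>\<in>exponents N D. (if \<beta> = ?b then 1 else 0) * mon N \<beta> u) = mon N ?b u" for u :: "nat \<Rightarrow> 'a"
    by (simp add: finite_exponents if_distrib[of "\<lambda>x. x * _"] cong: if_cong)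
  moreover have "mon N ?b u = mon N \<alpha> u" for u :: "nat \<Rightarrow> 'a" by (simp add: mon_def)
  ultimately show ?thesis
    unfolding box_def by (intro CollectI exI[of _ "\<lambda>\<beta>. if \<beta> = ?b then 1 else 0"]) simp
qed

lemma box_mult:
  assumes "F \<in> box N D" "G \<in> box N E"
  shows "(\<lambda>u. F u * G u) \<in> box N (D + E)"
proof -
  obtain c c' where c: "\<And>u. F u = (\<Sum>\<alpha>\<in>exponents N D. c \<alpha> * mon N \<alpha> u)"
    "\<And>u. G u = (\<Sum>\<beta>\<in>exponents N E. c' \<beta> * mon N \<beta> u)"
    using assms unfolding box_def by blast
  have "F u * G u = (\<Sum>\<alpha>\<in>exponents N D. \<Sum>\<beta>\<in>exponents N E.
      (c \<alpha> * c' \<beta>) * mon N (\<lambda>i. \<alpha> i + \<beta> i) u)" for u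
    unfolding c sum_product
    by (intro sum.cong refl) (simp add: mon_def power_add prod.distrib ac_simps)
  moreover have "(\<lambda>u. \<Sum>\<alpha>\<in>exponents N D. \<Sum>\<beta>\<in>exponents N E.
      (c \<alpha> * c' \<beta>) * mon N (\<lambda>i. \<alpha> i + \<beta> i) u) \<in> box N (D + E)"
    by (intro box_sum box_scale box_mon) (auto simp: exponents_def intro!: add_mono)
  ultimately show ?thesis by simp
qed

lemma box_mono:
  assumes "F \<in> box N D" "D \<le> E"
  shows "F \<in> box N E"
proof -
  obtain c where c: "\<And>u. F u = (\<Sum>\<alpha>\<in>exponents N D. c \<alpha> * mon N \<alpha> u)"
    using assms(1) unfolding box_def by blast
  have "(\<lambda>u. \<Sum>\<alpha>\<in>exponents N D. c \<alpha> * mon N \<alpha> u) \<in> box N E"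
    using assms(2) by (intro box_sum box_scale box_mon) (auto dest: exponents_le)
  then show ?thesis using c by presburger
qed

lemma box_one: "(\<lambda>u. 1) \<in> box N D"
  using box_mon[of N "\<lambda>_. 0" D] by (simp add: mon_def[abs_def])

lemma polyfun_box: "F \<in> polyfun N \<Longrightarrow> \<exists>D. F \<in> box N D"
proof (induction rule: polyfun.induct)
  case (const c)
  show ?case using box_scale[OF box_one, of c] by auto
next
  case (coord i)
  have "mon N (\<lambda>l. if l = i then 1 else 0) u = u i" for u :: "nat \<Rightarrow> 'a"
    using coord by (simp add: mon_def if_distrib cong: if_cong)
  then have "mon N (\<lambda>l. if l = i then 1 else 0) = (\<lambda>u :: nat \<Rightarrow> 'a. u i)" by (rule ext)
  moreover have "(mon N (\<lambda>l. if l = i then 1 else 0) :: (nat \<Rightarrow> 'a) \<Rightarrow> 'a) \<in> box N 1"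
    by (rule box_mon) auto
  ultimately show ?case by auto
next
  case (add F G)
  then obtain D E where "F \<in> box N D" "G \<in> box N E" by blast
  then have "(\<lambda>u. F u + G u) \<in> box N (max D E)" by (intro box_add) (auto intro: box_mono)
  then show ?case by blast
next
  case (mult F G)
  then show ?case using box_mult by blast
qed

lemma box_power: "F \<in> box N D \<Longrightarrow> (\<lambda>u. F u ^ r) \<in> box N (r * D)"
  by (induction r) (auto intro: box_one box_mult)

lemma box_mon_comp:
  assumes "\<And>i. i < d \<Longrightarrow> F i \<in> box N D" "\<And>i. i < d \<Longrightarrow> \<alpha> i \<le> s"
  shows "(\<lambda>u. mon d \<alpha> (\<lambda>i. F i u)) \<in> box N (d * (s * D))"
  using assms
proof (induction d)
  case 0
  then show ?case by (simp add: mon_def box_one)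
next
  case (Suc d)
  have "(\<lambda>u. F d u ^ \<alpha> d) \<in> box N (s * D)"
    using Suc.prems by (intro box_mono[OF box_power]) auto
  then have "(\<lambda>u. mon d \<alpha> (\<lambda>i. F i u) * F d u ^ \<alpha> d) \<in> box N (d * (s * D) + s * D)"
    using Suc by (intro box_mult Suc.IH) auto
  then show ?case by (simp add: mon_def algebra_simps)
qed

text \<open>Algebraic independence of functions on a set, phrased as linear independence of their monomials. Relations
with exponents bounded by an arbitrary \<open>s\<close> are all relations.\<close>

definition alg_independent_on :: "'c set \<Rightarrow> nat \<Rightarrow> (nat \<Rightarrow> 'c \<Rightarrow> 'a::comm_ring_1) \<Rightarrow> bool" where
  "alg_independent_on K d G \<longleftrightarrow> (\<forall>s c. (\<forall>e\<in>K. (\<Sum>\<alpha>\<in>exponents d s. c \<alpha> * mon d \<alpha> (\<lambda>i. G i e)) = 0) \<longrightarrow>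
     (\<forall>\<alpha>\<in>exponents d s. c \<alpha> = 0))"

text \<open>A polynomial of degree \<open>N < d\<close> in \<open>s\<close> is eventually smaller than \<open>(s + 1) ^ d\<close>; the choice
\<open>s = (K + 1) ^ N\<close> is large enough because \<open>K * s + 1 \<le> (K + 1) * (s + 1)\<close>.\<close>

lemma power_beats:
  assumes "N < d"
  shows "\<exists>s. (K * s + 1) ^ N < (s + 1 :: nat) ^ d"
proof -
  define s where "s = (K + 1) ^ N"
  have "(K * s + 1) ^ N \<le> ((K + 1) * (s + 1)) ^ N" by (intro power_mono) (auto simp: algebra_simps)
  also have "\<dots> = s * (s + 1) ^ N" by (simp only: power_mult_distrib s_def)
  also have "\<dots> < (s + 1) * (s + 1) ^ N" by (intro mult_strict_right_mono) auto
  also have "\<dots> = (s + 1) ^ Suc N" by simp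
  also have "\<dots> \<le> (s + 1) ^ d" using assms by (intro power_increasing) auto
  finally show ?thesis by blast
qed

text \<open>The \<open>(s + 1) ^ d\<close> monomials in the \<open>H i\<close> with exponents up to \<open>s\<close> lie in a space of polynomials of
dimension at most \<open>(K * s + 1) ^ N\<close> with \<open>K\<close> independent of \<open>s\<close>. If \<open>d > N\<close>, they are
linearly dependent for large \<open>s\<close>.\<close>

lemma alg_independent_polyfun_le:
  fixes H :: "nat \<Rightarrow> (nat \<Rightarrow> 'a::field) \<Rightarrow> 'a"
  assumes H: "\<And>i. i < d \<Longrightarrow> H i \<in> polyfun N" and ind: "alg_independent_on UNIV d H"
  shows "d \<le> N"
proof (rule ccontr)
  assume "\<not> d \<le> N"
  have "\<exists>D. \<forall>i<d. H i \<in> box N D"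
  proof -
    obtain D where D: "\<And>i. i < d \<Longrightarrow> H i \<in> box N (D i)" using polyfun_box[OF H] by metis
    have "H i \<in> box N (\<Sum>i<d. D i)" if "i < d" for i
      by (rule box_mono[OF D[OF that]]) (use that in \<open>auto intro: member_le_sum\<close>)
    then show ?thesis by blast
  qed
  then obtain D where D: "\<And>i. i < d \<Longrightarrow> H i \<in> box N D" by blast
  obtain s where s: "(d * D * s + 1) ^ N < (s + 1) ^ d" using power_beats \<open>\<not> d \<le> N\<close> by (meson not_le)
  let ?E = "exponents N (d * (s * D))"
  have "\<exists>m. \<forall>u. mon d \<alpha> (\<lambda>i. H i u) = (\<Sum>\<beta>\<in>?E. m \<beta> * mon N \<beta> u)" if "\<alpha> \<in> exponents d s" for \<alpha>
    using box_mon_comp[of d H N D \<alpha> s] D that by (auto simp: exponents_def box_def)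
  then obtain m where m: "\<And>\<alpha> u. \<alpha> \<in> exponents d s \<Longrightarrow>
      mon d \<alpha> (\<lambda>i. H i u) = (\<Sum>\<beta>\<in>?E. m \<alpha> \<beta> * mon N \<beta> u)" by metis
  have "card ?E < card (exponents d s)" using s by (simp add: card_exponents algebra_simps)
  from underdetermined_system[OF finite_exponents finite_exponents this, of m]
  obtain c where c: "\<exists>\<alpha>\<in>exponents d s. c \<alpha> \<noteq> 0"
    "\<forall>\<beta>\<in>?E. (\<Sum>\<alpha>\<in>exponents d s. c \<alpha> * m \<alpha> \<beta>) = 0" by (elim exE conjE)
  have "(\<Sum>\<alpha>\<in>exponents d s. c \<alpha> * mon d \<alpha> (\<lambda>i. H i u)) = 0" for u
  proof -
    have "(\<Sum>\<alpha>\<in>exponents d s. c \<alpha> * mon d \<alpha> (\<lambda>i. H i u)) =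
        (\<Sum>\<alpha>\<in>exponents d s. \<Sum>\<beta>\<in>?E. c \<alpha> * m \<alpha> \<beta> * mon N \<beta> u)"
      by (simp add: m sum_distrib_left mult.assoc)
    also have "\<dots> = (\<Sum>\<beta>\<in>?E. (\<Sum>\<alpha>\<in>exponents d s. c \<alpha> * m \<alpha> \<beta>) * mon N \<beta> u)"
      by (subst sum.swap) (simp add: sum_distrib_right)
    finally show ?thesis using c(2) by simp
  qed
  then show False using ind c(1) unfolding alg_independent_on_def by blast
qed

lemma sum_exponents_Suc:
  "(\<Sum>\<alpha>\<in>exponents (Suc d) s. f \<alpha>) = (\<Sum>j\<le>s. \<Sum>\<beta>\<in>exponents d s. f (\<beta>(d := j)))"
proof -
  have "exponents (Suc d) s = (\<lambda>(j, \<beta>). \<beta>(d := j)) ` ({..s} \<times> exponents d s)"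
    unfolding exponents_def lessThan_Suc PiE_insert_eq by simp
  moreover have "inj_on (\<lambda>(j, \<beta>). \<beta>(d := j)) ({..s} \<times> exponents d s)"
    unfolding exponents_def using inj_combinator[of d "{..<d}" "\<lambda>_. {..s}"] by simp
  ultimately show ?thesis by (simp add: sum.reindex sum.cartesian_product case_prod_unfold)
qed

lemma mon_Suc: "mon (Suc d) (\<beta>(d := j)) u = u d ^ j * mon d \<beta> u"
proof -
  have "(\<Prod>i<d. u i ^ (\<beta>(d := j)) i) = (\<Prod>i<d. u i ^ \<beta> i)" by (intro prod.cong) auto
  then show ?thesis by (simp add: mon_def mult.commute)
qed

lemma mon_cong: "(\<And>i. i < d \<Longrightarrow> u i = v i) \<Longrightarrow> mon d \<alpha> u = mon d \<alpha> v"
  unfolding mon_def by (intro prod.cong) auto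

text \<open>Let \<open>F\<close> vanish on \<open>K0\<close>. Divide a relation between the \<open>G i\<close> and \<open>F\<close> on \<open>K\<close> by the highest
power of \<open>F\<close> that divides it, and restrict to \<open>K0\<close>: only the part free of \<open>F\<close> survives, and it is a
nontrivial relation between the \<open>G i\<close>. The assumption \<open>dense\<close> justifies the division: it holds when the
points with \<open>F e \<noteq> 0\<close> are dense in \<open>K\<close>.\<close>

lemma alg_independent_extend:
  fixes G :: "nat \<Rightarrow> 'c \<Rightarrow> 'a::idom"
  assumes sub: "K0 \<subseteq> K" and ind: "alg_independent_on K0 d G"
    and zero: "\<And>e. e \<in> K0 \<Longrightarrow> F e = 0"
    and dense: "\<And>s c. (\<forall>e\<in>K. F e \<noteq> 0 \<longrightarrow>
        (\<Sum>\<alpha>\<in>exponents (Suc d) s. c \<alpha> * mon (Suc d) \<alpha> (\<lambda>i. (G(d := F)) i e)) = 0) \<Longrightarrow>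
      (\<forall>e\<in>K. (\<Sum>\<alpha>\<in>exponents (Suc d) s. c \<alpha> * mon (Suc d) \<alpha> (\<lambda>i. (G(d := F)) i e)) = 0)"
  shows "alg_independent_on K (Suc d) (G(d := F))"
  unfolding alg_independent_on_def
proof (intro allI impI)
  fix s c
  define P where "P c e = (\<Sum>\<alpha>\<in>exponents (Suc d) s. c \<alpha> * mon (Suc d) \<alpha> (\<lambda>i. (G(d := F)) i e))" for c e
  define Q where "Q c i e = (\<Sum>\<beta>\<in>exponents d s. c (\<beta>(d := i)) * mon d \<beta> (\<lambda>i. G i e))"
    for c :: "(nat \<Rightarrow> nat) \<Rightarrow> 'a" and i e
  have PQ: "P c e = (\<Sum>i\<le>s. F e ^ i * Q c i e)" for c e
  proof -
    have "mon d \<beta> (\<lambda>i. (G(d := F)) i e) = mon d \<beta> (\<lambda>i. G i e)" for \<beta>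
      by (rule mon_cong) simp
    then show ?thesis
      unfolding P_def Q_def sum_exponents_Suc mon_Suc by (simp add: sum_distrib_left ac_simps)
  qed
  assume "\<forall>e\<in>K. (\<Sum>\<alpha>\<in>exponents (Suc d) s. c \<alpha> * mon (Suc d) \<alpha> (\<lambda>i. (G(d := F)) i e)) = 0"
  then have rel: "P c e = 0" if "e \<in> K" for e using that unfolding P_def by blast
  have coeff: "\<forall>\<beta>\<in>exponents d s. c (\<beta>(d := j)) = 0" if "j \<le> s" for j
    using that
  proof (induction j rule: less_induct)
    case (less j)
    \<comment> \<open>The coefficients of the relation divided by the \<open>j\<close>-th power of \<open>F\<close>.\<close>
    define c' where "c' \<gamma> = (if \<gamma> d + j \<le> s then c (\<gamma>(d := \<gamma> d + j)) else 0)" for \<gamma>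
    have Q': "Q c' i e = (if i + j \<le> s then Q c (i + j) e else 0)" for i e
      unfolding Q_def c'_def by simp
    have low: "Q c l e = 0" if "l < j" for l e
    proof -
      have "\<forall>\<beta>\<in>exponents d s. c (\<beta>(d := l)) = 0"
        by (rule less.IH[OF that]) (use that less.prems in simp)
      then show ?thesis unfolding Q_def by (metis (no_types, lifting) mult_zero_left sum.neutral)
    qed
    have "F e ^ j * P c' e = P c e" for e
    proof -
      have "F e ^ j * P c' e = (\<Sum>i\<in>{i. i \<le> s \<and> i + j \<le> s}. F e ^ (i + j) * Q c (i + j) e)"
        unfolding PQ Q' sum_distrib_left
        by (rule sum.mono_neutral_cong_right) (auto simp: power_add ac_simps)
      also have "\<dots> = (\<Sum>l\<in>{j..s}. F e ^ l * Q c l e)"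
        by (rule sum.reindex_bij_witness[of _ "\<lambda>l. l - j" "\<lambda>i. i + j"]) auto
      also have "\<dots> = P c e" unfolding PQ using low
        by (intro sum.mono_neutral_left) auto
      finally show ?thesis .
    qed
    then have "P c' e = 0" if "e \<in> K" "F e \<noteq> 0" for e
      using rel[OF that(1)] that(2) by (metis mult_eq_0_iff power_not_zero)
    then have "\<forall>e\<in>K. P c' e = 0" using dense[where s = s and c = c'] unfolding P_def by blast
    then have "Q c j e = 0" if "e \<in> K0" for e
    proof -
      have "0 = (\<Sum>i\<le>s. F e ^ i * Q c' i e)" using \<open>\<forall>e\<in>K. P c' e = 0\<close> sub that PQ by fastforce
      also have "\<dots> = Q c' 0 e" using zero[OF that]
        by (simp add: power_0_left if_distrib[of "\<lambda>x. x * _"] cong: if_cong)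
      also have "\<dots> = Q c j e" using less.prems unfolding Q' by simp
      finally show ?thesis by simp
    qed
    then show ?case using ind[unfolded alg_independent_on_def, THEN spec[of _ s],
          THEN spec[of _ "\<lambda>\<beta>. c (\<beta>(d := j))"]]
      unfolding Q_def by blast
  qed
  show "\<forall>\<alpha>\<in>exponents (Suc d) s. c \<alpha> = 0"
  proof
    fix \<alpha> assume "\<alpha> \<in> exponents (Suc d) s"
    then obtain j \<beta> where "j \<le> s" "\<beta> \<in> exponents d s" "\<alpha> = \<beta>(d := j)"
      unfolding exponents_def lessThan_Suc PiE_insert_eq by auto
    then show "c \<alpha> = 0" using coeff by blast
  qed
qed

section \<open>Forms and cones over sets of points\<close>

lemma poly_val_one [simp]: "poly_val a 1 = 1"
  by (simp add: poly_val_def monom_val_def)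

lemma poly_val_power: "poly_val a (f ^ r) = poly_val a f ^ r"
  by (induction r) (simp_all add: poly_val_mult)

lemma poly_val_prod: "poly_val a (prod F A) = (\<Prod>i\<in>A. poly_val a (F i))"
  by (induction A rule: infinite_finite_induct) (simp_all add: poly_val_mult)

lemma poly_val_const: "poly_val a (Poly_Mapping.single 0 c) = c"
  by (simp add: poly_val_single monom_val_def)

lemma bihom_zero: "0 \<in> bihom n m a b"
  by (simp add: bihom_def)

lemma bihom_one: "1 \<in> bihom n m 0 0"
  by (auto simp: bihom_def)

lemma bihom_const: "Poly_Mapping.single 0 c \<in> bihom n m 0 0"
  by (auto simp: bihom_def)

lemma bihom_add:
  assumes "f \<in> bihom n m a b" "g \<in> bihom n m a b"
  shows "f + g \<in> bihom n m a b"
  using assms keys_add[of f g] unfolding bihom_def by blast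

lemma bihom_sum: "(\<And>i. i \<in> A \<Longrightarrow> f i \<in> bihom n m a b) \<Longrightarrow> sum f A \<in> bihom n m a b"
  by (induction A rule: infinite_finite_induct) (simp_all add: bihom_zero bihom_add)

lemma bihom_scale: "f \<in> bihom n m a b \<Longrightarrow> Poly_Mapping.single 0 c * f \<in> bihom n m a b"
  using bihom_mult[OF bihom_const] by fastforce

lemma bihom_power: "f \<in> bihom n m a b \<Longrightarrow> f ^ r \<in> bihom n m (r * a) (r * b)"
  by (induction r) (auto simp: bihom_one intro: bihom_mult)

lemma bihom_prod:
  "(\<And>i. i \<in> A \<Longrightarrow> f i \<in> bihom n m (a i) (b i)) \<Longrightarrow> prod f A \<in> bihom n m (sum a A) (sum b A)"
  by (induction A rule: infinite_finite_induct) (auto simp: bihom_one intro: bihom_mult)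

definition var :: "nat + nat \<Rightarrow> 'a::field bipoly" where
  "var x = Poly_Mapping.single (Poly_Mapping.single x 1) 1"

lemma poly_val_var [simp]: "poly_val a (var x) = a x"
  by (simp add: var_def poly_val_single monom_val_def)

lemma var_Inl_bihom: "i \<le> n \<Longrightarrow> var (Inl i) \<in> bihom n m 1 0"
  by (auto simp: var_def bihom_def lookup_single when_def)

lemma var_Inr_bihom: "i \<le> m \<Longrightarrow> var (Inr i) \<in> bihom n m 0 1"
  by (auto simp: var_def bihom_def lookup_single when_def)

text \<open>The closed sets are the zero loci of sets of forms, so the closure is cut out by all forms vanishing on the
set.\<close>

lemma closure_zariski:
  assumes S: "S \<subseteq> Proj n \<times> Proj m"
  shows "zariski n m closure_of S = zero_locus n m (vanishing_forms n m S)"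
proof
  have "closedin (zariski n m) (zero_locus n m (vanishing_forms n m S))"
    unfolding closedin_zariski by (intro exI conjI refl) (auto simp: vanishing_forms_def)
  moreover have "S \<subseteq> zero_locus n m (vanishing_forms n m S)"
    using S unfolding zero_locus_def vanishing_forms_def by blast
  ultimately show "zariski n m closure_of S \<subseteq> zero_locus n m (vanishing_forms n m S)"
    by (rule closure_of_minimal[rotated])
next
  have "closedin (zariski n m) (zariski n m closure_of S)" by simp
  then obtain F where F: "F \<subseteq> bihom_forms n m" "zariski n m closure_of S = zero_locus n m F"
    unfolding closedin_zariski by blast
  have "S \<subseteq> zero_locus n m F"
    using S closure_of_subset[of S "zariski n m"] unfolding F(2)[symmetric] topspace_zariski by blast
  then have "F \<subseteq> vanishing_forms n m S"
    using F(1) unfolding zero_locus_def vanishing_forms_def by blast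
  then show "zero_locus n m (vanishing_forms n m S) \<subseteq> zariski n m closure_of S"
    unfolding F(2) zero_locus_def by blast
qed

text \<open>All representatives of the points of \<open>Z\<close>, as assignments to the two groups of variables at which
polynomials can be evaluated.\<close>

definition cone :: "'a::field bipoint set \<Rightarrow> (nat + nat \<Rightarrow> 'a) set" where
  "cone Z = {case_sum v w |v w. \<exists>z\<in>Z. v \<in> fst z \<and> w \<in> snd z}"

lemma cone_mono: "Y \<subseteq> Z \<Longrightarrow> cone Y \<subseteq> cone Z"
  unfolding cone_def by blast

lemma Proj_scale: "P \<in> Proj n \<Longrightarrow> v \<in> P \<Longrightarrow> c \<noteq> 0 \<Longrightarrow> vscale c v \<in> P"
proof -
  assume P: "P \<in> Proj n" "v \<in> P" "c \<noteq> 0"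
  obtain v0 where v0: "P = {vscale c v0 |c. c \<noteq> 0}" by (rule Proj_rep[OF P(1)])
  then obtain d where "v = vscale d v0" "d \<noteq> 0" using P(2) by blast
  then have "vscale c v = vscale (c * d) v0" "c * d \<noteq> 0" using P(3) by (auto simp: vscale_def mult.assoc)
  then show ?thesis unfolding v0 by blast
qed

text \<open>The sum is a polynomial in \<open>t\<close> with infinitely many zeros, hence its coefficients vanish. The exponents
\<open>p \<beta>\<close> may repeat, so the conclusion collects the terms of equal exponent.\<close>

lemma sum_monomials_vanish:
  fixes c :: "'b \<Rightarrow> 'a::{field_char_0}"
  assumes "finite B" and van: "\<And>t. t \<noteq> 0 \<Longrightarrow> (\<Sum>\<beta>\<in>B. c \<beta> * t ^ p \<beta>) = 0"
  shows "(\<Sum>\<beta> | \<beta> \<in> B \<and> p \<beta> = a. c \<beta>) = 0"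
proof -
  define f where "f = (\<Sum>\<beta>\<in>B. monom (c \<beta>) (p \<beta>))"
  have "poly f t = 0" if "t \<noteq> 0" for t
    using van[OF that] by (simp add: f_def poly_sum poly_monom)
  then have "UNIV - {0} \<subseteq> {t. poly f t = 0}" by auto
  moreover have "infinite (UNIV - {0 :: 'a})" using infinite_UNIV_char_0 by simp
  ultimately have "f = 0" using poly_roots_finite finite_subset by metis
  then have "0 = coeff f a" by simp
  also have "\<dots> = (\<Sum>\<beta>\<in>B. if p \<beta> = a then c \<beta> else 0)" by (simp add: f_def coeff_sum coeff_monom)
  also have "\<dots> = (\<Sum>\<beta> | \<beta> \<in> B \<and> p \<beta> = a. c \<beta>)"
    using sum.inter_filter[OF \<open>finite B\<close>, of c "\<lambda>\<beta>. p \<beta> = a"] by simp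
  finally show ?thesis by simp
qed

lemma sum_bimonomials_vanish:
  fixes c :: "'b \<Rightarrow> 'a::{field_char_0}"
  assumes fin: "finite B"
    and van: "\<And>s t. s \<noteq> 0 \<Longrightarrow> t \<noteq> 0 \<Longrightarrow> (\<Sum>\<beta>\<in>B. c \<beta> * (s ^ p \<beta> * t ^ q \<beta>)) = 0"
  shows "(\<Sum>\<beta> | \<beta> \<in> B \<and> p \<beta> = a \<and> q \<beta> = b. c \<beta>) = 0"
proof -
  have "(\<Sum>\<beta> | \<beta> \<in> B \<and> p \<beta> = a. c \<beta> * t ^ q \<beta>) = 0" if "t \<noteq> 0" for t
    by (rule sum_monomials_vanish[OF fin]) (use van[OF _ that] in \<open>simp add: ac_simps\<close>)
  from sum_monomials_vanish[of "{\<beta>. \<beta> \<in> B \<and> p \<beta> = a}" c q b, OF _ this]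
  show ?thesis using fin by (simp add: conj_assoc)
qed

text \<open>A cone is stable under rescaling the two factors independently. So if a sum of forms of various bidegrees
vanishes on the cone, its bihomogeneous components do so separately; these are forms and therefore vanish on the
closure.\<close>

lemma cone_closure_vanish:
  fixes S :: "'a::field_char_0 bipoint set"
  assumes fin: "finite B" and h: "\<And>\<beta>. \<beta> \<in> B \<Longrightarrow> h \<beta> \<in> bihom n m (p \<beta>) (q \<beta>)"
    and S: "S \<subseteq> Proj n \<times> Proj m"
    and van: "\<And>e. e \<in> cone S \<Longrightarrow> (\<Sum>\<beta>\<in>B. poly_val e (h \<beta>)) = 0"
    and e: "e \<in> cone (zariski n m closure_of S)"
  shows "(\<Sum>\<beta>\<in>B. poly_val e (h \<beta>)) = 0"
proof -
  define H where "H a b = (\<Sum>\<beta> | \<beta> \<in> B \<and> p \<beta> = a \<and> q \<beta> = b. h \<beta>)" for a b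
  have H: "H a b \<in> bihom n m a b" for a b
    unfolding H_def using h by (intro bihom_sum) auto
  have "vanishes_at (H a b) z" if "z \<in> S" for a b z
    unfolding vanishes_at_def
  proof (intro ballI)
    fix v w assume vw: "v \<in> fst z" "w \<in> snd z"
    have z: "fst z \<in> Proj n" "snd z \<in> Proj m" using S that by auto
    show "poly_val (case_sum v w) (H a b) = 0"
      unfolding H_def poly_val_sum
    proof (rule sum_bimonomials_vanish[OF fin])
      fix s t :: 'a assume st: "s \<noteq> 0" "t \<noteq> 0"
      have "case_sum (vscale s v) (vscale t w) \<in> cone S"
        using Proj_scale[OF z(1) vw(1) st(1)] Proj_scale[OF z(2) vw(2) st(2)] that
        unfolding cone_def by blast
      from van[OF this] show "(\<Sum>\<beta>\<in>B. poly_val (case_sum v w) (h \<beta>) * (s ^ p \<beta> * t ^ q \<beta>)) = 0"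
        using poly_val_bihom[OF h] by (simp add: ac_simps)
    qed
  qed
  then have "H a b \<in> vanishing_forms n m S" for a b
    using H unfolding vanishing_forms_def bihom_forms_def by blast
  then have "poly_val e (H a b) = 0" for a b
    using e unfolding closure_zariski[OF S] cone_def zero_locus_def vanishes_at_def by blast
  then have "(\<Sum>\<beta> | \<beta> \<in> B \<and> (p \<beta>, q \<beta>) = ab. poly_val e (h \<beta>)) = 0" for ab
    unfolding H_def poly_val_sum by (cases ab) simp
  then show ?thesis
    by (subst sum.image_gen[OF fin, of _ "\<lambda>\<beta>. (p \<beta>, q \<beta>)"]) simp
qed

lemma vanishes_at_form_iff:
  assumes "f \<in> bihom_forms n m" "z \<in> Proj n \<times> Proj m" "v \<in> fst z" "w \<in> snd z"
  shows "vanishes_at f z \<longleftrightarrow> poly_val (case_sum v w) f = 0"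
proof -
  obtain a b where "f \<in> bihom n m a b" using assms(1) unfolding bihom_forms_def by blast
  then show ?thesis using vanishes_at_iff[of f n m a b "fst z" "snd z" v w] assms by auto
qed

lemma cone_closure_relation:
  fixes S :: "'a::field_char_0 bipoint set"
  assumes G: "\<And>i. i < d \<Longrightarrow> G i \<in> bihom_forms n m" and S: "S \<subseteq> Proj n \<times> Proj m"
    and van: "\<And>e. e \<in> cone S \<Longrightarrow> (\<Sum>\<alpha>\<in>exponents d s. c \<alpha> * mon d \<alpha> (\<lambda>i. poly_val e (G i))) = 0"
    and e: "e \<in> cone (zariski n m closure_of S)"
  shows "(\<Sum>\<alpha>\<in>exponents d s. c \<alpha> * mon d \<alpha> (\<lambda>i. poly_val e (G i))) = 0"
proof -
  obtain a b where ab: "\<And>i. i < d \<Longrightarrow> G i \<in> bihom n m (a i) (b i)"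
    using G unfolding bihom_forms_def mem_Collect_eq by metis
  define h where "h \<alpha> = Poly_Mapping.single 0 (c \<alpha>) * (\<Prod>i<d. G i ^ \<alpha> i)" for \<alpha>
  have h: "h \<alpha> \<in> bihom n m (\<Sum>i<d. \<alpha> i * a i) (\<Sum>i<d. \<alpha> i * b i)" for \<alpha>
    unfolding h_def using ab by (intro bihom_scale bihom_prod bihom_power) auto
  have val: "c \<alpha> * mon d \<alpha> (\<lambda>i. poly_val e (G i)) = poly_val e (h \<alpha>)" for e \<alpha>
    by (simp add: h_def mon_def poly_val_mult poly_val_const poly_val_prod poly_val_power)
  show ?thesis unfolding val
    by (rule cone_closure_vanish[OF finite_exponents h S _ e]) (use van val in simp)
qed

section \<open>Chains of irreducible closed sets\<close>

text \<open>Choose in each factor a coordinate that does not vanish at \<open>z\<close>. On the cone over \<open>z\<close> these two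
coordinates take all pairs of nonzero values.\<close>

lemma alg_independent_base:
  fixes z :: "'a::field_char_0 bipoint"
  assumes z: "z \<in> Proj n \<times> Proj m" "z \<in> Z"
  shows "\<exists>G. (\<forall>i<2. G i \<in> bihom_forms n m) \<and> alg_independent_on (cone Z) 2 (\<lambda>i e. poly_val e (G i))"
proof -
  have zp: "fst z \<in> Proj n" "snd z \<in> Proj m" using z by auto
  obtain v where v: "v \<in> fst z" "v \<in> cvec n" "v \<noteq> 0" by (rule Proj_rep[OF zp(1)])
  obtain w where w: "w \<in> snd z" "w \<in> cvec m" "w \<noteq> 0" by (rule Proj_rep[OF zp(2)])
  obtain i where i: "v i \<noteq> 0" using v(3) by (auto simp: fun_eq_iff)
  then have i': "i \<le> n" using v(2) unfolding cvec_def by (metis (mono_tags) mem_Collect_eq not_le)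
  obtain j where j: "w j \<noteq> 0" using w(3) by (auto simp: fun_eq_iff)
  then have j': "j \<le> m" using w(2) unfolding cvec_def by (metis (mono_tags) mem_Collect_eq not_le)
  define G where "G l = (if l = (0::nat) then var (Inl i) else var (Inr j) :: 'a bipoly)" for l
  have "G l \<in> bihom_forms n m" for l
    unfolding G_def bihom_forms_def using var_Inl_bihom[OF i'] var_Inr_bihom[OF j'] by auto
  moreover have "alg_independent_on (cone Z) 2 (\<lambda>i e. poly_val e (G i))"
    unfolding alg_independent_on_def
  proof (intro allI impI ballI)
    fix s :: nat and c :: "(nat \<Rightarrow> nat) \<Rightarrow> 'a" and \<gamma>
    assume rel: "\<forall>e\<in>cone Z. (\<Sum>\<alpha>\<in>exponents 2 s. c \<alpha> * mon 2 \<alpha> (\<lambda>i. poly_val e (G i))) = 0"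
      and \<gamma>: "\<gamma> \<in> exponents 2 s"
    have "(\<Sum>\<alpha> | \<alpha> \<in> exponents 2 s \<and> \<alpha> 0 = \<gamma> 0 \<and> \<alpha> 1 = \<gamma> 1. c \<alpha> * (v i ^ \<alpha> 0 * w j ^ \<alpha> 1)) = 0"
    proof (rule sum_bimonomials_vanish[OF finite_exponents])
      fix \<mu> \<nu> :: 'a assume st: "\<mu> \<noteq> 0" "\<nu> \<noteq> 0"
      have "case_sum (vscale \<mu> v) (vscale \<nu> w) \<in> cone Z"
        using Proj_scale[OF zp(1) v(1) st(1)] Proj_scale[OF zp(2) w(1) st(2)] z(2)
        unfolding cone_def by blast
      then have "(\<Sum>\<alpha>\<in>exponents 2 s. c \<alpha> *
          mon 2 \<alpha> (\<lambda>i. poly_val (case_sum (vscale \<mu> v) (vscale \<nu> w)) (G i))) = 0"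
        using rel by blast
      moreover have "mon 2 \<alpha> (\<lambda>i. poly_val (case_sum (vscale \<mu> v) (vscale \<nu> w)) (G i)) =
          (v i ^ \<alpha> 0 * w j ^ \<alpha> 1) * (\<mu> ^ \<alpha> 0 * \<nu> ^ \<alpha> 1)" for \<alpha>
      proof -
        have "{..<2} = {0, 1 :: nat}" by auto
        then show ?thesis by (simp add: mon_def G_def vscale_def power_mult_distrib mult_ac)
      qed
      ultimately show "(\<Sum>\<alpha>\<in>exponents 2 s. c \<alpha> * (v i ^ \<alpha> 0 * w j ^ \<alpha> 1) * (\<mu> ^ \<alpha> 0 * \<nu> ^ \<alpha> 1)) = 0"
        by (simp only: mult.assoc)
    qed
    moreover have "{\<alpha>. \<alpha> \<in> exponents 2 s \<and> \<alpha> 0 = \<gamma> 0 \<and> \<alpha> 1 = \<gamma> 1} = {\<gamma>}"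
    proof -
      have "\<alpha> = \<gamma>" if "\<alpha> \<in> exponents 2 s" "\<alpha> 0 = \<gamma> 0" "\<alpha> 1 = \<gamma> 1" for \<alpha>
      proof (rule PiE_ext)
        show "\<alpha> \<in> PiE {..<2} (\<lambda>_. {..s})" "\<gamma> \<in> PiE {..<2} (\<lambda>_. {..s})"
          using that(1) \<gamma> unfolding exponents_def .
        show "\<alpha> l = \<gamma> l" if "l \<in> {..<2}" for l
        proof -
          have "l = 0 \<or> l = 1" using that by auto
          then show ?thesis using \<open>\<alpha> 0 = \<gamma> 0\<close> \<open>\<alpha> 1 = \<gamma> 1\<close> by blast
        qed
      qed
      then show ?thesis using \<gamma> by auto
    qed
    ultimately show "c \<gamma> = 0" using i j by simp
  qed
  ultimately show ?thesis by blast
qed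

text \<open>Each step of the chain contributes a form vanishing on the smaller set but not on the larger one. Since the
larger set is irreducible, the complement of the zeros of this form is dense in it, which is what
\<open>alg_independent_extend\<close> requires.\<close>

lemma chain_alg_independent:
  fixes Z :: "nat \<Rightarrow> 'a::field_char_0 bipoint set"
  assumes "\<forall>i\<le>d. closedin (zariski n m) (Z i) \<and> irreducible_in (zariski n m) (Z i)"
    and "\<forall>i<d. Z i \<subset> Z (Suc i)"
  shows "\<exists>G. (\<forall>i<d + 2. G i \<in> bihom_forms n m) \<and>
    alg_independent_on (cone (Z d)) (d + 2) (\<lambda>i e. poly_val e (G i))"
  using assms
proof (induction d)
  case 0
  then obtain z where "z \<in> Z 0" "z \<in> Proj n \<times> Proj m"
    unfolding irreducible_in_def topspace_zariski by blast
  then show ?case using alg_independent_base[of z n m "Z 0"] by (simp add: numeral_2_eq_2)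
next
  case (Suc d)
  let ?Y = "Z (Suc d)"
  obtain G where G: "\<And>i. i < d + 2 \<Longrightarrow> G i \<in> bihom_forms n m"
    "alg_independent_on (cone (Z d)) (d + 2) (\<lambda>i e. poly_val e (G i))"
    using Suc by auto
  have Y: "irreducible_in (zariski n m) ?Y" "?Y \<subseteq> Proj n \<times> Proj m"
    using Suc.prems(1) unfolding irreducible_in_def topspace_zariski by blast+
  have sub: "Z d \<subset> ?Y" using Suc.prems(2) by simp
  obtain F where F: "F \<subseteq> bihom_forms n m" "Z d = zero_locus n m F"
    using Suc.prems(1) unfolding closedin_zariski by (meson le_SucI order_refl)
  obtain z where z: "z \<in> ?Y" "z \<notin> Z d" using sub by blast
  then obtain f where f: "f \<in> F" "\<not> vanishes_at f z"
    using Y(2) unfolding F(2) zero_locus_def by blast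
  have form: "f \<in> bihom_forms n m" using F(1) f(1) by blast
  define S where "S = {z \<in> ?Y. \<not> vanishes_at f z}"
  have S: "S \<subseteq> Proj n \<times> Proj m" using Y(2) unfolding S_def by blast
  have "?Y \<subseteq> zero_locus n m {f} \<union> zariski n m closure_of S"
    using Y(2) closure_of_subset[of S "zariski n m"] S
    unfolding S_def topspace_zariski zero_locus_def by blast
  moreover have "closedin (zariski n m) (zero_locus n m {f})"
    unfolding closedin_zariski using form by blast
  moreover have "\<not> ?Y \<subseteq> zero_locus n m {f}" using z f unfolding zero_locus_def by blast
  ultimately have dense: "?Y \<subseteq> zariski n m closure_of S"
    using Y(1) unfolding irreducible_in_def by (metis closedin_closure_of)
  define G' where "G' = G(d + 2 := f)"
  have G': "G' i \<in> bihom_forms n m" if "i < Suc (d + 2)" for i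
    using that G(1) form unfolding G'_def by (auto simp: less_Suc_eq)
  have upd: "(\<lambda>i e. poly_val e (G i))(d + 2 := (\<lambda>e. poly_val e f)) = (\<lambda>i e. poly_val e (G' i))"
    unfolding G'_def by auto
  have "alg_independent_on (cone ?Y) (Suc (d + 2))
      ((\<lambda>i e. poly_val e (G i))(d + 2 := (\<lambda>e. poly_val e f)))"
  proof (rule alg_independent_extend[OF cone_mono G(2)])
    show "Z d \<subseteq> ?Y" using sub by blast
    show "poly_val e f = 0" if "e \<in> cone (Z d)" for e
      using that f(1) unfolding F(2) cone_def zero_locus_def vanishes_at_def by blast
    fix s c
    assume rel: "\<forall>e\<in>cone ?Y. poly_val e f \<noteq> 0 \<longrightarrow> (\<Sum>\<alpha>\<in>exponents (Suc (d + 2)) s. c \<alpha> *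
        mon (Suc (d + 2)) \<alpha> (\<lambda>i. ((\<lambda>i e. poly_val e (G i))(d + 2 := (\<lambda>e. poly_val e f))) i e)) = 0"
    have "cone S \<subseteq> {e \<in> cone ?Y. poly_val e f \<noteq> 0}"
    proof
      fix e assume "e \<in> cone S"
      then obtain v w y where y: "e = case_sum v w" "y \<in> S" "v \<in> fst y" "w \<in> snd y"
        unfolding cone_def by blast
      then have "poly_val e f \<noteq> 0"
        using vanishes_at_form_iff[OF form, of y v w] S unfolding S_def by blast
      then show "e \<in> {e \<in> cone ?Y. poly_val e f \<noteq> 0}" using y unfolding cone_def S_def by blast
    qed
    then have relS: "(\<Sum>\<alpha>\<in>exponents (Suc (d + 2)) s. c \<alpha> *
        mon (Suc (d + 2)) \<alpha> (\<lambda>i. poly_val e (G' i))) = 0" if "e \<in> cone S" for e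
      using rel that unfolding upd by blast
    show "\<forall>e\<in>cone ?Y. (\<Sum>\<alpha>\<in>exponents (Suc (d + 2)) s. c \<alpha> *
        mon (Suc (d + 2)) \<alpha> (\<lambda>i. ((\<lambda>i e. poly_val e (G i))(d + 2 := (\<lambda>e. poly_val e f))) i e)) = 0"
    proof
      fix e assume "e \<in> cone ?Y"
      then have "e \<in> cone (zariski n m closure_of S)" using cone_mono[OF dense] by blast
      from cone_closure_relation[OF G' S relS this]
      show "(\<Sum>\<alpha>\<in>exponents (Suc (d + 2)) s. c \<alpha> *
        mon (Suc (d + 2)) \<alpha> (\<lambda>i. ((\<lambda>i e. poly_val e (G i))(d + 2 := (\<lambda>e. poly_val e f))) i e)) = 0"
        unfolding upd .
    qed
  qed
  then have "alg_independent_on (cone ?Y) (Suc d + 2) (\<lambda>i e. poly_val e (G' i))" unfolding upd by simp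
  then show ?case using G' by auto
qed

text \<open>A relation that holds after pulling back along the parametrization \<open>\<Phi>\<close> holds on the cone over \<open>S\<close>,
hence on the cone over its closure. So the \<open>d + 2\<close> independent forms stay independent as polynomial functions
of the \<open>N\<close> parameters.\<close>

lemma chain_le_parameters:
  fixes Z :: "nat \<Rightarrow> 'a::field_char_0 bipoint set"
  assumes chain: "\<forall>i\<le>d. closedin (zariski n m) (Z i) \<and> irreducible_in (zariski n m) (Z i)"
      "\<forall>i<d. Z i \<subset> Z (Suc i)"
    and S: "S \<subseteq> Proj n \<times> Proj m" "Z d \<subseteq> zariski n m closure_of S"
    and param: "\<And>x. (\<lambda>u. \<Phi> u x) \<in> polyfun N" "cone S \<subseteq> range \<Phi>"
  shows "d + 2 \<le> N"
proof -
  obtain G where forms: "\<forall>i<d + 2. G i \<in> bihom_forms n m"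
    and ind: "alg_independent_on (cone (Z d)) (d + 2) (\<lambda>i e. poly_val e (G i))"
    using chain_alg_independent[OF chain] by (elim exE conjE)
  have "alg_independent_on UNIV (d + 2) (\<lambda>i u. poly_val (\<Phi> u) (G i))"
    unfolding alg_independent_on_def
  proof (intro allI impI)
    fix s c
    assume rel: "\<forall>u\<in>UNIV. (\<Sum>\<alpha>\<in>exponents (d + 2) s. c \<alpha> *
      mon (d + 2) \<alpha> (\<lambda>i. poly_val (\<Phi> u) (G i))) = 0"
    have relS: "(\<Sum>\<alpha>\<in>exponents (d + 2) s. c \<alpha> * mon (d + 2) \<alpha> (\<lambda>i. poly_val e (G i))) = 0"
      if "e \<in> cone S" for e
      using rel subsetD[OF param(2) that] by auto
    have "(\<Sum>\<alpha>\<in>exponents (d + 2) s. c \<alpha> * mon (d + 2) \<alpha> (\<lambda>i. poly_val e (G i))) = 0"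
      if "e \<in> cone (Z d)" for e
      by (rule cone_closure_relation[OF forms[rule_format] S(1) relS])
        (use cone_mono[OF S(2)] that in blast)+
    then show "\<forall>\<alpha>\<in>exponents (d + 2) s. c \<alpha> = 0"
      using ind unfolding alg_independent_on_def by blast
  qed
  then show ?thesis by (intro alg_independent_polyfun_le) (rule polyfun_poly_val, rule param(1))
qed

section \<open>Images of polynomial maps and dimension\<close>

definition pclass :: "nat \<Rightarrow> (nat \<Rightarrow> 'a::field) \<Rightarrow> (nat \<Rightarrow> 'a) set" where
  "pclass n v = proportional n `` {v}"

lemma pclass_Proj: "v \<in> cvec n \<Longrightarrow> v \<noteq> 0 \<Longrightarrow> pclass n v \<in> Proj n"
  unfolding pclass_def Proj_def by (intro quotientI) simp

lemma pclass_eq: "v \<in> cvec n \<Longrightarrow> v \<noteq> 0 \<Longrightarrow> pclass n v = {vscale c v |c. c \<noteq> 0}"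
  by (auto simp: pclass_def proportional_def cvec_def vscale_def fun_eq_iff)

lemma pclass_self: "v \<in> cvec n \<Longrightarrow> v \<noteq> 0 \<Longrightarrow> v \<in> pclass n v"
  by (auto simp: pclass_eq vscale_def intro: exI[of _ 1])

lemma Proj_memD: "P \<in> Proj n \<Longrightarrow> v \<in> P \<Longrightarrow> v \<in> cvec n \<and> v \<noteq> 0 \<and> P = pclass n v"
proof -
  assume P: "P \<in> Proj n" "v \<in> P"
  obtain v0 where v0: "v0 \<in> cvec n" "v0 \<noteq> 0" "P = {vscale c v0 |c. c \<noteq> 0}" by (rule Proj_rep[OF P(1)])
  then obtain c where c: "v = vscale c v0" "c \<noteq> 0" using P(2) by blast
  have v: "v \<in> cvec n" "v \<noteq> 0" using v0 c by (auto simp: cvec_def vscale_def fun_eq_iff)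
  have "P = {vscale d v |d. d \<noteq> 0}"
  proof (rule subset_antisym; rule subsetI)
    fix w assume "w \<in> P"
    then obtain d where "w = vscale d v0" "d \<noteq> 0" unfolding v0(3) by blast
    then have "w = vscale (d / c) v" "d / c \<noteq> 0" using c by (auto simp: vscale_def)
    then show "w \<in> {vscale d v |d. d \<noteq> 0}" by blast
  next
    fix w assume "w \<in> {vscale d v |d. d \<noteq> 0}"
    then obtain d where "w = vscale (d * c) v0" "d * c \<noteq> 0" using c by (auto simp: vscale_def mult.assoc)
    then show "w \<in> P" unfolding v0(3) by blast
  qed
  then show ?thesis using v pclass_eq[OF v] by simp
qed

lemma nonroot_exists:
  fixes p :: "'a::field_char_0 poly"
  assumes "p \<noteq> 0"
  obtains t where "poly p t \<noteq> 0"
proof -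
  have "{t. poly p t = 0} \<noteq> UNIV"
    using poly_roots_finite[OF assms] infinite_UNIV_char_0[where 'a = 'a] by metis
  then show ?thesis using that by blast
qed

text \<open>Parameters \<open>u\<close> at which \<open>\<Phi>\<close> or \<open>\<Psi>\<close> takes the value zero contribute no point, because a
point of projective space does not contain the zero vector.\<close>

definition image_points ::
  "nat \<Rightarrow> nat \<Rightarrow> ('c \<Rightarrow> nat \<Rightarrow> 'a::field) \<Rightarrow> ('c \<Rightarrow> nat \<Rightarrow> 'a) \<Rightarrow> 'a bipoint set" where
  "image_points n m \<Phi> \<Psi> = {z \<in> Proj n \<times> Proj m. \<exists>u. \<Phi> u \<in> fst z \<and> \<Psi> u \<in> snd z}"

text \<open>Suppose two closed sets cover the image but neither contains it, and take a point outside each. Along the line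
joining the two parameters, a form of the first set and a form of the second, as well as one coordinate in
each factor, become nonzero polynomials in one variable. At a parameter where none of them vanishes the map is
defined and its value lies in neither closed set.\<close>

lemma irreducible_image_points:
  fixes \<Phi> \<Psi> :: "(nat \<Rightarrow> 'a::field_char_0) \<Rightarrow> nat \<Rightarrow> 'a"
  assumes poly: "\<And>i. (\<lambda>u. \<Phi> u i) \<in> polyfun N" "\<And>j. (\<lambda>u. \<Psi> u j) \<in> polyfun N"
    and cvec: "\<And>u. \<Phi> u \<in> cvec n" "\<And>u. \<Psi> u \<in> cvec m"
    and ne: "image_points n m \<Phi> \<Psi> \<noteq> {}"
  shows "irreducible_in (zariski n m) (zariski n m closure_of image_points n m \<Phi> \<Psi>)"
proof -
  let ?S = "image_points n m \<Phi> \<Psi>"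
  let ?T = "zariski n m :: 'a bipoint topology"
  have S: "?S \<subseteq> topspace ?T" unfolding topspace_zariski image_points_def by blast
  have key: "?S \<subseteq> A \<or> ?S \<subseteq> B" if closed: "closedin ?T A" "closedin ?T B" and cover: "?S \<subseteq> A \<union> B" for A B
  proof (rule ccontr)
    assume "\<not> (?S \<subseteq> A \<or> ?S \<subseteq> B)"
    then obtain z z' where z: "z \<in> ?S" "z \<notin> A" and z': "z' \<in> ?S" "z' \<notin> B" by blast
    obtain F G where F: "F \<subseteq> bihom_forms n m" "A = zero_locus n m F"
      and G: "G \<subseteq> bihom_forms n m" "B = zero_locus n m G"
      using closed unfolding closedin_zariski by blast
    obtain f where f: "f \<in> F" "\<not> vanishes_at f z"
      using z S unfolding F(2) zero_locus_def topspace_zariski by blast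
    obtain g where g: "g \<in> G" "\<not> vanishes_at g z'"
      using z' S unfolding G(2) zero_locus_def topspace_zariski by blast
    have forms: "f \<in> bihom_forms n m" "g \<in> bihom_forms n m" using f F g G by auto
    obtain u where u: "\<Phi> u \<in> fst z" "\<Psi> u \<in> snd z" using z(1) unfolding image_points_def by blast
    obtain u' where u': "\<Phi> u' \<in> fst z'" "\<Psi> u' \<in> snd z'" using z'(1) unfolding image_points_def by blast
    have zP: "z \<in> Proj n \<times> Proj m" "z' \<in> Proj n \<times> Proj m" using z z' unfolding image_points_def by auto
    have "\<Phi> u \<noteq> 0" "\<Psi> u \<noteq> 0" using Proj_memD[OF _ u(1)] Proj_memD[OF _ u(2)] zP by auto
    then obtain i j where ij: "\<Phi> u i \<noteq> 0" "\<Psi> u j \<noteq> 0" by (auto simp: fun_eq_iff)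
    define l where "l t = (\<lambda>i. u i + t * (u' i - u i))" for t
    have l01: "l 0 = u" "l 1 = u'" by (auto simp: l_def)
    have pv: "(\<lambda>u. poly_val (case_sum (\<Phi> u) (\<Psi> u)) h) \<in> polyfun N" for h
    proof (rule polyfun_poly_val)
      fix s show "(\<lambda>u. case_sum (\<Phi> u) (\<Psi> u) s) \<in> polyfun N" by (cases s) (simp_all add: poly)
    qed
    obtain pf where pf: "\<And>t. poly_val (case_sum (\<Phi> (l t)) (\<Psi> (l t))) f = poly pf t"
      using polyfun_line[OF pv[of f], of u "\<lambda>i. u' i - u i"] unfolding l_def by blast
    obtain pg where pg: "\<And>t. poly_val (case_sum (\<Phi> (l t)) (\<Psi> (l t))) g = poly pg t"
      using polyfun_line[OF pv[of g], of u "\<lambda>i. u' i - u i"] unfolding l_def by blast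
    obtain px where px: "\<And>t. \<Phi> (l t) i = poly px t"
      using polyfun_line[OF poly(1)[of i], of u "\<lambda>i. u' i - u i"] unfolding l_def by blast
    obtain py where py: "\<And>t. \<Psi> (l t) j = poly py t"
      using polyfun_line[OF poly(2)[of j], of u "\<lambda>i. u' i - u i"] unfolding l_def by blast
    have "poly pf 0 \<noteq> 0" using f(2) vanishes_at_form_iff[OF forms(1) zP(1) u] pf[of 0] l01 by simp
    moreover have "poly pg 1 \<noteq> 0" using g(2) vanishes_at_form_iff[OF forms(2) zP(2) u'] pg[of 1] l01 by simp
    moreover have "poly px 0 \<noteq> 0" "poly py 0 \<noteq> 0" using ij px[of 0] py[of 0] l01 by auto
    ultimately have "pf * pg * px * py \<noteq> 0" by auto
    then obtain t where "poly (pf * pg * px * py) t \<noteq> 0" by (rule nonroot_exists)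
    then have t: "poly pf t \<noteq> 0" "poly pg t \<noteq> 0" and "\<Phi> (l t) i \<noteq> 0" "\<Psi> (l t) j \<noteq> 0"
      unfolding px[of t] py[of t] by auto
    then have nz: "\<Phi> (l t) \<noteq> 0" "\<Psi> (l t) \<noteq> 0" by (auto simp: zero_fun_def)
    define y where "y = (pclass n (\<Phi> (l t)), pclass m (\<Psi> (l t)))"
    have y: "y \<in> Proj n \<times> Proj m" "\<Phi> (l t) \<in> fst y" "\<Psi> (l t) \<in> snd y"
      using pclass_Proj[OF cvec(1) nz(1)] pclass_Proj[OF cvec(2) nz(2)]
        pclass_self[OF cvec(1) nz(1)] pclass_self[OF cvec(2) nz(2)] unfolding y_def by simp_all
    then have "y \<in> ?S" unfolding image_points_def by blast
    then have "y \<in> A \<or> y \<in> B" using cover by blast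
    moreover have "\<not> vanishes_at f y" "\<not> vanishes_at g y"
      using vanishes_at_form_iff[OF forms(1) y] vanishes_at_form_iff[OF forms(2) y] pf pg t by auto
    ultimately show False using f(1) g(1) unfolding F(2) G(2) zero_locus_def by blast
  qed
  show ?thesis unfolding irreducible_in_def
  proof (intro conjI allI impI)
    show "?T closure_of ?S \<noteq> {}" using ne closure_of_subset[OF S] by blast
    show "?T closure_of ?S \<subseteq> topspace ?T" by (rule closure_of_subset_topspace)
    fix A B assume AB: "closedin ?T A \<and> closedin ?T B \<and> ?T closure_of ?S \<subseteq> A \<union> B"
    then have "?S \<subseteq> A \<or> ?S \<subseteq> B" using key[of A B] closure_of_subset[OF S] by blast
    then show "?T closure_of ?S \<subseteq> A \<or> ?T closure_of ?S \<subseteq> B"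
      using AB closure_of_minimal by blast
  qed
qed

lemma irreducible_in_subtopology:
  assumes "closedin T X" "Z \<subseteq> X"
  shows "irreducible_in (subtopology T X) Z \<longleftrightarrow> irreducible_in T Z"
proof -
  have top: "topspace (subtopology T X) = X" using closedin_subset[OF assms(1)] by auto
  have cl: "closedin (subtopology T X) A \<longleftrightarrow> closedin T A \<and> A \<subseteq> X" for A
    by (rule closedin_closed_subtopology[OF assms(1)])
  have eq: "(\<forall>A B. closedin T A \<and> closedin T B \<and> Z \<subseteq> A \<union> B \<longrightarrow> Z \<subseteq> A \<or> Z \<subseteq> B) \<longleftrightarrow>
     (\<forall>A B. (closedin T A \<and> A \<subseteq> X) \<and> (closedin T B \<and> B \<subseteq> X) \<and> Z \<subseteq> A \<union> B \<longrightarrow> Z \<subseteq> A \<or> Z \<subseteq> B)"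
    (is "?L \<longleftrightarrow> ?R")
  proof
    assume R: ?R
    show ?L
    proof (intro allI impI)
      fix A B assume AB: "closedin T A \<and> closedin T B \<and> Z \<subseteq> A \<union> B"
      then have "closedin T (A \<inter> X)" "closedin T (B \<inter> X)" using assms(1) by auto
      moreover have "Z \<subseteq> (A \<inter> X) \<union> (B \<inter> X)" using AB assms(2) by blast
      ultimately have "Z \<subseteq> A \<inter> X \<or> Z \<subseteq> B \<inter> X"
        using R[THEN spec[of _ "A \<inter> X"], THEN spec[of _ "B \<inter> X"]] by blast
      then show "Z \<subseteq> A \<or> Z \<subseteq> B" by blast
    qed
  qed blast
  have "Z \<subseteq> topspace T" using assms closedin_subset by blast
  then show ?thesis
    unfolding irreducible_in_def top cl eq using assms(2) by (simp only: simp_thms)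
qed

text \<open>Chains in the subspace \<open>X\<close> are the same as chains of closed irreducible subsets of the ambient space that
lie in \<open>X\<close>, because \<open>X\<close> is closed.\<close>

lemma variety_dim_eqI:
  assumes X: "closedin (zariski n m) X"
    and upper: "\<And>d Z. \<forall>i\<le>d. closedin (zariski n m) (Z i) \<and> irreducible_in (zariski n m) (Z i) \<Longrightarrow>
      \<forall>i<d. Z i \<subset> Z (Suc i) \<Longrightarrow> Z d \<subseteq> X \<Longrightarrow> d \<le> D"
    and lower: "\<forall>i\<le>D. closedin (zariski n m) (Z i) \<and> irreducible_in (zariski n m) (Z i) \<and> Z i \<subseteq> X"
      "\<forall>i<D. Z i \<subset> Z (Suc i)"
  shows "variety_dim n m X = enat D"
proof -
  let ?T = "zariski n m"
  have eq: "closedin (subtopology ?T X) Y \<and> irreducible_in (subtopology ?T X) Y \<longleftrightarrow>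
      closedin ?T Y \<and> irreducible_in ?T Y \<and> Y \<subseteq> X" for Y
    unfolding closedin_closed_subtopology[OF X] using irreducible_in_subtopology[OF X, of Y] by blast
  show ?thesis
    unfolding variety_dim_def krull_dim_def eq
  proof (rule antisym)
    show "Sup {enat d |d. \<exists>Z. (\<forall>i\<le>d. closedin ?T (Z i) \<and> irreducible_in ?T (Z i) \<and> Z i \<subseteq> X) \<and>
        (\<forall>i<d. Z i \<subset> Z (Suc i))} \<le> enat D"
    proof (rule Sup_least, clarsimp)
      fix d Z assume "\<forall>i\<le>d. closedin ?T (Z i) \<and> irreducible_in ?T (Z i) \<and> Z i \<subseteq> X"
        "\<forall>i<d. Z i \<subset> Z (Suc i)"
      then show "d \<le> D" by (intro upper[of d Z]) auto
    qed
    show "enat D \<le> Sup {enat d |d. \<exists>Z. (\<forall>i\<le>d. closedin ?T (Z i) \<and> irreducible_in ?T (Z i) \<and> Z i \<subseteq> X) \<and>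
        (\<forall>i<d. Z i \<subset> Z (Suc i))}"
      by (rule Sup_upper) (use lower in blast)
  qed
qed

section \<open>Homogeneous coordinates\<close>

definition lin :: "nat \<Rightarrow> (nat \<Rightarrow> nat \<Rightarrow> 'a::field) \<Rightarrow> (nat \<Rightarrow> 'a) \<Rightarrow> nat \<Rightarrow> 'a" where
  "lin n A \<xi> = (\<lambda>i. if i \<le> n then \<Sum>l\<le>n. A i l * \<xi> l else 0)"

lemma lin_cvec: "lin n A \<xi> \<in> cvec n"
  by (simp add: lin_def cvec_def)

lemma lin_cong: "(\<And>i. i \<le> n \<Longrightarrow> \<xi> i = \<zeta> i) \<Longrightarrow> lin n A \<xi> = lin n A \<zeta>"
  by (auto simp: lin_def fun_eq_iff)

lemma lin_scale: "lin n A (\<lambda>i. c * \<xi> i) = vscale c (lin n A \<xi>)"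
  by (auto simp: lin_def vscale_def fun_eq_iff sum_distrib_left ac_simps)

lemma lin_sum: "lin n A (\<lambda>i. \<Sum>r\<in>R. c r * \<xi> r i) = (\<lambda>i. \<Sum>r\<in>R. c r * lin n A (\<xi> r) i)"
proof
  fix i
  have "(\<Sum>l\<le>n. \<Sum>r\<in>R. A i l * (c r * \<xi> r l)) = (\<Sum>r\<in>R. \<Sum>l\<le>n. A i l * (c r * \<xi> r l))"
    by (rule sum.swap)
  then show "lin n A (\<lambda>i. \<Sum>r\<in>R. c r * \<xi> r i) i = (\<Sum>r\<in>R. c r * lin n A (\<xi> r) i)"
    by (simp add: lin_def sum_distrib_left mult.left_commute)
qed

lemma polyfun_lin:
  "(\<And>l. l \<le> n \<Longrightarrow> (\<lambda>u. \<xi> u l) \<in> polyfun N) \<Longrightarrow> (\<lambda>u. lin n A (\<xi> u) i) \<in> polyfun N"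
  unfolding lin_def
  by (cases "i \<le> n") (auto intro!: polyfun_sum polyfun.mult polyfun.const[of 0] polyfun.const)

lemma matrix_inverse_commute:
  fixes A B :: "nat \<Rightarrow> nat \<Rightarrow> 'a::field"
  assumes AB: "\<And>i l. i \<le> n \<Longrightarrow> l \<le> n \<Longrightarrow> (\<Sum>j\<le>n. A i j * B j l) = (if i = l then 1 else 0)"
    and "i \<le> n" "l \<le> n"
  shows "(\<Sum>j\<le>n. B i j * A j l) = (if i = l then 1 else 0)"
proof -
  let ?A = "mat (Suc n) (Suc n) (\<lambda>(i, j). A i j)" and ?B = "mat (Suc n) (Suc n) (\<lambda>(i, j). B i j)"
  have "?A * ?B = 1\<^sub>m (Suc n)"
    by (rule eq_matI)
      (use AB in \<open>auto simp: scalar_prod_def atLeast0LessThan lessThan_Suc_atMost less_Suc_eq_le\<close>)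
  then have "?B * ?A = 1\<^sub>m (Suc n)" using mat_mult_left_right_inverse[of ?A "Suc n" ?B] by simp
  then have "1\<^sub>m (Suc n) $$ (i, l) = (?B * ?A) $$ (i, l)" by simp
  also have "\<dots> = (\<Sum>j\<in>{0..<Suc n}. B i j * A j l)"
    using assms(2,3) by (simp add: scalar_prod_def)
  also have "{0..<Suc n} = {..n}" by auto
  finally show ?thesis using assms(2,3) by simp
qed

lemma bihom_10_keys:
  assumes "f \<in> bihom n m 1 0" "t \<in> keys f"
  shows "\<exists>i\<le>n. t = Poly_Mapping.single (Inl i) 1"
proof -
  have t: "keys t \<subseteq> Inl ` {..n} \<union> Inr ` {..m}" "(\<Sum>i\<le>n. lookup t (Inl i)) = 1"
    "(\<Sum>j\<le>m. lookup t (Inr j)) = 0" using assms by (auto simp: bihom_def)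
  obtain i where "i \<in> {..n}" and i': "lookup t (Inl i) = 1" "\<forall>l\<in>{..n}. i \<noteq> l \<longrightarrow> lookup t (Inl l) = 0"
    using t(2) sum_eq_1_iff[OF finite_atMost, of "\<lambda>l. lookup t (Inl l)" n] by blast
  then have i: "i \<le> n" by simp
  have "t = Poly_Mapping.single (Inl i) 1"
  proof (rule poly_mapping_eqI)
    fix x
    show "lookup t x = lookup (Poly_Mapping.single (Inl i) 1) x"
    proof (cases x)
      case (Inl l)
      then show ?thesis
        using i' t(1) by (cases "l \<le> n") (auto simp: lookup_single when_def in_keys_iff)
    next
      case (Inr l)
      then show ?thesis
        using t(1,3) by (cases "l \<le> m") (auto simp: lookup_single when_def in_keys_iff)
    qed
  qed
  then show ?thesis using i by blast
qed

lemma bihom_01_keys: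
  assumes "f \<in> bihom n m 0 1" "t \<in> keys f"
  shows "\<exists>j\<le>m. t = Poly_Mapping.single (Inr j) 1"
proof -
  have t: "keys t \<subseteq> Inl ` {..n} \<union> Inr ` {..m}" "(\<Sum>i\<le>n. lookup t (Inl i)) = 0"
    "(\<Sum>j\<le>m. lookup t (Inr j)) = 1" using assms by (auto simp: bihom_def)
  obtain j where "j \<in> {..m}" and j': "lookup t (Inr j) = 1" "\<forall>l\<in>{..m}. j \<noteq> l \<longrightarrow> lookup t (Inr l) = 0"
    using t(3) sum_eq_1_iff[OF finite_atMost, of "\<lambda>l. lookup t (Inr l)" m] by blast
  then have j: "j \<le> m" by simp
  have "t = Poly_Mapping.single (Inr j) 1"
  proof (rule poly_mapping_eqI)
    fix x
    show "lookup t x = lookup (Poly_Mapping.single (Inr j) 1) x"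
    proof (cases x)
      case (Inl l)
      then show ?thesis
        using t(1,2) by (cases "l \<le> n") (auto simp: lookup_single when_def in_keys_iff)
    next
      case (Inr l)
      then show ?thesis
        using j' t(1) by (cases "l \<le> m") (auto simp: lookup_single when_def in_keys_iff)
    qed
  qed
  then show ?thesis using j by blast
qed

lemma poly_val_pscale: "poly_val e (pscale c f) = c * poly_val e f"
  by (simp add: pscale_def poly_val_mult poly_val_const)

text \<open>The map \<open>\<iota>\<close> selects one of the two groups of variables. Since the linear forms \<open>x j\<close> span the
variables, a matrix \<open>A\<close> recovers a vector from the values of the forms on it, and a left inverse of a square
matrix is also a right inverse; so \<open>lin n A\<close> is the inverse of the coordinate map.\<close>

lemma linear_coordinates:
  fixes x :: "nat \<Rightarrow> 'a::field bipoly" and \<iota> :: "nat \<Rightarrow> nat + nat"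
  assumes "inj \<iota>" and "inj_on x {..n}"
    and keys: "\<And>j t. j \<le> n \<Longrightarrow> t \<in> keys (x j) \<Longrightarrow> \<exists>i\<le>n. t = Poly_Mapping.single (\<iota> i) 1"
    and span: "\<And>i. i \<le> n \<Longrightarrow> var (\<iota> i) \<in> pv.span (x ` {..n})"
  shows "\<exists>A. (\<forall>e \<xi>. (\<forall>i\<le>n. e (\<iota> i) = lin n A \<xi> i) \<longrightarrow> (\<forall>j\<le>n. poly_val e (x j) = \<xi> j)) \<and>
    (\<forall>e. \<forall>i\<le>n. lin n A (\<lambda>j. poly_val e (x j)) i = e (\<iota> i))"
proof -
  let ?s = "\<lambda>i. Poly_Mapping.single (\<iota> i) (1::nat)"
  define B where "B j i = lookup (x j) (?s i)" for j i
  have B: "poly_val e (x j) = (\<Sum>i\<le>n. B j i * e (\<iota> i))" if "j \<le> n" for e j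
  proof -
    have inj: "inj_on ?s {..n}"
    proof (rule inj_onI)
      fix a b assume "?s a = ?s b"
      then have "lookup (?s a) (\<iota> a) = lookup (?s b) (\<iota> a)" by simp
      then have "\<iota> b = \<iota> a" by (simp add: lookup_single when_def split: if_splits)
      then show "a = b" using \<open>inj \<iota>\<close> by (simp add: inj_eq)
    qed
    have "poly_val e (x j) = (\<Sum>t\<in>?s ` {..n}. lookup (x j) t * monom_val e t)"
      by (rule poly_val_superset) (use keys[OF that] in auto)
    also have "\<dots> = (\<Sum>i\<le>n. B j i * e (\<iota> i))"
      unfolding sum.reindex[OF inj] B_def by (simp add: monom_val_def)
    finally show ?thesis .
  qed
  have "\<exists>c. \<forall>e. e (\<iota> i) = (\<Sum>j\<le>n. c j * poly_val e (x j))" if "i \<le> n" for i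
  proof -
    have "var (\<iota> i) \<in> range (\<lambda>c. \<Sum>f\<in>x ` {..n}. pscale (c f) f)"
      using span[OF that] pv.span_finite[of "x ` {..n}"] by auto
    then obtain c where c: "var (\<iota> i) = (\<Sum>f\<in>x ` {..n}. pscale (c f) f)" by blast
    have "e (\<iota> i) = (\<Sum>j\<le>n. c (x j) * poly_val e (x j))" for e
    proof -
      have "e (\<iota> i) = poly_val e (var (\<iota> i))" by simp
      also have "\<dots> = (\<Sum>j\<le>n. c (x j) * poly_val e (x j))"
        unfolding c poly_val_sum poly_val_pscale by (simp add: sum.reindex[OF \<open>inj_on x {..n}\<close>])
      finally show ?thesis .
    qed
    then show ?thesis by (intro exI[of _ "\<lambda>j. c (x j)"]) blast
  qed
  then obtain A where A: "\<And>i e. i \<le> n \<Longrightarrow> e (\<iota> i) = (\<Sum>j\<le>n. A i j * poly_val e (x j))" by metis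
  have AB: "(\<Sum>j\<le>n. A i j * B j l) = (if i = l then 1 else 0)" if "i \<le> n" "l \<le> n" for i l
  proof -
    define e where "e z = (if z = \<iota> l then 1 else 0 :: 'a)" for z
    have "poly_val e (x j) = B j l" if "j \<le> n" for j
      unfolding B[OF that] e_def using \<open>inj \<iota>\<close> \<open>l \<le> n\<close> by (simp add: inj_eq if_distrib cong: if_cong)
    then have "e (\<iota> i) = (\<Sum>j\<le>n. A i j * B j l)" unfolding A[OF that(1)] by simp
    then show ?thesis using \<open>inj \<iota>\<close> by (simp add: e_def inj_eq)
  qed
  show ?thesis
  proof (intro exI[of _ A] conjI allI impI)
    fix e \<xi> j assume e: "\<forall>i\<le>n. e (\<iota> i) = lin n A \<xi> i" and j: "j \<le> n"
    have "poly_val e (x j) = (\<Sum>i\<le>n. B j i * (\<Sum>l\<le>n. A i l * \<xi> l))"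
      unfolding B[OF j] using e by (intro sum.cong) (auto simp: lin_def)
    also have "\<dots> = (\<Sum>l\<le>n. (\<Sum>i\<le>n. B j i * A i l) * \<xi> l)"
      unfolding sum_distrib_left sum_distrib_right by (subst sum.swap) (simp add: mult.assoc)
    also have "\<dots> = (\<Sum>l\<le>n. (if j = l then 1 else 0) * \<xi> l)"
      using matrix_inverse_commute[OF AB j] by (intro sum.cong) auto
    also have "\<dots> = \<xi> j" using j by (simp add: if_distrib[of "\<lambda>x. x * _"] cong: if_cong)
    finally show "poly_val e (x j) = \<xi> j" .
  next
    fix e i assume "i \<le> n"
    then show "lin n A (\<lambda>j. poly_val e (x j)) i = e (\<iota> i)" using A[of i e] by (simp add: lin_def)
  qed
qed

definition nonzero_upto :: "nat \<Rightarrow> (nat \<Rightarrow> 'a::field) \<Rightarrow> bool" where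
  "nonzero_upto n \<xi> \<longleftrightarrow> (\<exists>i\<le>n. \<xi> i \<noteq> 0)"

text \<open>A pair of homogeneous coordinate systems together with the matrices that turn coordinates back into vectors.
It allows points to be handled through their coordinates \<open>(\<xi>, \<eta>)\<close>.\<close>

locale frame =
  fixes n m :: nat and x y :: "nat \<Rightarrow> 'a::field_char_0 bipoly" and A A' :: "nat \<Rightarrow> nat \<Rightarrow> 'a"
  assumes x_form: "j \<le> n \<Longrightarrow> x j \<in> bihom n m 1 0" and y_form: "j \<le> m \<Longrightarrow> y j \<in> bihom n m 0 1"
    and x_lin: "j \<le> n \<Longrightarrow> poly_val (case_sum (lin n A \<xi>) w) (x j) = \<xi> j"
    and y_lin: "j \<le> m \<Longrightarrow> poly_val (case_sum v (lin m A' \<eta>)) (y j) = \<eta> j"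
    and lin_x: "v \<in> cvec n \<Longrightarrow> lin n A (\<lambda>j. poly_val (case_sum v w) (x j)) = v"
    and lin_y: "w \<in> cvec m \<Longrightarrow> lin m A' (\<lambda>j. poly_val (case_sum v w) (y j)) = w"

lemma frame_exists:
  fixes x y :: "nat \<Rightarrow> 'a::field_char_0 bipoly"
  assumes "homogeneous_coordinates n m x y"
  obtains A A' where "frame n m x y A A'"
proof -
  have x: "inj_on x {..n}" "pv.span (x ` {..n}) = bihom n m 1 0"
    and y: "inj_on y {..m}" "pv.span (y ` {..m}) = bihom n m 0 1"
    using assms unfolding homogeneous_coordinates_def by blast+
  have xf: "x j \<in> bihom n m 1 0" if "j \<le> n" for j
    unfolding x(2)[symmetric] using that by (intro pv.span_base) simp
  have yf: "y j \<in> bihom n m 0 1" if "j \<le> m" for j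
    unfolding y(2)[symmetric] using that by (intro pv.span_base) simp
  have "\<exists>A. (\<forall>e \<xi>. (\<forall>i\<le>n. e (Inl i) = lin n A \<xi> i) \<longrightarrow> (\<forall>j\<le>n. poly_val e (x j) = \<xi> j)) \<and>
    (\<forall>e. \<forall>i\<le>n. lin n A (\<lambda>j. poly_val e (x j)) i = e (Inl i))"
  proof (rule linear_coordinates)
    show "\<exists>i\<le>n. t = Poly_Mapping.single (Inl i) 1" if "j \<le> n" "t \<in> keys (x j)" for j t
      by (rule bihom_10_keys[OF xf[OF that(1)] that(2)])
    show "var (Inl i) \<in> pv.span (x ` {..n})" if "i \<le> n" for i
      unfolding x(2) by (rule var_Inl_bihom[OF that])
  qed (simp_all add: x(1))
  then obtain A where A:
    "\<And>e \<xi> j. \<forall>i\<le>n. e (Inl i) = lin n A \<xi> i \<Longrightarrow> j \<le> n \<Longrightarrow> poly_val e (x j) = \<xi> j"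
    "\<And>e i. i \<le> n \<Longrightarrow> lin n A (\<lambda>j. poly_val e (x j)) i = e (Inl i)" by metis
  have "\<exists>A'. (\<forall>e \<eta>. (\<forall>i\<le>m. e (Inr i) = lin m A' \<eta> i) \<longrightarrow> (\<forall>j\<le>m. poly_val e (y j) = \<eta> j)) \<and>
    (\<forall>e. \<forall>i\<le>m. lin m A' (\<lambda>j. poly_val e (y j)) i = e (Inr i))"
  proof (rule linear_coordinates)
    show "\<exists>i\<le>m. t = Poly_Mapping.single (Inr i) 1" if "j \<le> m" "t \<in> keys (y j)" for j t
      by (rule bihom_01_keys[OF yf[OF that(1)] that(2)])
    show "var (Inr i) \<in> pv.span (y ` {..m})" if "i \<le> m" for i
      unfolding y(2) by (rule var_Inr_bihom[OF that])
  qed (simp_all add: y(1))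
  then obtain A' where A':
    "\<And>e \<eta> j. \<forall>i\<le>m. e (Inr i) = lin m A' \<eta> i \<Longrightarrow> j \<le> m \<Longrightarrow> poly_val e (y j) = \<eta> j"
    "\<And>e i. i \<le> m \<Longrightarrow> lin m A' (\<lambda>j. poly_val e (y j)) i = e (Inr i)" by metis
  have "frame n m x y A A'"
  proof
    show "lin n A (\<lambda>j. poly_val (case_sum v w) (x j)) = v" if "v \<in> cvec n" for v w
    proof
      fix i show "lin n A (\<lambda>j. poly_val (case_sum v w) (x j)) i = v i"
        using A(2)[of i "case_sum v w"] that by (cases "i \<le> n") (auto simp: lin_def cvec_def)
    qed
    show "lin m A' (\<lambda>j. poly_val (case_sum v w) (y j)) = w" if "w \<in> cvec m" for v w
    proof
      fix i show "lin m A' (\<lambda>j. poly_val (case_sum v w) (y j)) i = w i"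
        using A'(2)[of i "case_sum v w"] that by (cases "i \<le> m") (auto simp: lin_def cvec_def)
    qed
  qed (use xf yf A(1) A'(1) in auto)
  then show ?thesis by (rule that)
qed

context frame
begin

text \<open>Only the entries \<open>\<xi> i\<close> with \<open>i \<le> n\<close> and \<open>\<eta> j\<close> with \<open>j \<le> m\<close> matter, and they must not all
be zero in either factor.\<close>

definition pt :: "(nat \<Rightarrow> 'a) \<Rightarrow> (nat \<Rightarrow> 'a) \<Rightarrow> 'a bipoint" where
  "pt \<xi> \<eta> = (pclass n (lin n A \<xi>), pclass m (lin m A' \<eta>))"

lemma lin_nonzero: "lin n A \<xi> \<noteq> 0 \<longleftrightarrow> nonzero_upto n \<xi>"
proof
  assume ne: "lin n A \<xi> \<noteq> 0"
  show "nonzero_upto n \<xi>"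
  proof (rule ccontr)
    assume "\<not> nonzero_upto n \<xi>"
    then have "lin n A \<xi> = 0" by (auto simp: lin_def nonzero_upto_def fun_eq_iff)
    then show False using ne by simp
  qed
next
  assume "nonzero_upto n \<xi>"
  then obtain j where j: "j \<le> n" "\<xi> j \<noteq> 0" unfolding nonzero_upto_def by blast
  show "lin n A \<xi> \<noteq> 0"
  proof
    assume "lin n A \<xi> = 0"
    then have "lin n A \<xi> = lin n A (\<lambda>_. 0)" by (auto simp: lin_def fun_eq_iff)
    then have "\<xi> j = 0" using x_lin[OF j(1), of \<xi>] x_lin[OF j(1), of "\<lambda>_. 0"] by metis
    then show False using j(2) by simp
  qed
qed

lemma lin_nonzero': "lin m A' \<eta> \<noteq> 0 \<longleftrightarrow> nonzero_upto m \<eta>"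
proof
  assume ne: "lin m A' \<eta> \<noteq> 0"
  show "nonzero_upto m \<eta>"
  proof (rule ccontr)
    assume "\<not> nonzero_upto m \<eta>"
    then have "lin m A' \<eta> = 0" by (auto simp: lin_def nonzero_upto_def fun_eq_iff)
    then show False using ne by simp
  qed
next
  assume "nonzero_upto m \<eta>"
  then obtain j where j: "j \<le> m" "\<eta> j \<noteq> 0" unfolding nonzero_upto_def by blast
  show "lin m A' \<eta> \<noteq> 0"
  proof
    assume "lin m A' \<eta> = 0"
    then have "lin m A' \<eta> = lin m A' (\<lambda>_. 0)" by (auto simp: lin_def fun_eq_iff)
    then have "\<eta> j = 0" using y_lin[OF j(1), of _ \<eta>] y_lin[OF j(1), of _ "\<lambda>_. 0"] by metis
    then show False using j(2) by simp
  qed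
qed

lemma pt_Proj:
  assumes "nonzero_upto n \<xi>" "nonzero_upto m \<eta>"
  shows "pt \<xi> \<eta> \<in> Proj n \<times> Proj m" "lin n A \<xi> \<in> fst (pt \<xi> \<eta>)" "lin m A' \<eta> \<in> snd (pt \<xi> \<eta>)"
  using assms lin_nonzero lin_nonzero' by (auto simp: pt_def intro: pclass_Proj pclass_self lin_cvec)

lemma pt_cases:
  assumes "z \<in> Proj n \<times> Proj m" "v \<in> fst z" "w \<in> snd z"
  obtains \<xi> \<eta> where "nonzero_upto n \<xi>" "nonzero_upto m \<eta>" "z = pt \<xi> \<eta>" "v = lin n A \<xi>" "w = lin m A' \<eta>"
proof
  let ?e = "case_sum v w"
  have v: "v \<in> cvec n" "v \<noteq> 0" "fst z = pclass n v" using Proj_memD[of "fst z" n v] assms by auto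
  have w: "w \<in> cvec m" "w \<noteq> 0" "snd z = pclass m w" using Proj_memD[of "snd z" m w] assms by auto
  note e = lin_x[OF v(1), of w] lin_y[OF w(1), of v]
  show "v = lin n A (\<lambda>j. poly_val ?e (x j))" "w = lin m A' (\<lambda>j. poly_val ?e (y j))"
    using e by auto
  then show "nonzero_upto n (\<lambda>j. poly_val ?e (x j))" "nonzero_upto m (\<lambda>j. poly_val ?e (y j))"
    using v(2) w(2) lin_nonzero lin_nonzero' by metis+
  show "z = pt (\<lambda>j. poly_val ?e (x j)) (\<lambda>j. poly_val ?e (y j))"
    unfolding pt_def e using v(3) w(3) by (simp add: prod_eq_iff)
qed

lemma vanishes_at_pt:
  assumes "f \<in> bihom_forms n m" "nonzero_upto n \<xi>" "nonzero_upto m \<eta>"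
  shows "vanishes_at f (pt \<xi> \<eta>) \<longleftrightarrow> poly_val (case_sum (lin n A \<xi>) (lin m A' \<eta>)) f = 0"
  using vanishes_at_form_iff[OF assms(1) pt_Proj[OF assms(2,3)]] .

end

section \<open>Hankel loci and annihilating polynomials\<close>

lemma submatrix_map_mat: "submatrix (map_mat h A) I J = map_mat h (submatrix A I J)"
  by (rule eq_matI) (auto simp: submatrix_def pick_le)

lemma minors_map_mat:
  assumes "comm_ring_hom h"
  shows "minors r (map_mat h A) = h ` minors r A"
proof -
  interpret comm_ring_hom h by fact
  show ?thesis unfolding minors_def submatrix_map_mat hom_det by auto
qed

lemma comm_ring_hom_poly_val: "comm_ring_hom (poly_val e)"
  by unfold_locales (simp_all add: poly_val_add poly_val_mult)

text \<open>Every term of the determinant contains exactly one entry from each column, so its bidegree is the sum of the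
bidegrees of the columns.\<close>

lemma det_bihom:
  assumes B: "B \<in> carrier_mat r r"
    and entry: "\<And>i j. i < r \<Longrightarrow> j < r \<Longrightarrow> B $$ (i, j) \<in> bihom n m (a j) (b j)"
  shows "det B \<in> bihom n m (\<Sum>j<r. a j) (\<Sum>j<r. b j)"
  unfolding det_def'[OF B]
proof (rule bihom_sum)
  fix p assume "p \<in> {p. p permutes {0..<r}}"
  then have p: "p permutes {..<r}" by (simp add: atLeast0LessThan)
  have "(\<Prod>i = 0..<r. B $$ (i, p i)) \<in> bihom n m (\<Sum>i = 0..<r. a (p i)) (\<Sum>i = 0..<r. b (p i))"
    using permutes_in_image[OF p] by (intro bihom_prod entry) auto
  moreover have "(\<Sum>i = 0..<r. a (p i)) = (\<Sum>j<r. a j)" "(\<Sum>i = 0..<r. b (p i)) = (\<Sum>j<r. b j)"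
    using sum.permute[OF p, of a] sum.permute[OF p, of b] by (simp_all add: atLeast0LessThan comp_def)
  ultimately have prod: "(\<Prod>i = 0..<r. B $$ (i, p i)) \<in> bihom n m (\<Sum>j<r. a j) (\<Sum>j<r. b j)" by simp
  have eq: "(of_int (sign p) :: 'a bipoly) = Poly_Mapping.single 0 (of_int (sign p))"
    by (simp add: sign_def single_uminus)
  show "signof p * (\<Prod>i = 0..<r. B $$ (i, p i)) \<in> bihom n m (\<Sum>j<r. a j) (\<Sum>j<r. b j)"
    unfolding eq by (rule bihom_scale[OF prod])
qed

definition hankel :: "nat \<Rightarrow> nat \<Rightarrow> nat \<Rightarrow> (nat \<Rightarrow> 'r) \<Rightarrow> (nat \<Rightarrow> 'r) \<Rightarrow> 'r mat" where
  "hankel k c d x y = mat (k + 1) (c + d) (\<lambda>(i, j). if j < c then x (i + j) else y (i + (j - c)))"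

lemma minors_hankel_forms:
  assumes x: "\<And>i. i < k + c \<Longrightarrow> x i \<in> bihom n m 1 0" and y: "\<And>i. i < k + d \<Longrightarrow> y i \<in> bihom n m 0 1"
  shows "minors r (hankel k c d x y) \<subseteq> bihom_forms n m"
proof
  let ?H = "hankel k c d x y"
  fix f assume "f \<in> minors r ?H"
  then obtain I J where IJ: "f = det (submatrix ?H I J)" "I \<subseteq> {..<k + 1}" "J \<subseteq> {..<c + d}"
    "card I = r" "card J = r" by (auto simp: minors_def hankel_def)
  have sets: "{i. i < dim_row ?H \<and> i \<in> I} = I" "{j. j < dim_col ?H \<and> j \<in> J} = J"
    using IJ(2,3) by (auto simp: hankel_def)
  have "submatrix ?H I J \<in> carrier_mat r r"
    by (rule carrier_matI) (simp_all only: dim_submatrix sets IJ(4,5))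
  moreover have "submatrix ?H I J $$ (i, j) \<in>
      bihom n m (if pick J j < c then 1 else 0) (if pick J j < c then 0 else 1)"
    if ij: "i < r" "j < r" for i j
  proof -
    have "pick I i \<in> I" "pick J j \<in> J" using pick_in_set_le[of i I] pick_in_set_le[of j J] ij IJ by auto
    then have p: "pick I i < k + 1" "pick J j < c + d" using IJ(2,3) by auto
    have "submatrix ?H I J $$ (i, j) = ?H $$ (pick I i, pick J j)"
      by (rule submatrix_index) (simp_all only: sets IJ(4,5) ij)
    then show ?thesis using p x y by (auto simp: hankel_def)
  qed
  ultimately have "f \<in> bihom n m (\<Sum>j<r. if pick J j < c then 1 else 0) (\<Sum>j<r. if pick J j < c then 0 else 1)"
    unfolding IJ(1) by (rule det_bihom)
  then show "f \<in> bihom_forms n m" unfolding bihom_forms_def by blast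
qed

lemma zero_locus_ideal: "zero_locus n m (ideal.span F) = zero_locus n m F"
proof
  show "zero_locus n m (ideal.span F) \<subseteq> zero_locus n m F"
    using ideal.span_superset[of F] unfolding zero_locus_def by blast
  show "zero_locus n m F \<subseteq> zero_locus n m (ideal.span F)"
  proof
    fix z assume z: "z \<in> zero_locus n m F"
    have "ideal.span F \<subseteq> {f. vanishes_at f z}"
    proof (rule ideal.span_minimal)
      show "F \<subseteq> {f. vanishes_at f z}" using z unfolding zero_locus_def by blast
      show "ideal.subspace {f. vanishes_at f z}"
        by (auto simp: ideal.subspace_def vanishes_at_def poly_val_add poly_val_mult)
    qed
    then show "z \<in> zero_locus n m (ideal.span F)" using z unfolding zero_locus_def by blast
  qed
qed

text \<open>The linear functional on polynomials whose value at the \<open>i\<close>-th power of the variable is \<open>\<xi> i\<close>.\<close>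

definition pairing :: "(nat \<Rightarrow> 'a::comm_ring_1) \<Rightarrow> 'a poly \<Rightarrow> 'a" where
  "pairing \<xi> p = (\<Sum>i\<le>degree p. coeff p i * \<xi> i)"

lemma pairing_eq: "degree p \<le> d \<Longrightarrow> pairing \<xi> p = (\<Sum>i\<le>d. coeff p i * \<xi> i)"
  unfolding pairing_def by (rule sum.mono_neutral_left) (auto simp: coeff_eq_0)

lemma pairing_add: "pairing \<xi> (p + q) = pairing \<xi> p + pairing \<xi> q"
proof -
  let ?d = "max (degree p) (degree q)"
  have "pairing \<xi> (p + q) = (\<Sum>i\<le>?d. coeff (p + q) i * \<xi> i)"
    by (intro pairing_eq degree_add_le) auto
  also have "\<dots> = pairing \<xi> p + pairing \<xi> q"
    by (simp add: pairing_eq[of p ?d] pairing_eq[of q ?d] algebra_simps sum.distrib)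
  finally show ?thesis .
qed

lemma pairing_0 [simp]: "pairing \<xi> 0 = 0"
  by (simp add: pairing_def)

lemma pairing_smult: "pairing \<xi> (smult c p) = c * pairing \<xi> p"
  by (subst pairing_eq[of "smult c p" "degree p"])
    (simp_all add: degree_smult_le pairing_def sum_distrib_left mult.assoc)

lemma pairing_sum: "pairing \<xi> (\<Sum>i\<in>I. p i) = (\<Sum>i\<in>I. pairing \<xi> (p i))"
  by (induction I rule: infinite_finite_induct) (simp_all add: pairing_add)

lemma pairing_monom: "pairing \<xi> (monom c j) = c * \<xi> j"
proof -
  have "pairing \<xi> (monom c j) = (\<Sum>i\<le>j. coeff (monom c j) i * \<xi> i)"
    by (rule pairing_eq) (rule degree_monom_le)
  then show ?thesis by (simp add: if_distrib[of "\<lambda>x. x * _"] cong: if_cong)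
qed

lemma pairing_monom_mult:
  assumes "degree q \<le> k"
  shows "pairing \<xi> (monom 1 j * q) = (\<Sum>i\<le>k. coeff q i * \<xi> (j + i))"
proof -
  have "q = (\<Sum>i\<le>k. monom (coeff q i) i)" using poly_as_sum_of_monoms'[OF assms] by simp
  then have "monom 1 j * q = (\<Sum>i\<le>k. monom (coeff q i) (j + i))"
    by (metis (no_types, lifting) mult_1 mult_monom sum.cong sum_distrib_left)
  then show ?thesis by (simp add: pairing_sum pairing_monom)
qed

lemma pairing_powers:
  assumes "degree p \<le> n" "\<And>i. i \<le> n \<Longrightarrow> \<xi> i = (\<Sum>r\<in>R. a r * t r ^ i)"
  shows "pairing \<xi> p = (\<Sum>r\<in>R. a r * poly p (t r))"
proof -
  have "pairing \<xi> p = (\<Sum>i\<le>n. \<Sum>r\<in>R. a r * (coeff p i * t r ^ i))"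
    unfolding pairing_eq[OF assms(1)] using assms(2)
    by (intro sum.cong) (auto simp: sum_distrib_left ac_simps)
  also have "\<dots> = (\<Sum>r\<in>R. a r * (\<Sum>i\<le>n. coeff p i * t r ^ i))"
    by (subst sum.swap) (simp add: sum_distrib_left)
  also have "\<dots> = (\<Sum>r\<in>R. a r * poly p (t r))"
  proof -
    have "(\<Sum>i\<le>n. coeff p i * s ^ i) = poly p s" for s
      unfolding poly_altdef using assms(1) by (intro sum.mono_neutral_right) (auto simp: coeff_eq_0)
    then show ?thesis by simp
  qed
  finally show ?thesis .
qed

text \<open>The functional of \<open>\<xi>\<close> kills those multiples \<open>T ^ (u + j) * q\<close> whose degree stays within the index range
\<open>0..n\<close>, where \<open>k\<close> is a bound for the degree of \<open>q\<close>. With \<open>u = 1\<close> the entry \<open>\<xi> 0\<close> is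
disregarded. The use of \<open>k\<close> instead of the actual degree accounts for roots of \<open>q\<close> at infinity.\<close>

definition annihilates :: "nat \<Rightarrow> nat \<Rightarrow> nat \<Rightarrow> 'a::comm_ring_1 poly \<Rightarrow> (nat \<Rightarrow> 'a) \<Rightarrow> bool" where
  "annihilates n k u q \<xi> \<longleftrightarrow> (\<forall>j. u + j + k \<le> n \<longrightarrow> pairing \<xi> (monom 1 (u + j) * q) = 0)"

lemma annihilates_mult:
  assumes q: "annihilates n k u q \<xi>" and h: "degree h \<le> l"
  shows "annihilates n (k + l) u (h * q) \<xi>"
  unfolding annihilates_def
proof (intro allI impI)
  fix j assume j: "u + j + (k + l) \<le> n"
  have "h = (\<Sum>i\<le>l. monom (coeff h i) i)" using poly_as_sum_of_monoms'[OF h] by simp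
  then have "monom 1 (u + j) * (h * q) = monom 1 (u + j) * ((\<Sum>i\<le>l. monom (coeff h i) i) * q)" by simp
  also have "\<dots> = (\<Sum>i\<le>l. smult (coeff h i) (monom 1 (u + (j + i)) * q))"
    unfolding sum_distrib_left sum_distrib_right
  proof (rule sum.cong[OF refl])
    fix i
    have "monom 1 (u + j) * monom (coeff h i) i = smult (coeff h i) (monom 1 (u + (j + i)))"
      by (simp add: mult_monom smult_monom add.assoc)
    then show "monom 1 (u + j) * (monom (coeff h i) i * q) = smult (coeff h i) (monom 1 (u + (j + i)) * q)"
      by (metis mult.assoc mult_smult_left)
  qed
  also have "pairing \<xi> \<dots> = 0"
    using q j unfolding pairing_sum pairing_smult annihilates_def by (intro sum.neutral) auto
  finally show "pairing \<xi> (monom 1 (u + j) * (h * q)) = 0" .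
qed

context frame
begin

text \<open>The shifts \<open>u\<close> and \<open>w\<close> omit the first coordinate of the respective factor when they are 1. These shifted
loci separate the consecutive members of the chain that realizes the dimension.\<close>

definition locus :: "nat \<Rightarrow> nat \<Rightarrow> nat \<Rightarrow> 'a bipoint set" where
  "locus k u w = zero_locus n m (minors (k + 1)
     (hankel k (n + 1 - (u + k)) (m + 1 - (w + k)) (\<lambda>i. x (u + i)) (\<lambda>i. y (w + i))))"

lemma locus_minors_forms:
  assumes "u + k \<le> n + 1" "w + k \<le> m + 1"
  shows "minors (k + 1) (hankel k (n + 1 - (u + k)) (m + 1 - (w + k)) (\<lambda>i. x (u + i)) (\<lambda>i. y (w + i)))
    \<subseteq> bihom_forms n m"
  using assms by (intro minors_hankel_forms x_form y_form) auto

lemma closedin_locus: "u + k \<le> n + 1 \<Longrightarrow> w + k \<le> m + 1 \<Longrightarrow> closedin (zariski n m) (locus k u w)"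
  unfolding closedin_zariski locus_def using locus_minors_forms by blast

lemma pt_in_locus_iff:
  assumes le: "u + k \<le> n + 1" "w + k \<le> m + 1" and nz: "nonzero_upto n \<xi>" "nonzero_upto m \<eta>"
  shows "pt \<xi> \<eta> \<in> locus k u w \<longleftrightarrow>
    (\<exists>q. q \<noteq> 0 \<and> degree q \<le> k \<and> annihilates n k u q \<xi> \<and> annihilates m k w q \<eta>)"
proof -
  let ?c = "n + 1 - (u + k)" and ?d = "m + 1 - (w + k)"
  let ?H = "hankel k ?c ?d (\<lambda>i. x (u + i)) (\<lambda>i. y (w + i))"
  let ?h = "poly_val (case_sum (lin n A \<xi>) (lin m A' \<eta>))"
  have entry: "map_mat ?h ?H $$ (i, j) = (if j < ?c then \<xi> (u + j + i) else \<eta> (w + (j - ?c) + i))"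
    if "i < k + 1" "j < ?c + ?d" for i j
    using that le by (auto simp: hankel_def x_lin y_lin ac_simps)
  have "pt \<xi> \<eta> \<in> locus k u w \<longleftrightarrow> (\<forall>f\<in>minors (k + 1) ?H. vanishes_at f (pt \<xi> \<eta>))"
    unfolding locus_def zero_locus_def using pt_Proj(1)[OF nz] by blast
  also have "\<dots> \<longleftrightarrow> (\<forall>f\<in>minors (k + 1) ?H. ?h f = 0)"
    using vanishes_at_pt[OF _ nz] locus_minors_forms[OF le] by (meson subsetD)
  also have "\<dots> \<longleftrightarrow> minors (k + 1) (map_mat ?h ?H) \<subseteq> {0}"
    unfolding minors_map_mat[OF comm_ring_hom_poly_val] by auto
  also have "\<dots> \<longleftrightarrow> (\<exists>q. (\<exists>i<k + 1. q i \<noteq> 0) \<and>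
      (\<forall>j<?c + ?d. (\<Sum>i<k + 1. q i * map_mat ?h ?H $$ (i, j)) = 0))"
    by (rule maximal_minors_vanish_iff) (simp add: hankel_def)
  also have "\<dots> \<longleftrightarrow> (\<exists>q. (\<exists>i\<le>k. q i \<noteq> 0) \<and> (\<forall>j. u + j + k \<le> n \<longrightarrow> (\<Sum>i\<le>k. q i * \<xi> (u + j + i)) = 0) \<and>
      (\<forall>j. w + j + k \<le> m \<longrightarrow> (\<Sum>i\<le>k. q i * \<eta> (w + j + i)) = 0))"
  proof (rule ex_cong1, rule arg_cong2[of _ _ _ _ "(\<and>)"])
    fix q :: "nat \<Rightarrow> 'a"
    show "(\<exists>i<k + 1. q i \<noteq> 0) \<longleftrightarrow> (\<exists>i\<le>k. q i \<noteq> 0)" by (simp add: less_Suc_eq_le)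
    have eq: "(\<Sum>i<k + 1. q i * map_mat ?h ?H $$ (i, j)) =
        (\<Sum>i\<le>k. q i * (if j < ?c then \<xi> (u + j + i) else \<eta> (w + (j - ?c) + i)))" if "j < ?c + ?d" for j
      using entry[OF _ that] by (intro sum.cong) auto
    have "(\<forall>j<?c + ?d. (\<Sum>i<k + 1. q i * map_mat ?h ?H $$ (i, j)) = 0) \<longleftrightarrow>
      (\<forall>j<?c. (\<Sum>i\<le>k. q i * \<xi> (u + j + i)) = 0) \<and> (\<forall>j<?d. (\<Sum>i\<le>k. q i * \<eta> (w + j + i)) = 0)"
    proof (intro iffI conjI allI impI; (elim conjE)?)
      fix j assume all: "\<forall>j<?c + ?d. (\<Sum>i<k + 1. q i * map_mat ?h ?H $$ (i, j)) = 0" and j: "j < ?c"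
      then show "(\<Sum>i\<le>k. q i * \<xi> (u + j + i)) = 0" using all[rule_format, of j] eq[of j] by simp
    next
      fix j assume all: "\<forall>j<?c + ?d. (\<Sum>i<k + 1. q i * map_mat ?h ?H $$ (i, j)) = 0" and j: "j < ?d"
      then show "(\<Sum>i\<le>k. q i * \<eta> (w + j + i)) = 0" using all[rule_format, of "?c + j"] eq[of "?c + j"] by simp
    next
      fix j assume all: "\<forall>j<?c. (\<Sum>i\<le>k. q i * \<xi> (u + j + i)) = 0" "\<forall>j<?d. (\<Sum>i\<le>k. q i * \<eta> (w + j + i)) = 0"
        and j: "j < ?c + ?d"
      show "(\<Sum>i<k + 1. q i * map_mat ?h ?H $$ (i, j)) = 0"
      proof (cases "j < ?c")
        case True
        then show ?thesis unfolding eq[OF j] using all(1) by (simp only: if_True)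
      next
        case False
        then have "j - ?c < ?d" using j by linarith
        then show ?thesis unfolding eq[OF j] using all(2) False by (simp only: if_False)
      qed
    qed
    moreover have "j < ?c \<longleftrightarrow> u + j + k \<le> n" "j < ?d \<longleftrightarrow> w + j + k \<le> m" for j by auto
    ultimately show "(\<forall>j<?c + ?d. (\<Sum>i<k + 1. q i * map_mat ?h ?H $$ (i, j)) = 0) \<longleftrightarrow>
      (\<forall>j. u + j + k \<le> n \<longrightarrow> (\<Sum>i\<le>k. q i * \<xi> (u + j + i)) = 0) \<and>
      (\<forall>j. w + j + k \<le> m \<longrightarrow> (\<Sum>i\<le>k. q i * \<eta> (w + j + i)) = 0)" by simp
  qed
  also have "\<dots> \<longleftrightarrow> (\<exists>q. q \<noteq> 0 \<and> degree q \<le> k \<and> annihilates n k u q \<xi> \<and> annihilates m k w q \<eta>)"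
  proof (intro iffI; elim exE conjE)
    fix q i assume q: "i \<le> k" "q i \<noteq> 0" "\<forall>j. u + j + k \<le> n \<longrightarrow> (\<Sum>i\<le>k. q i * \<xi> (u + j + i)) = 0"
      "\<forall>j. w + j + k \<le> m \<longrightarrow> (\<Sum>i\<le>k. q i * \<eta> (w + j + i)) = 0"
    define Q where "Q = (\<Sum>i\<le>k. monom (q i) i)"
    have co: "coeff Q l = q l" if "l \<le> k" for l
      using that by (simp add: Q_def coeff_sum)
    have "degree Q \<le> k" unfolding Q_def
      by (intro degree_sum_le) (auto intro: order_trans[OF degree_monom_le])
    moreover have "Q \<noteq> 0" using co[OF q(1)] q(2) by auto
    ultimately show "\<exists>q. q \<noteq> 0 \<and> degree q \<le> k \<and> annihilates n k u q \<xi> \<and> annihilates m k w q \<eta>"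
      using q(3,4) co by (intro exI[of _ Q]) (simp add: annihilates_def pairing_monom_mult)
  next
    fix q assume q: "q \<noteq> 0" "degree q \<le> k" "annihilates n k u q \<xi>" "annihilates m k w q \<eta>"
    have "coeff q (degree q) \<noteq> 0" using q(1) by simp
    then show "\<exists>q. (\<exists>i\<le>k. q i \<noteq> 0) \<and> (\<forall>j. u + j + k \<le> n \<longrightarrow> (\<Sum>i\<le>k. q i * \<xi> (u + j + i)) = 0) \<and>
      (\<forall>j. w + j + k \<le> m \<longrightarrow> (\<Sum>i\<le>k. q i * \<eta> (w + j + i)) = 0)"
      using q by (intro exI[of _ "coeff q"] conjI) (auto simp: annihilates_def pairing_monom_mult)
  qed
  finally show ?thesis .
qed

end

section \<open>Power sums and secant spaces\<close>

definition node_poly :: "('b \<Rightarrow> 'a::field) \<Rightarrow> 'b set \<Rightarrow> 'b \<Rightarrow> 'a poly" where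
  "node_poly t R r = (\<Prod>s\<in>R - {r}. [:- t s, 1:])"

lemma degree_node_poly: "finite R \<Longrightarrow> r \<in> R \<Longrightarrow> degree (node_poly t R r) = card R - 1"
  unfolding node_poly_def by (subst degree_prod_sum_eq) auto

lemma node_poly_self: "finite R \<Longrightarrow> inj_on t R \<Longrightarrow> r \<in> R \<Longrightarrow> poly (node_poly t R r) (t r) \<noteq> 0"
  by (auto simp: node_poly_def poly_prod inj_on_def)

lemma node_poly_other: "finite R \<Longrightarrow> s \<in> R \<Longrightarrow> s \<noteq> r \<Longrightarrow> poly (node_poly t R r) (t s) = 0"
  by (auto simp: node_poly_def poly_prod)

text \<open>This is the nonvanishing of a Vandermonde determinant. It is obtained by pairing with the polynomial that has
all nodes but one as its roots.\<close>

lemma power_sums_independent: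
  fixes t a :: "'b \<Rightarrow> 'a::field"
  assumes R: "finite R" "inj_on t R" and zero: "\<And>i. i < card R \<Longrightarrow> (\<Sum>r\<in>R. a r * t r ^ i) = 0" and r: "r \<in> R"
  shows "a r = 0"
proof -
  let ?p = "node_poly t R r"
  define \<xi> where "\<xi> i = (\<Sum>r\<in>R. a r * t r ^ i)" for i
  have deg: "degree ?p = card R - 1" using R(1) r by (rule degree_node_poly)
  have "card R > 0" using R(1) r by (auto simp: card_gt_0_iff)
  then have "pairing \<xi> ?p = 0"
    unfolding pairing_def deg using zero by (intro sum.neutral) (auto simp: \<xi>_def)
  moreover have "pairing \<xi> ?p = (\<Sum>s\<in>R. a s * poly ?p (t s))"
    by (rule pairing_powers[OF order_refl]) (simp add: \<xi>_def)
  moreover have "\<dots> = a r * poly ?p (t r)"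
    unfolding sum.remove[OF R(1) r] by (simp add: node_poly_other[OF R(1)])
  ultimately show ?thesis using node_poly_self[OF R r] by simp
qed

text \<open>Since the functional of \<open>\<xi>\<close> kills the multiples of \<open>q\<close> in its range, \<open>\<xi> i\<close> is its value on
the remainder of \<open>T ^ i\<close> modulo \<open>q\<close>. That remainder has degree less than \<open>k\<close> and takes the value
\<open>t r ^ i\<close> at \<open>t r\<close>, so it is given by Lagrange interpolation.\<close>

lemma annihilates_imp_power_sum:
  fixes t :: "'b \<Rightarrow> 'a::field"
  assumes R: "finite R" "inj_on t R" "card R = k" and q: "degree q = k" "q \<noteq> 0" "\<And>r. r \<in> R \<Longrightarrow> poly q (t r) = 0"
    and ann: "annihilates n k 0 q \<xi>"
  shows "\<exists>a. \<forall>i\<le>n. \<xi> i = (\<Sum>r\<in>R. a r * t r ^ i)"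
proof -
  \<comment> \<open>The Lagrange basis of the polynomials of degree less than \<open>k\<close>.\<close>
  define l where "l r = smult (inverse (poly (node_poly t R r) (t r))) (node_poly t R r)" for r
  have ls: "poly (l r) (t s) = (if s = r then 1 else 0)" if "r \<in> R" "s \<in> R" for r s
    using that node_poly_self[OF R(1,2)] node_poly_other[OF R(1)] by (auto simp: l_def)
  have "\<xi> i = (\<Sum>r\<in>R. pairing \<xi> (l r) * t r ^ i)" if i: "i \<le> n" for i
  proof -
    define T :: "'a poly" where "T = monom 1 i"
    have rem: "T mod q = (\<Sum>r\<in>R. smult (t r ^ i) (l r))"
    proof (cases "k = 0")
      case True
      then show ?thesis using q(1,2) R(1,3) by (simp add: is_unit_iff_degree mod_eq_0_iff_dvd unit_imp_dvd)
    next
      case False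
      show ?thesis
      proof (rule poly_eqI_degree[of "t ` R"])
        have card: "card (t ` R) = k" using R by (simp add: card_image)
        show "degree (T mod q) < card (t ` R)"
          using degree_mod_less[OF q(2), of T] False q(1) card by auto
        have "degree (\<Sum>r\<in>R. smult (t r ^ i) (l r)) \<le> k - 1"
        proof (rule degree_sum_le[OF R(1)])
          fix r assume r: "r \<in> R"
          have "degree (smult (t r ^ i) (l r)) \<le> degree (l r)" by (rule degree_smult_le)
          also have "\<dots> \<le> degree (node_poly t R r)" unfolding l_def by (rule degree_smult_le)
          also have "\<dots> = k - 1" using degree_node_poly[OF R(1) r] R(3) by simp
          finally show "degree (smult (t r ^ i) (l r)) \<le> k - 1" .
        qed
        then show "degree (\<Sum>r\<in>R. smult (t r ^ i) (l r)) < card (t ` R)" using False card by simp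
        fix z assume "z \<in> t ` R"
        then obtain s where s: "s \<in> R" "z = t s" by blast
        have "poly (T mod q) z = poly T z"
          using q(3)[OF s(1)] s(2) by (metis add.left_neutral mult_zero_right div_mult_mod_eq poly_add poly_mult)
        also have "\<dots> = t s ^ i" by (simp add: T_def poly_monom s)
        also have "\<dots> = poly (\<Sum>r\<in>R. smult (t r ^ i) (l r)) z"
          using s ls R(1) by (simp add: poly_sum if_distrib[of "\<lambda>x. _ * x"] cong: sum.cong if_cong)
        finally show "poly (T mod q) z = poly (\<Sum>r\<in>R. smult (t r ^ i) (l r)) z" .
      qed
    qed
    have "pairing \<xi> (T div q * q) = 0"
    proof (cases "i < k")
      case True
      then have "T div q = 0" by (intro div_poly_less) (simp add: T_def degree_monom_eq q(1))
      then show ?thesis by simp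
    next
      case False
      have "degree (T div q) \<le> i - k"
      proof (cases "T div q = 0")
        case nz: False
        have "T div q * q = T - T mod q" by (simp add: minus_mod_eq_div_mult)
        moreover have "degree (T mod q) \<le> i"
          using degree_mod_less[OF q(2), of T] False q(1) by auto
        then have "degree (T - T mod q) \<le> i"
          by (intro degree_diff_le) (auto simp: T_def degree_monom_eq)
        ultimately show ?thesis using degree_mult_eq[OF nz q(2)] q(1) by simp
      qed simp
      from annihilates_mult[OF ann this] have "annihilates n (k + (i - k)) 0 (T div q * q) \<xi>" .
      from this[unfolded annihilates_def, rule_format, of 0]
      have "pairing \<xi> (monom 1 (0 + 0) * (T div q * q)) = 0"
        using False i by simp
      then show ?thesis by simp
    qed
    then have "pairing \<xi> T = pairing \<xi> (T mod q)"
      using pairing_add[of \<xi> "T div q * q" "T mod q"] by simp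
    also have "\<dots> = (\<Sum>r\<in>R. pairing \<xi> (l r) * t r ^ i)"
      unfolding rem pairing_sum pairing_smult by (simp add: mult.commute)
    finally show ?thesis by (simp add: T_def pairing_monom)
  qed
  then show ?thesis by (intro exI[of _ "\<lambda>r. pairing \<xi> (l r)"]) blast
qed

lemma annihilates_cong:
  assumes "annihilates n k u q \<xi>" "degree q \<le> k" "\<And>i. i \<le> n \<Longrightarrow> \<xi> i = \<zeta> i"
  shows "annihilates n k u q \<zeta>"
  using assms unfolding annihilates_def pairing_monom_mult[OF assms(2)] by auto

lemma annihilates_add:
  "annihilates n k u q \<xi> \<Longrightarrow> annihilates n k u q \<zeta> \<Longrightarrow> annihilates n k u q (\<lambda>i. \<xi> i + \<zeta> i)"
  unfolding annihilates_def pairing_def by (simp add: algebra_simps sum.distrib)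

lemma annihilates_scale: "annihilates n k u q \<xi> \<Longrightarrow> annihilates n k u q (\<lambda>i. c * \<xi> i)"
proof -
  have "pairing (\<lambda>i. c * \<xi> i) p = c * pairing \<xi> p" for p
    by (simp add: pairing_def sum_distrib_left ac_simps)
  then show "annihilates n k u q \<xi> \<Longrightarrow> annihilates n k u q (\<lambda>i. c * \<xi> i)"
    unfolding annihilates_def by simp
qed

text \<open>The functional of a power sum is a weighted sum of evaluations at the nodes. A node need not be a root of \<open>q\<close>
if its weight is zero, or if it is zero itself and the shift is positive.\<close>

lemma annihilates_power_sum:
  assumes "degree q \<le> k" and \<xi>: "\<And>i. i \<le> n \<Longrightarrow> \<xi> i = (\<Sum>r\<in>R. a r * t r ^ i)"
    and root: "\<And>r. r \<in> R \<Longrightarrow> a r * t r ^ u * poly q (t r) = 0"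
  shows "annihilates n k u q \<xi>"
  unfolding annihilates_def
proof (intro allI impI)
  fix j assume j: "u + j + k \<le> n"
  have "degree (monom 1 (u + j) * q) \<le> n"
    using degree_mult_le[of "monom 1 (u + j)" q] degree_monom_le[of "1::'a" "u + j"] assms(1) j by linarith
  from pairing_powers[OF this \<xi>]
  have "pairing \<xi> (monom 1 (u + j) * q) = (\<Sum>r\<in>R. a r * poly (monom 1 (u + j) * q) (t r))" .
  also have "\<dots> = 0"
  proof (rule sum.neutral, rule ballI)
    fix r assume "r \<in> R"
    have "a r * poly (monom 1 (u + j) * q) (t r) = (a r * t r ^ u * poly q (t r)) * t r ^ j"
      by (simp add: poly_monom power_add ac_simps)
    then show "a r * poly (monom 1 (u + j) * q) (t r) = 0" using root[OF \<open>r \<in> R\<close>] by simp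
  qed
  finally show "pairing \<xi> (monom 1 (u + j) * q) = 0" .
qed

lemma sum_fun_apply: "(\<Sum>r\<in>R. f r) i = (\<Sum>r\<in>R. f r i)"
  for f :: "'b \<Rightarrow> nat \<Rightarrow> 'a::comm_monoid_add"
  by (induction R rule: infinite_finite_induct) auto

lemma independent_familyI:
  fixes V :: "nat \<Rightarrow> nat \<Rightarrow> 'a::field"
  assumes "finite R" and ind: "\<And>c r. (\<forall>i. (\<Sum>s\<in>R. c s * V s i) = 0) \<Longrightarrow> r \<in> R \<Longrightarrow> c r = 0"
  shows "inj_on V R \<and> fv.independent (V ` R)"
proof
  show inj: "inj_on V R"
  proof (rule inj_onI, rule ccontr)
    fix r s assume rs: "r \<in> R" "s \<in> R" "V r = V s" "r \<noteq> s"
    define c where "c l = (if l = r then 1 else if l = s then - 1 else 0 :: 'a)" for l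
    have "(\<Sum>l\<in>R. c l * V l i) = 0" for i
    proof -
      have "(\<Sum>l\<in>R. c l * V l i) = (\<Sum>l\<in>{r, s}. c l * V l i)"
        using assms(1) rs by (intro sum.mono_neutral_right) (auto simp: c_def)
      then show ?thesis using rs by (simp add: c_def)
    qed
    then have "c r = 0" using ind rs(1) by blast
    then show False by (simp add: c_def)
  qed
  show "fv.independent (V ` R)"
  proof
    assume "fv.dependent (V ` R)"
    then obtain u where u: "\<exists>v\<in>V ` R. u v \<noteq> 0" "(\<Sum>v\<in>V ` R. vscale (u v) v) = 0"
      unfolding fv.dependent_finite[OF finite_imageI[OF assms(1)]] by blast
    have "(\<Sum>s\<in>R. u (V s) * V s i) = 0" for i
    proof -
      have "(\<Sum>s\<in>R. u (V s) * V s i) = (\<Sum>v\<in>V ` R. vscale (u v) v) i"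
        by (simp add: sum_fun_apply sum.reindex[OF inj] vscale_def)
      then show ?thesis using u(2) by simp
    qed
    then have "u (V r) = 0" if "r \<in> R" for r using ind[of "\<lambda>s. u (V s)" r] that by blast
    then show False using u(1) by blast
  qed
qed

lemma lin_power_sums_independent:
  assumes "inj_on t {..<k}" "k \<le> n + 1" and inj: "\<And>\<xi> \<zeta> j. lin n A \<xi> = lin n A \<zeta> \<Longrightarrow> j \<le> n \<Longrightarrow> \<xi> j = \<zeta> j"
  shows "inj_on (\<lambda>r. lin n A (\<lambda>i. t r ^ i)) {..<k} \<and>
    fv.independent ((\<lambda>r. lin n A (\<lambda>i. t r ^ i)) ` {..<k})"
proof (rule independent_familyI)
  fix c :: "nat \<Rightarrow> 'a" and r
  assume zero: "\<forall>i. (\<Sum>s<k. c s * lin n A (\<lambda>i. t s ^ i) i) = 0" and r: "r \<in> {..<k}"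
  have "lin n A (\<lambda>i. \<Sum>s<k. c s * t s ^ i) = lin n A (\<lambda>_. 0)"
    using zero unfolding lin_sum by (simp add: lin_def fun_eq_iff)
  from inj[OF this] have "(\<Sum>s<k. c s * t s ^ i) = 0" if "i < k" for i
    using that assms(2) by simp
  then show "c r = 0" using power_sums_independent[OF _ assms(1), of c r] r by simp
qed simp

lemma span_annihilated:
  assumes ann: "\<And>v. v \<in> V \<Longrightarrow> \<exists>\<zeta>. v = lin d B \<zeta> \<and> annihilates d k 0 q \<zeta>" and v: "v \<in> fv.span V"
  shows "\<exists>\<zeta>. v = lin d B \<zeta> \<and> annihilates d k 0 q \<zeta>"
  using v
proof (induction rule: fv.span_induct_alt)
  case base
  show ?case by (intro exI[of _ "\<lambda>_. 0"]) (auto simp: lin_def fun_eq_iff annihilates_def pairing_def)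
next
  case (step c v w)
  obtain \<zeta> \<zeta>' where z: "v = lin d B \<zeta>" "annihilates d k 0 q \<zeta>" "w = lin d B \<zeta>'" "annihilates d k 0 q \<zeta>'"
    using step ann by blast
  have "vscale c v + w = lin d B (\<lambda>i. c * \<zeta> i + \<zeta>' i)"
    unfolding z by (auto simp: lin_def vscale_def fun_eq_iff algebra_simps sum.distrib sum_distrib_left)
  moreover have "annihilates d k 0 q (\<lambda>i. c * \<zeta> i + \<zeta>' i)"
    using z by (intro annihilates_add annihilates_scale)
  ultimately show ?case by blast
qed

context frame
begin

lemma lin_inj: "lin n A \<xi> = lin n A \<zeta> \<Longrightarrow> j \<le> n \<Longrightarrow> \<xi> j = \<zeta> j"
  using x_lin by metis

lemma lin_inj': "lin m A' \<eta> = lin m A' \<zeta> \<Longrightarrow> j \<le> m \<Longrightarrow> \<eta> j = \<zeta> j"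
  using y_lin by metis

lemma pt_cong:
  "(\<And>i. i \<le> n \<Longrightarrow> \<xi> i = \<xi>' i) \<Longrightarrow> (\<And>j. j \<le> m \<Longrightarrow> \<eta> j = \<eta>' j) \<Longrightarrow> pt \<xi> \<eta> = pt \<xi>' \<eta>'"
  unfolding pt_def using lin_cong[of n \<xi> \<xi>' A] lin_cong[of m \<eta> \<eta>' A'] by simp

text \<open>Points in the bilinear span of \<open>k\<close> distinct points of the curve away from infinity, the point with
parameter \<open>t\<close> having the powers of \<open>t\<close> as its coordinates in both factors.\<close>

definition powersum_points :: "nat \<Rightarrow> 'a bipoint set" where
  "powersum_points k = {pt \<xi> \<eta> |\<xi> \<eta>. nonzero_upto n \<xi> \<and> nonzero_upto m \<eta> \<and>
     (\<exists>t a b. inj_on t {..<k} \<and> (\<forall>i\<le>n. \<xi> i = (\<Sum>r<k. a r * t r ^ i)) \<and>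
       (\<forall>j\<le>m. \<eta> j = (\<Sum>r<k. b r * t r ^ j)))}"

text \<open>The union whose closure is the secant variety of the curve; the curve itself is the locus for \<open>k = 1\<close>.\<close>

definition secant_union :: "nat \<Rightarrow> 'a bipoint set" where
  "secant_union k = (\<Union>z \<in> {z. (\<forall>i<k. z i \<in> locus 1 0 0) \<and> general_points k z}. bilinear_span n m k z)"

lemma powersum_points_subset_secant_union:
  assumes k: "k \<le> n + 1" "k \<le> m + 1"
  shows "powersum_points k \<subseteq> secant_union k"
proof
  fix p assume "p \<in> powersum_points k"
  then obtain \<xi> \<eta> t a b where p: "p = pt \<xi> \<eta>" and nz: "nonzero_upto n \<xi>" "nonzero_upto m \<eta>"
    and t: "inj_on t {..<k}" and \<xi>: "\<And>i. i \<le> n \<Longrightarrow> \<xi> i = (\<Sum>r<k. a r * t r ^ i)"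
    and \<eta>: "\<And>j. j \<le> m \<Longrightarrow> \<eta> j = (\<Sum>r<k. b r * t r ^ j)"
    unfolding powersum_points_def by blast
  define z where "z r = pt (\<lambda>i. t r ^ i) (\<lambda>i. t r ^ i)" for r
  have nzp: "nonzero_upto d (\<lambda>i. s ^ i)" for d and s :: 'a
    unfolding nonzero_upto_def by (intro exI[of _ 0]) simp
  have mem: "lin n A (\<lambda>i. t r ^ i) \<in> fst (z r)" "lin m A' (\<lambda>i. t r ^ i) \<in> snd (z r)" for r
    unfolding z_def using pt_Proj[OF nzp nzp] by auto
  have "z r \<in> locus 1 0 0" for r
  proof -
    let ?q = "[:- t r, 1:]"
    have "annihilates d 1 0 ?q (\<lambda>i. t r ^ i)" for d
      by (rule annihilates_power_sum[where R = "{r}" and a = "\<lambda>_. 1" and t = t]) auto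
    then show ?thesis unfolding z_def
      by (subst pt_in_locus_iff[OF _ _ nzp nzp]) (auto intro!: exI[of _ ?q])
  qed
  moreover have "general_points k z"
    unfolding general_points_def indep_points_def
  proof
    show "\<exists>v. (\<forall>i\<in>{..<k}. v i \<in> (fst \<circ> z) i) \<and> inj_on v {..<k} \<and> fv.independent (v ` {..<k})"
    proof (intro exI conjI)
      have "inj_on (\<lambda>r. lin n A (\<lambda>i. t r ^ i)) {..<k} \<and>
          fv.independent ((\<lambda>r. lin n A (\<lambda>i. t r ^ i)) ` {..<k})"
        by (rule lin_power_sums_independent[OF t k(1)]) (rule lin_inj)
      then show "inj_on (\<lambda>r. lin n A (\<lambda>i. t r ^ i)) {..<k}"
        and "fv.independent ((\<lambda>r. lin n A (\<lambda>i. t r ^ i)) ` {..<k})" by auto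
    qed (simp add: mem)
    show "\<exists>v. (\<forall>i\<in>{..<k}. v i \<in> (snd \<circ> z) i) \<and> inj_on v {..<k} \<and> fv.independent (v ` {..<k})"
    proof (intro exI conjI)
      have "inj_on (\<lambda>r. lin m A' (\<lambda>i. t r ^ i)) {..<k} \<and>
          fv.independent ((\<lambda>r. lin m A' (\<lambda>i. t r ^ i)) ` {..<k})"
        by (rule lin_power_sums_independent[OF t k(2)]) (rule lin_inj')
      then show "inj_on (\<lambda>r. lin m A' (\<lambda>i. t r ^ i)) {..<k}"
        and "fv.independent ((\<lambda>r. lin m A' (\<lambda>i. t r ^ i)) ` {..<k})" by auto
    qed (simp add: mem)
  qed
  moreover have "p \<in> bilinear_span n m k z"
  proof -
    have span: "pclass d (lin d B \<zeta>) \<subseteq> fv.span (\<Union>(P ` {..<k}))"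
      if \<zeta>: "\<And>i. i \<le> d \<Longrightarrow> \<zeta> i = (\<Sum>r<k. c r * t r ^ i)" and nz: "lin d B \<zeta> \<noteq> 0"
        and P: "\<And>r. lin d B (\<lambda>i. t r ^ i) \<in> P r" for d B \<zeta> c and P :: "nat \<Rightarrow> (nat \<Rightarrow> 'a) set"
    proof
      fix v assume "v \<in> pclass d (lin d B \<zeta>)"
      then obtain e where v: "v = vscale e (lin d B \<zeta>)" using pclass_eq[OF lin_cvec nz] by blast
      have eq: "lin d B \<zeta> = (\<Sum>r<k. vscale (c r) (lin d B (\<lambda>i. t r ^ i)))"
        using lin_cong[of d \<zeta> "\<lambda>i. \<Sum>r<k. c r * t r ^ i" B] \<zeta>
        by (simp add: lin_sum fun_eq_iff sum_fun_apply vscale_def)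
      show "v \<in> fv.span (\<Union>(P ` {..<k}))"
        unfolding v eq by (rule fv.span_scale, rule fv.span_sum, rule fv.span_scale, rule fv.span_base)
          (use P in auto)
    qed
    have "pclass n (lin n A \<xi>) \<subseteq> fv.span (\<Union>((fst \<circ> z) ` {..<k}))"
      using nz mem by (intro span[OF \<xi>]) (auto simp: lin_nonzero)
    moreover have "pclass m (lin m A' \<eta>) \<subseteq> fv.span (\<Union>((snd \<circ> z) ` {..<k}))"
      using nz mem by (intro span[OF \<eta>]) (auto simp: lin_nonzero')
    ultimately show ?thesis
      using pt_Proj(1)[OF nz] unfolding bilinear_span_def proj_span_def p pt_def by auto
  qed
  ultimately show "p \<in> secant_union k" unfolding secant_union_def by blast
qed

text \<open>Every point of the curve has an annihilator of degree at most 1. The product of those of the \<open>k\<close> chosen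
points annihilates each of the points, hence by linearity their whole spans in both factors.\<close>

lemma secant_union_subset_locus:
  assumes k: "1 \<le> k" "k \<le> n + 1" "k \<le> m + 1"
  shows "secant_union k \<subseteq> locus k 0 0"
proof
  fix p assume "p \<in> secant_union k"
  then obtain z where z: "\<And>r. r < k \<Longrightarrow> z r \<in> locus 1 0 0" and p: "p \<in> bilinear_span n m k z"
    unfolding secant_union_def by blast
  have "\<exists>q. q \<noteq> 0 \<and> degree q \<le> 1 \<and> (\<exists>\<xi> \<eta>. nonzero_upto n \<xi> \<and> nonzero_upto m \<eta> \<and> z r = pt \<xi> \<eta> \<and>
      annihilates n 1 0 q \<xi> \<and> annihilates m 1 0 q \<eta>)" if r: "r < k" for r
  proof -
    have zr: "z r \<in> Proj n \<times> Proj m" using z[OF r] unfolding locus_def zero_locus_def by blast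
    then have "fst (z r) \<in> Proj n" "snd (z r) \<in> Proj m" by auto
    then obtain v w where vw: "v \<in> fst (z r)" "w \<in> snd (z r)" by (metis Proj_rep)
    obtain \<xi> \<eta> where pt: "nonzero_upto n \<xi>" "nonzero_upto m \<eta>" "z r = pt \<xi> \<eta>"
      using pt_cases[OF zr vw] by metis
    then show ?thesis using pt_in_locus_iff[of 0 1 0 \<xi> \<eta>] z[OF r] by auto
  qed
  then obtain q where q: "\<And>r. r < k \<Longrightarrow> q r \<noteq> 0" "\<And>r. r < k \<Longrightarrow> degree (q r) \<le> 1"
    "\<And>r. r < k \<Longrightarrow> \<exists>\<xi> \<eta>. nonzero_upto n \<xi> \<and> nonzero_upto m \<eta> \<and> z r = pt \<xi> \<eta> \<and>
      annihilates n 1 0 (q r) \<xi> \<and> annihilates m 1 0 (q r) \<eta>" by metis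
  define Q where "Q = (\<Prod>r<k. q r)"
  have Q0: "Q \<noteq> 0" using q(1) by (simp add: Q_def)
  have deg: "degree (\<Prod>r\<in>R. q r) \<le> card R" if "R \<subseteq> {..<k}" for R
  proof -
    have "degree (\<Prod>r\<in>R. q r) \<le> sum (degree \<circ> q) R"
      using that finite_subset by (intro degree_prod_sum_le) auto
    also have "\<dots> \<le> sum (\<lambda>_. 1) R" using q(2) that by (intro sum_mono) auto
    finally show ?thesis by simp
  qed
  have Qk: "degree Q \<le> k" using deg[of "{..<k}"] by (simp add: Q_def)
  have annQ: "annihilates d k 0 Q \<zeta>" if r: "r < k" and "annihilates d 1 0 (q r) \<zeta>" for r d \<zeta>
  proof -
    have "degree (\<Prod>s\<in>{..<k} - {r}. q s) \<le> k - 1" using deg[of "{..<k} - {r}"] r by simp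
    from annihilates_mult[OF that(2) this] have "annihilates d k 0 ((\<Prod>s\<in>{..<k} - {r}. q s) * q r) \<zeta>"
      using k(1) by simp
    also have "(\<Prod>s\<in>{..<k} - {r}. q s) * q r = Q"
      unfolding Q_def using r by (subst prod.remove[of "{..<k}" r]) (auto simp: mult.commute)
    finally show ?thesis .
  qed
  have fst_ann: "\<exists>\<zeta>. v = lin n A \<zeta> \<and> annihilates n k 0 Q \<zeta>" if v: "v \<in> \<Union>((fst \<circ> z) ` {..<k})" for v
  proof -
    obtain r where r: "r < k" "v \<in> fst (z r)" using v by auto
    obtain \<xi> \<eta> where pt: "nonzero_upto n \<xi>" "nonzero_upto m \<eta>" "z r = pt \<xi> \<eta>" "annihilates n 1 0 (q r) \<xi>"
      using q(3)[OF r(1)] by blast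
    have "v \<in> pclass n (lin n A \<xi>)" using r(2) pt(3) by (simp add: pt_def)
    then obtain c where "v = lin n A (\<lambda>i. c * \<xi> i)"
      unfolding pclass_eq[OF lin_cvec lin_nonzero[THEN iffD2, OF pt(1)]] lin_scale by blast
    then show ?thesis using annihilates_scale[OF annQ[OF r(1) pt(4)]] by blast
  qed
  have snd_ann: "\<exists>\<zeta>. v = lin m A' \<zeta> \<and> annihilates m k 0 Q \<zeta>" if v: "v \<in> \<Union>((snd \<circ> z) ` {..<k})" for v
  proof -
    obtain r where r: "r < k" "v \<in> snd (z r)" using v by auto
    obtain \<xi> \<eta> where pt: "nonzero_upto n \<xi>" "nonzero_upto m \<eta>" "z r = pt \<xi> \<eta>" "annihilates m 1 0 (q r) \<eta>"
      using q(3)[OF r(1)] by blast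
    have "v \<in> pclass m (lin m A' \<eta>)" using r(2) pt(3) by (simp add: pt_def)
    then obtain c where "v = lin m A' (\<lambda>i. c * \<eta> i)"
      unfolding pclass_eq[OF lin_cvec lin_nonzero'[THEN iffD2, OF pt(2)]] lin_scale by blast
    then show ?thesis using annihilates_scale[OF annQ[OF r(1) pt(4)]] by blast
  qed
  have pP: "p \<in> Proj n \<times> Proj m" "fst p \<subseteq> fv.span (\<Union>((fst \<circ> z) ` {..<k}))"
    "snd p \<subseteq> fv.span (\<Union>((snd \<circ> z) ` {..<k}))"
    using p unfolding bilinear_span_def proj_span_def by auto
  then have "fst p \<in> Proj n" "snd p \<in> Proj m" by auto
  then obtain v w where vw: "v \<in> fst p" "w \<in> snd p" by (metis Proj_rep)
  obtain \<xi> \<eta> where pt: "nonzero_upto n \<xi>" "nonzero_upto m \<eta>" "p = pt \<xi> \<eta>" "v = lin n A \<xi>" "w = lin m A' \<eta>"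
    using pt_cases[OF pP(1) vw] by metis
  obtain \<zeta> where "lin n A \<xi> = lin n A \<zeta>" "annihilates n k 0 Q \<zeta>"
    using span_annihilated[OF fst_ann] pP(2) vw(1) pt(4) by blast
  then have "annihilates n k 0 Q \<xi>" using annihilates_cong[OF _ Qk] lin_inj by metis
  moreover obtain \<zeta>' where "lin m A' \<eta> = lin m A' \<zeta>'" "annihilates m k 0 Q \<zeta>'"
    using span_annihilated[OF snd_ann] pP(3) vw(2) pt(5) by blast
  then have "annihilates m k 0 Q \<eta>" using annihilates_cong[OF _ Qk] lin_inj' by metis
  ultimately show "p \<in> locus k 0 0"
    unfolding pt(3) using pt_in_locus_iff[of 0 k 0 \<xi> \<eta>] pt(1,2) k Q0 Qk by auto
qed

end

section \<open>Deformation to distinct roots\<close>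

text \<open>The equations form a Hankel-type system in the entries of \<open>\<Xi>\<close> with coefficients depending on a parameter. At
parameter 0 let \<open>j\<close> be the largest index of a nonzero coefficient. The square part of the system in the
columns \<open>j, \<dots>, j + n - k\<close> is then triangular with nonzero diagonal, so its determinant \<open>\<delta>\<close> does not
vanish at 0. Cramer's rule corrects \<open>\<delta> * \<xi>\<close> in those entries to a solution for all values of the parameter,
and the correction vanishes at 0 because \<open>\<xi>\<close> is a solution there.\<close>

lemma kernel_lift:
  fixes Q :: "nat \<Rightarrow> 'a::field poly" and \<xi> :: "nat \<Rightarrow> 'a"
  assumes r0: "r0 \<le> k" "poly (Q r0) 0 \<noteq> 0"
    and ker: "\<And>i. i + k \<le> n \<Longrightarrow> (\<Sum>r\<le>k. poly (Q r) 0 * \<xi> (i + r)) = 0"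
  shows "\<exists>\<Xi> c. c \<noteq> 0 \<and> (\<forall>i. i + k \<le> n \<longrightarrow> (\<Sum>r\<le>k. Q r * \<Xi> (i + r)) = 0) \<and>
    (\<forall>i. poly (\<Xi> i) 0 = c * \<xi> i)"
proof -
  define N where "N = n + 1 - k"
  have N: "i < N \<longleftrightarrow> i + k \<le> n" for i unfolding N_def by auto
  define j where "j = Max {r. r \<le> k \<and> poly (Q r) 0 \<noteq> 0}"
  have fin: "finite {r. r \<le> k \<and> poly (Q r) 0 \<noteq> 0}" by (rule finite_subset[of _ "{..k}"]) auto
  have "j \<in> {r. r \<le> k \<and> poly (Q r) 0 \<noteq> 0}"
    unfolding j_def using r0 by (intro Max_in[OF fin]) auto
  then have j: "j \<le> k" "poly (Q j) 0 \<noteq> 0" by auto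
  have top: "poly (Q r) 0 = 0" if "r \<le> k" "j < r" for r
    using Max_ge[OF fin, of r] that unfolding j_def by fastforce
  define B where "B = mat N N (\<lambda>(i, l). if i \<le> l + j \<and> l + j - i \<le> k then Q (l + j - i) else 0)"
  have B: "B \<in> carrier_mat N N" by (simp add: B_def)
  define \<delta> where "\<delta> = det B"
  define rhs where "rhs i = (\<Sum>r\<le>k. Q r * [:\<xi> (i + r):])" for i
  define y where "y l = (\<Sum>i<N. adj_mat B $$ (l, i) * rhs i)" for l
  define \<Xi> where "\<Xi> s = \<delta> * [:\<xi> s:] - (if j \<le> s \<and> s - j < N then y (s - j) else 0)" for s
  interpret ev: comm_ring_hom "\<lambda>p :: 'a poly. poly p 0" by unfold_locales auto
  have "poly \<delta> 0 = det (map_mat (\<lambda>p. poly p 0) B)" by (simp add: \<delta>_def)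
  also have "\<dots> = prod_list (diag_mat (map_mat (\<lambda>p. poly p 0) B))"
    by (rule det_lower_triangular[of N]) (auto simp: B_def top)
  also have "\<dots> \<noteq> 0"
    using j by (auto simp: prod_list_zero_iff diag_mat_def B_def)
  finally have \<delta>0: "poly \<delta> 0 \<noteq> 0" .
  have By: "(\<Sum>l<N. B $$ (i, l) * y l) = \<delta> * rhs i" if i: "i < N" for i
  proof -
    have "(\<Sum>l<N. B $$ (i, l) * y l) = (\<Sum>i'<N. (\<Sum>l<N. B $$ (i, l) * adj_mat B $$ (l, i')) * rhs i')"
      unfolding y_def sum_distrib_left sum_distrib_right by (subst sum.swap) (simp add: mult.assoc)
    also have "\<dots> = (\<Sum>i'<N. (B * adj_mat B) $$ (i, i') * rhs i')"
      using i B adj_mat(1)[OF B] by (intro sum.cong) (auto simp: scalar_prod_def atLeast0LessThan)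
    also have "\<dots> = (\<Sum>i'<N. (if i = i' then \<delta> else 0) * rhs i')"
      unfolding adj_mat(2)[OF B] using i by (intro sum.cong) (auto simp: \<delta>_def)
    also have "\<dots> = \<delta> * rhs i" using i by (simp add: if_distrib[of "\<lambda>x. x * _"] cong: if_cong)
    finally show ?thesis .
  qed
  have "(\<Sum>r\<le>k. Q r * \<Xi> (i + r)) = 0" if "i + k \<le> n" for i
  proof -
    have i: "i < N" using that N by simp
    have "(\<Sum>r\<le>k. Q r * (if j \<le> i + r \<and> i + r - j < N then y (i + r - j) else 0)) =
        (\<Sum>r | r \<le> k \<and> j \<le> i + r \<and> i + r - j < N. Q r * y (i + r - j))"
      by (rule sum.mono_neutral_cong_right) auto
    also have "\<dots> = (\<Sum>l | l < N \<and> i \<le> l + j \<and> l + j - i \<le> k. Q (l + j - i) * y l)"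
      by (rule sum.reindex_bij_witness[of _ "\<lambda>l. l + j - i" "\<lambda>r. i + r - j"]) auto
    also have "\<dots> = (\<Sum>l<N. B $$ (i, l) * y l)"
      using i by (intro sum.mono_neutral_cong_left) (auto simp: B_def)
    finally have "(\<Sum>r\<le>k. Q r * (if j \<le> i + r \<and> i + r - j < N then y (i + r - j) else 0)) = \<delta> * rhs i"
      using By[OF i] by simp
    moreover have "(\<Sum>r\<le>k. Q r * (\<delta> * [:\<xi> (i + r):])) = \<delta> * rhs i"
      unfolding rhs_def sum_distrib_left by (intro sum.cong refl mult.left_commute)
    ultimately show ?thesis
      unfolding \<Xi>_def right_diff_distrib sum_subtractf by simp
  qed
  moreover have "poly (\<Xi> s) 0 = poly \<delta> 0 * \<xi> s" for s
  proof -
    have "poly (rhs i) 0 = 0" if "i < N" for i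
      using ker[of i] that N by (simp add: rhs_def poly_sum mult.commute)
    then have "poly (y l) 0 = 0" for l by (simp add: y_def poly_sum)
    then show ?thesis by (simp add: \<Xi>_def)
  qed
  ultimately show ?thesis using \<delta>0 by (intro exI[of _ \<Xi>] exI[of _ "poly \<delta> 0"]) blast
qed

lemma coeff_prod_linear_factors:
  fixes \<alpha> \<beta> :: "nat \<Rightarrow> 'a::comm_ring_1 poly"
  shows "\<exists>Q. \<forall>s r. coeff (\<Prod>i<k. [:poly (\<beta> i) s, poly (\<alpha> i) s:]) r = poly (Q r) s"
proof (induction k)
  case 0
  show ?case by (intro exI[of _ "\<lambda>r. if r = 0 then 1 else 0"]) (auto simp: coeff_1)
next
  case (Suc k)
  then obtain Q where Q: "\<And>s r. coeff (\<Prod>i<k. [:poly (\<beta> i) s, poly (\<alpha> i) s:]) r = poly (Q r) s" by blast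
  show ?case
  proof (intro exI[of _ "\<lambda>r. \<beta> k * Q r + (case r of 0 \<Rightarrow> 0 | Suc r' \<Rightarrow> \<alpha> k * Q r')"] allI)
    fix s r
    have "(\<Prod>i<Suc k. [:poly (\<beta> i) s, poly (\<alpha> i) s:]) =
        [:poly (\<beta> k) s, poly (\<alpha> k) s:] * (\<Prod>i<k. [:poly (\<beta> i) s, poly (\<alpha> i) s:])"
      by (simp add: mult.commute)
    then show "coeff (\<Prod>i<Suc k. [:poly (\<beta> i) s, poly (\<alpha> i) s:]) r =
        poly (\<beta> k * Q r + (case r of 0 \<Rightarrow> 0 | Suc r' \<Rightarrow> \<alpha> k * Q r')) s"
      by (cases r) (simp_all add: Q coeff_pCons)
  qed
qed

text \<open>Write \<open>q\<close> as a product of \<open>k\<close> factors \<open>\<alpha> i * T + \<beta> i\<close>, with constant factors for the missing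
degrees, that is for the roots at infinity. Move the \<open>i\<close>-th finite root with speed \<open>i + 1\<close>, and replace
the \<open>i\<close>-th constant factor by one with the root \<open>1 / ((i + 1) * s)\<close>. The degree of the product is
\<open>k\<close> and the roots are distinct unless \<open>s\<close> is a zero of \<open>\<Delta>\<close>, the product of the leading coefficients
of the factors and of the determinants of pairs of factors.\<close>

lemma distinct_root_deformation:
  fixes q :: "'a::{alg_closed_field, field_char_0} poly"
  assumes q: "q \<noteq> 0" "degree q \<le> k"
  obtains Q :: "nat \<Rightarrow> 'a poly" and p :: "'a \<Rightarrow> 'a poly" and \<Delta> :: "'a poly"
  where "\<And>s r. coeff (p s) r = poly (Q r) s" "p 0 = q" "\<Delta> \<noteq> 0"
    "\<And>s. poly \<Delta> s \<noteq> 0 \<Longrightarrow> degree (p s) = k \<and> p s \<noteq> 0 \<and> (\<exists>t. inj_on t {..<k} \<and> (\<forall>i<k. poly (p s) (t i) = 0))"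
proof -
  obtain X where X: "size X = degree q" "q = smult (lead_coeff q) (\<Prod>x\<in>#X. [:- x, 1:])"
    using alg_closed_imp_factorization[OF q(1)] by blast
  obtain xs where xs: "mset xs = X" using ex_mset by blast
  define d where "d = degree q"
  have len: "length xs = d" using X(1) xs d_def by auto
  define c where "c = lead_coeff q"
  have c: "c \<noteq> 0" using q(1) by (simp add: c_def)
  define \<alpha> :: "nat \<Rightarrow> 'a poly" where "\<alpha> i = (if i < d then 1 else [:0, - of_nat (Suc i):])" for i
  define \<beta> :: "nat \<Rightarrow> 'a poly" where "\<beta> i = (if i < d then [:- (xs ! i), - of_nat (Suc i):] else 1)" for i
  define p where "p s = smult c (\<Prod>i<k. [:poly (\<beta> i) s, poly (\<alpha> i) s:])" for s
  obtain Q0 where Q0: "\<And>s r. coeff (\<Prod>i<k. [:poly (\<beta> i) s, poly (\<alpha> i) s:]) r = poly (Q0 r) s"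
    using coeff_prod_linear_factors[where k = k and \<alpha> = \<alpha> and \<beta> = \<beta>] by blast
  define Q where "Q r = smult c (Q0 r)" for r
  define \<Delta> where "\<Delta> = (\<Prod>i<k. \<alpha> i) * (\<Prod>i<k. \<Prod>l<i. \<alpha> i * \<beta> l - \<alpha> l * \<beta> i)"
  show ?thesis
  proof (rule that)
    show "coeff (p s) r = poly (Q r) s" for s r by (simp add: p_def Q_def Q0)
    have "(\<Prod>i<k. [:poly (\<beta> i) 0, poly (\<alpha> i) 0:]) = (\<Prod>i<d. [:- (xs ! i), 1:])"
      using q(2) by (intro prod.mono_neutral_cong_right) (auto simp: \<alpha>_def \<beta>_def d_def one_pCons)
    also have "\<dots> = (\<Prod>x\<leftarrow>xs. [:- x, 1:])"
      by (simp add: prod.list_conv_set_nth len atLeast0LessThan)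
    also have "\<dots> = (\<Prod>x\<in>#X. [:- x, 1:])"
      unfolding xs[symmetric] by (simp add: prod_mset_prod_list flip: mset_map)
    finally show "p 0 = q" using X(2) by (simp add: p_def c_def)
    have "\<alpha> i * \<beta> l - \<alpha> l * \<beta> i \<noteq> 0" if "l < i" for i l
    proof -
      consider "i < d" | "l < d" "d \<le> i" | "d \<le> l" using that by linarith
      then show ?thesis
      proof cases
        case 1
        then have "coeff (\<alpha> i * \<beta> l - \<alpha> l * \<beta> i) 1 = of_nat (Suc i) - of_nat (Suc l)"
          using that by (simp add: \<alpha>_def \<beta>_def)
        also have "\<dots> \<noteq> (0 :: 'a)" using that by (metis Suc_inject eq_iff_diff_eq_0 less_irrefl of_nat_eq_iff)
        finally show ?thesis by auto
      next
        case 2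
        then have "coeff (\<alpha> i * \<beta> l - \<alpha> l * \<beta> i) 0 = - 1" by (simp add: \<alpha>_def \<beta>_def)
        then show ?thesis by auto
      next
        case 3
        then have "coeff (\<alpha> i * \<beta> l - \<alpha> l * \<beta> i) 1 = of_nat (Suc l) - of_nat (Suc i)"
          using that by (simp add: \<alpha>_def \<beta>_def)
        also have "\<dots> \<noteq> (0 :: 'a)" using that by (metis Suc_inject eq_iff_diff_eq_0 less_irrefl of_nat_eq_iff)
        finally show ?thesis by auto
      qed
    qed
    moreover have "\<alpha> i \<noteq> 0" for i
      using of_nat_neq_0[of i, where 'a = 'a] by (auto simp: \<alpha>_def simp del: of_nat_Suc)
    ultimately show "\<Delta> \<noteq> 0" by (auto simp: \<Delta>_def)
    fix s assume "poly \<Delta> s \<noteq> 0"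
    then have \<Delta>s: "\<forall>i<k. poly (\<alpha> i) s \<noteq> 0"
      "\<forall>i<k. \<forall>l<i. poly (\<alpha> i) s * poly (\<beta> l) s - poly (\<alpha> l) s * poly (\<beta> i) s \<noteq> 0"
      by (auto simp: \<Delta>_def poly_prod)
    have \<alpha>0: "poly (\<alpha> i) s \<noteq> 0" if "i < k" for i using \<Delta>s(1) that by blast
    have disj: "poly (\<alpha> i) s * poly (\<beta> l) s \<noteq> poly (\<alpha> l) s * poly (\<beta> i) s" if "i < k" "l < i" for i l
      using \<Delta>s(2) that by auto
    have nz: "p s \<noteq> 0" using c \<alpha>0 by (auto simp: p_def)
    moreover have "degree (p s) = k"
    proof -
      have "degree (\<Prod>i<k. [:poly (\<beta> i) s, poly (\<alpha> i) s:]) =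
          (\<Sum>i<k. degree [:poly (\<beta> i) s, poly (\<alpha> i) s:])"
        by (rule degree_prod_sum_eq) (use \<alpha>0 in auto)
      also have "\<dots> = (\<Sum>i<k. 1)" using \<alpha>0 by (intro sum.cong) auto
      finally show ?thesis using c by (simp add: p_def)
    qed
    moreover define t where "t i = - poly (\<beta> i) s / poly (\<alpha> i) s" for i
    have "t l \<noteq> t i" if "i < k" "l < i" for i l
      using disj[OF that] \<alpha>0[OF that(1)] \<alpha>0[of l] that by (auto simp: t_def field_simps)
    then have "inj_on t {..<k}" by (intro linorder_inj_onI) auto
    moreover have "poly (p s) (t i) = 0" if "i < k" for i
      using that \<alpha>0[OF that] by (auto simp: p_def poly_prod t_def intro!: bexI[of _ i])
    ultimately show "degree (p s) = k \<and> p s \<noteq> 0 \<and>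
        (\<exists>t. inj_on t {..<k} \<and> (\<forall>i<k. poly (p s) (t i) = 0))" by blast
  qed
qed

lemma polyfun_curve:
  fixes v :: "nat + nat \<Rightarrow> 'a::comm_ring_1 poly"
  shows "\<exists>p. \<forall>s. poly_val (\<lambda>x. poly (v x) s) f = poly p s"
proof -
  have "(\<lambda>u. poly_val (\<lambda>x. poly (v x) (u 0)) f) \<in> polyfun (Suc 0)"
    by (rule polyfun_poly_val) (rule polyfun_poly)
  from polyfun_line[OF this, of "\<lambda>_. 0" "\<lambda>_. 1"] show ?thesis by simp
qed

text \<open>A point of the locus is the value at 0 of a polynomial curve whose general member is a powersum point: deform the
annihilator to distinct roots and lift the point along. A form vanishing on all powersum points then vanishes at
infinitely many parameters of the curve, hence identically along it.\<close>

lemma locus_subset_closure_powersum_points: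
  fixes x y :: "nat \<Rightarrow> 'a::{alg_closed_field, field_char_0} bipoly"
  assumes "frame n m x y A A'" and k: "k \<le> n + 1" "k \<le> m + 1"
  shows "frame.locus n m x y k 0 0 \<subseteq> zariski n m closure_of (frame.powersum_points n m A A' k)"
proof -
  interpret frame n m x y A A' by fact
  have sub: "powersum_points k \<subseteq> Proj n \<times> Proj m"
    unfolding powersum_points_def using pt_Proj(1) by blast
  show ?thesis
  proof
    fix z assume z: "z \<in> locus k 0 0"
    then have zP: "z \<in> Proj n \<times> Proj m" unfolding locus_def zero_locus_def by blast
    then have "fst z \<in> Proj n" "snd z \<in> Proj m" by auto
    then obtain v w where vw: "v \<in> fst z" "w \<in> snd z" by (metis Proj_rep)
    obtain \<xi> \<eta> where nz: "nonzero_upto n \<xi>" "nonzero_upto m \<eta>" and zpt: "z = pt \<xi> \<eta>"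
      using pt_cases[OF zP vw] by metis
    obtain q where q: "q \<noteq> 0" "degree q \<le> k" "annihilates n k 0 q \<xi>" "annihilates m k 0 q \<eta>"
      using z pt_in_locus_iff[of 0 k 0 \<xi> \<eta>] nz k unfolding zpt by auto
    obtain Q p \<Delta> where Q: "\<And>s r. coeff (p s) r = poly (Q r) s" "p 0 = q" "\<Delta> \<noteq> 0"
      and gen: "\<And>s. poly \<Delta> s \<noteq> 0 \<Longrightarrow> degree (p s) = k \<and> p s \<noteq> 0 \<and>
        (\<exists>t. inj_on t {..<k} \<and> (\<forall>i<k. poly (p s) (t i) = 0))"
      by (rule distinct_root_deformation[OF q(1,2)]) blast
    have Q0: "poly (Q r) 0 = coeff q r" for r using Q(1)[of 0 r] Q(2) by simp
    have lead: "poly (Q (degree q)) 0 \<noteq> 0" using q(1) by (simp add: Q0)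
    have "\<exists>\<Xi> c. c \<noteq> 0 \<and> (\<forall>i. i + k \<le> n \<longrightarrow> (\<Sum>r\<le>k. Q r * \<Xi> (i + r)) = 0) \<and>
        (\<forall>i. poly (\<Xi> i) 0 = c * \<xi> i)"
      by (rule kernel_lift[where Q = Q and \<xi> = \<xi> and n = n, OF q(2) lead])
        (use q(3) in \<open>simp add: annihilates_def pairing_monom_mult[OF q(2)] Q0\<close>)
    then obtain \<Xi> c where \<Xi>: "c \<noteq> 0" "\<And>i. i + k \<le> n \<Longrightarrow> (\<Sum>r\<le>k. Q r * \<Xi> (i + r)) = 0"
      "\<And>i. poly (\<Xi> i) 0 = c * \<xi> i" by blast
    have "\<exists>H c. c \<noteq> 0 \<and> (\<forall>i. i + k \<le> m \<longrightarrow> (\<Sum>r\<le>k. Q r * H (i + r)) = 0) \<and>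
        (\<forall>i. poly (H i) 0 = c * \<eta> i)"
      by (rule kernel_lift[where Q = Q and \<xi> = \<eta> and n = m, OF q(2) lead])
        (use q(4) in \<open>simp add: annihilates_def pairing_monom_mult[OF q(2)] Q0\<close>)
    then obtain H c' where H: "c' \<noteq> 0" "\<And>i. i + k \<le> m \<Longrightarrow> (\<Sum>r\<le>k. Q r * H (i + r)) = 0"
      "\<And>i. poly (H i) 0 = c' * \<eta> i" by blast
    obtain i0 j0 where ij: "i0 \<le> n" "\<xi> i0 \<noteq> 0" "j0 \<le> m" "\<eta> j0 \<noteq> 0"
      using nz unfolding nonzero_upto_def by blast
    have ann: "annihilates d k 0 (p s) (\<lambda>i. poly (G i) s)"
      if "degree (p s) = k" "\<And>i. i + k \<le> d \<Longrightarrow> (\<Sum>r\<le>k. Q r * G (i + r)) = 0" for d s G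
      unfolding annihilates_def
    proof (intro allI impI)
      fix j assume "0 + j + k \<le> d"
      then have "poly (\<Sum>r\<le>k. Q r * G (j + r)) s = 0" using that(2)[of j] by simp
      then show "pairing (\<lambda>i. poly (G i) s) (monom 1 (0 + j) * p s) = 0"
        using that(1) by (simp add: pairing_monom_mult[of _ k] Q(1) poly_sum)
    qed
    have "vanishes_at f z" if f: "f \<in> vanishing_forms n m (powersum_points k)" for f
    proof -
      have form: "f \<in> bihom_forms n m" and van: "\<And>z. z \<in> powersum_points k \<Longrightarrow> vanishes_at f z"
        using f unfolding vanishing_forms_def by auto
      define e where "e s = case_sum (lin n A (\<lambda>i. poly (\<Xi> i) s)) (lin m A' (\<lambda>i. poly (H i) s))" for s
      define vv where "vv = case_sum (\<lambda>i. if i \<le> n then \<Sum>l\<le>n. smult (A i l) (\<Xi> l) else 0)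
        (\<lambda>i. if i \<le> m then \<Sum>l\<le>m. smult (A' i l) (H l) else 0)"
      have "e s = (\<lambda>x. poly (vv x) s)" for s
        by (rule ext) (auto simp: e_def vv_def lin_def poly_sum split: sum.split)
      then obtain pf where pf: "\<And>s. poly_val (e s) f = poly pf s"
        using polyfun_curve[of vv f] by auto
      have "pf = 0"
      proof (rule ccontr)
        assume "pf \<noteq> 0"
        moreover have "\<Xi> i0 \<noteq> 0" "H j0 \<noteq> 0" using \<Xi>(1,3) H(1,3) ij by (metis mult_eq_0_iff poly_0)+
        ultimately have "pf * \<Delta> * \<Xi> i0 * H j0 \<noteq> 0" using Q(3) by simp
        then obtain s where "poly (pf * \<Delta> * \<Xi> i0 * H j0) s \<noteq> 0" by (rule nonroot_exists)
        then have s: "poly pf s \<noteq> 0" "poly \<Delta> s \<noteq> 0" "poly (\<Xi> i0) s \<noteq> 0" "poly (H j0) s \<noteq> 0" by auto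
        obtain t where t: "degree (p s) = k" "p s \<noteq> 0" "inj_on t {..<k}" "\<forall>i<k. poly (p s) (t i) = 0"
          using gen[OF s(2)] by blast
        have nzs: "nonzero_upto n (\<lambda>i. poly (\<Xi> i) s)" "nonzero_upto m (\<lambda>i. poly (H i) s)"
          using s(3,4) ij unfolding nonzero_upto_def by blast+
        have "\<exists>a. \<forall>i\<le>n. poly (\<Xi> i) s = (\<Sum>r<k. a r * t r ^ i)"
          using t(4) by (intro annihilates_imp_power_sum[OF _ t(3) _ t(1,2) _ ann[OF t(1) \<Xi>(2)]]) auto
        moreover have "\<exists>b. \<forall>i\<le>m. poly (H i) s = (\<Sum>r<k. b r * t r ^ i)"
          using t(4) by (intro annihilates_imp_power_sum[OF _ t(3) _ t(1,2) _ ann[OF t(1) H(2)]]) auto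
        ultimately have "pt (\<lambda>i. poly (\<Xi> i) s) (\<lambda>i. poly (H i) s) \<in> powersum_points k"
          using nzs t(3) unfolding powersum_points_def by blast
        from van[OF this] have "poly_val (e s) f = 0"
          using vanishes_at_pt[OF form nzs] by (simp add: e_def)
        then show False using s(1) pf by simp
      qed
      then have "poly_val (e 0) f = 0" using pf by simp
      moreover have "e 0 = case_sum (vscale c (lin n A \<xi>)) (vscale c' (lin m A' \<eta>))"
        by (simp add: e_def \<Xi>(3) H(3) lin_scale)
      moreover have "vscale c (lin n A \<xi>) \<in> fst z" "vscale c' (lin m A' \<eta>) \<in> snd z"
        using pt_Proj[OF nz] \<Xi>(1) H(1) zP unfolding zpt by (auto intro: Proj_scale)
      ultimately show ?thesis using vanishes_at_form_iff[OF form zP] by metis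
    qed
    then show "z \<in> zariski n m closure_of powersum_points k"
      unfolding closure_zariski[OF sub] zero_locus_def using zP by blast
  qed
qed

section \<open>A chain of maximal length\<close>

text \<open>If there are at least as many equations as nodes, the Vandermonde argument shows that the weight
\<open>t s ^ u * poly q (t s)\<close> vanishes at every node \<open>s\<close> in \<open>I\<close>, and similarly for \<open>J\<close>. The covering
condition excludes that a weight vanishes because the node is zero, so \<open>q\<close> has \<open>j + 1\<close> roots.\<close>

lemma annihilator_eq_0:
  fixes t :: "nat \<Rightarrow> 'a::field"
  assumes t: "inj_on t {..j}" and sub: "I \<subseteq> {..j}" "J \<subseteq> {..j}"
    and card: "card I \<le> n + 1 - (u + j)" "card J \<le> m + 1 - (w + j)"
    and \<xi>: "\<And>i. i \<le> n \<Longrightarrow> \<xi> i = (\<Sum>s\<in>I. t s ^ i)" and \<eta>: "\<And>i. i \<le> m \<Longrightarrow> \<eta> i = (\<Sum>s\<in>J. t s ^ i)"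
    and q: "degree q \<le> j" "annihilates n j u q \<xi>" "annihilates m j w q \<eta>"
    and cover: "\<And>s. s \<le> j \<Longrightarrow> s \<in> I \<and> (u = 0 \<or> t s \<noteq> 0) \<or> s \<in> J \<and> (w = 0 \<or> t s \<noteq> 0)"
  shows "q = 0"
proof -
  have weights: "t s ^ v * poly q (t s) = 0"
    if K: "K \<subseteq> {..j}" "card K \<le> d + 1 - (v + j)" "\<And>i. i \<le> d \<Longrightarrow> \<zeta> i = (\<Sum>s\<in>K. t s ^ i)"
      "annihilates d j v q \<zeta>" "s \<in> K" for K d v \<zeta> s
  proof (rule power_sums_independent[of K t])
    show "finite K" using K(1) finite_subset by blast
    show "inj_on t K" using t K(1) inj_on_subset by blast
    show "s \<in> K" by fact
    fix i assume i: "i < card K"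
    then have le: "v + i + j \<le> d" using K(2) by simp
    have deg: "degree (monom 1 (v + i) * q) \<le> d"
      using degree_mult_le[of "monom 1 (v + i)" q] degree_monom_le[of "1::'a" "v + i"] q(1) le by linarith
    have "0 = pairing \<zeta> (monom 1 (v + i) * q)" using K(4) le unfolding annihilates_def by simp
    also have "\<dots> = (\<Sum>s\<in>K. 1 * poly (monom 1 (v + i) * q) (t s))"
      using K(3) by (intro pairing_powers[OF deg]) simp
    also have "\<dots> = (\<Sum>s\<in>K. t s ^ v * poly q (t s) * t s ^ i)"
      by (intro sum.cong) (simp_all add: poly_monom power_add ac_simps)
    finally show "(\<Sum>s\<in>K. t s ^ v * poly q (t s) * t s ^ i) = 0" by simp
  qed
  have "poly q (t s) = 0" if "s \<le> j" for s
    using cover[OF that] weights[OF sub(1) card(1) \<xi> q(2)] weights[OF sub(2) card(2) \<eta> q(3)] by fastforce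
  then show "q = 0"
    using t q(1) by (intro poly_eqI_degree[of "t ` {..j}"]) (auto simp: card_image)
qed

definition trunc :: "nat \<Rightarrow> (nat \<Rightarrow> 'a::zero) \<Rightarrow> nat \<Rightarrow> 'a" where
  "trunc N u i = (if i < N then u i else 0)"

lemma polyfun_trunc: "(\<lambda>u. trunc N u i) \<in> polyfun N"
  unfolding trunc_def by (cases "i < N") (auto intro: polyfun.intros)

text \<open>The parameters are arranged in blocks: the \<open>r\<close>-th node is \<open>u (3 * r + 2)\<close>, with coefficient
\<open>u (3 * r + 1)\<close> in the first factor and \<open>u (3 * r)\<close> in the second. When only the first \<open>N\<close> parameters
are free and the others zero, an incomplete block has the node 0.\<close>

definition xcoords :: "nat \<Rightarrow> (nat \<Rightarrow> 'a::comm_ring_1) \<Rightarrow> nat \<Rightarrow> 'a" where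
  "xcoords k u i = (\<Sum>r<k. u (3 * r + 1) * u (3 * r + 2) ^ i)"

definition ycoords :: "nat \<Rightarrow> (nat \<Rightarrow> 'a::comm_ring_1) \<Rightarrow> nat \<Rightarrow> 'a" where
  "ycoords k u j = (\<Sum>r<k. u (3 * r) * u (3 * r + 2) ^ j)"

lemma polyfun_xcoords: "(\<lambda>u. xcoords k (trunc N u) i) \<in> polyfun N"
  unfolding xcoords_def by (intro polyfun_sum polyfun.mult polyfun_power polyfun_trunc)

lemma polyfun_ycoords: "(\<lambda>u. ycoords k (trunc N u) i) \<in> polyfun N"
  unfolding ycoords_def by (intro polyfun_sum polyfun.mult polyfun_power polyfun_trunc)

definition interleave :: "(nat \<Rightarrow> 'a) \<Rightarrow> (nat \<Rightarrow> 'a) \<Rightarrow> (nat \<Rightarrow> 'a) \<Rightarrow> nat \<Rightarrow> 'a" where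
  "interleave b a t i = (if i mod 3 = 0 then b (i div 3) else if i mod 3 = 1 then a (i div 3) else t (i div 3))"

lemma interleave_simps:
  "interleave b a t (3 * r) = b r" "interleave b a t (Suc (3 * r)) = a r" "interleave b a t (Suc (Suc (3 * r))) = t r"
proof -
  have "Suc (3 * r) mod 3 = 1" "Suc (3 * r) div 3 = r" "Suc (Suc (3 * r)) mod 3 = 2" "Suc (Suc (3 * r)) div 3 = r"
    by presburger+
  then show "interleave b a t (3 * r) = b r" "interleave b a t (Suc (3 * r)) = a r"
    "interleave b a t (Suc (Suc (3 * r))) = t r" by (simp_all add: interleave_def)
qed

lemma coords_interleave:
  "xcoords k (interleave b a t) i = (\<Sum>r<k. a r * t r ^ i)"
  "ycoords k (interleave b a t) i = (\<Sum>r<k. b r * t r ^ i)"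
  by (simp_all add: xcoords_def ycoords_def interleave_simps)

context frame
begin

text \<open>The points obtained when all parameters except for the first \<open>N\<close> are zero.\<close>

definition stratum :: "nat \<Rightarrow> nat \<Rightarrow> 'a bipoint set" where
  "stratum k N = image_points n m
     (\<lambda>u. lin n A (xcoords k (trunc N u))) (\<lambda>u. lin m A' (ycoords k (trunc N u)))"

lemma stratum_iff:
  "z \<in> stratum k N \<longleftrightarrow> (\<exists>u. (\<forall>i\<ge>N. u i = 0) \<and> nonzero_upto n (xcoords k u) \<and>
     nonzero_upto m (ycoords k u) \<and> z = pt (xcoords k u) (ycoords k u))"
proof
  assume z: "z \<in> stratum k N"
  then obtain u where u: "lin n A (xcoords k (trunc N u)) \<in> fst z" "lin m A' (ycoords k (trunc N u)) \<in> snd z"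
    and zP: "fst z \<in> Proj n" "snd z \<in> Proj m"
    unfolding stratum_def image_points_def by auto
  have "z = pt (xcoords k (trunc N u)) (ycoords k (trunc N u))"
    using Proj_memD[OF zP(1) u(1)] Proj_memD[OF zP(2) u(2)] by (simp add: pt_def prod_eq_iff)
  moreover have "nonzero_upto n (xcoords k (trunc N u))" "nonzero_upto m (ycoords k (trunc N u))"
    using Proj_memD[OF zP(1) u(1)] Proj_memD[OF zP(2) u(2)] lin_nonzero lin_nonzero' by blast+
  ultimately show "\<exists>u. (\<forall>i\<ge>N. u i = 0) \<and> nonzero_upto n (xcoords k u) \<and>
     nonzero_upto m (ycoords k u) \<and> z = pt (xcoords k u) (ycoords k u)"
    by (intro exI[of _ "trunc N u"]) (auto simp: trunc_def)
next
  assume "\<exists>u. (\<forall>i\<ge>N. u i = 0) \<and> nonzero_upto n (xcoords k u) \<and>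
     nonzero_upto m (ycoords k u) \<and> z = pt (xcoords k u) (ycoords k u)"
  then obtain u where u: "\<And>i. i \<ge> N \<Longrightarrow> u i = 0" "nonzero_upto n (xcoords k u)"
    "nonzero_upto m (ycoords k u)" "z = pt (xcoords k u) (ycoords k u)" by blast
  have "trunc N u = u" using u(1) by (auto simp: trunc_def fun_eq_iff)
  then show "z \<in> stratum k N"
    using pt_Proj[OF u(2,3)] unfolding stratum_def image_points_def u(4) mem_Collect_eq by metis
qed

lemma stratum_Proj: "stratum k N \<subseteq> Proj n \<times> Proj m"
  unfolding stratum_def image_points_def by blast

lemma stratum_mono:
  assumes "N \<le> N'"
  shows "stratum k N \<subseteq> stratum k N'"
proof
  fix z assume "z \<in> stratum k N"
  then obtain u where u: "\<forall>i\<ge>N. u i = 0" "nonzero_upto n (xcoords k u)" "nonzero_upto m (ycoords k u)"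
    "z = pt (xcoords k u) (ycoords k u)" unfolding stratum_iff by blast
  have "\<forall>i\<ge>N'. u i = 0" using u(1) assms by auto
  then show "z \<in> stratum k N'" using u(2-4) unfolding stratum_iff by blast
qed

lemma irreducible_stratum:
  assumes "1 \<le> k" "2 \<le> N"
  shows "irreducible_in (zariski n m) (zariski n m closure_of stratum k N)"
proof -
  define u :: "nat \<Rightarrow> 'a" where "u = interleave (\<lambda>r. if r = 0 then 1 else 0) (\<lambda>r. if r = 0 then 1 else 0) (\<lambda>_. 0)"
  have "u i = 0" if "i \<ge> N" for i
    using that assms(2) by (auto simp: u_def interleave_def div_eq_0_iff)
  moreover have "xcoords k u 0 = 1" "ycoords k u 0 = 1"
    using assms(1) by (simp_all add: u_def coords_interleave)
  then have "nonzero_upto n (xcoords k u)" "nonzero_upto m (ycoords k u)"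
    unfolding nonzero_upto_def by (auto intro!: exI[of _ 0])
  ultimately have "stratum k N \<noteq> {}" using stratum_iff by blast
  then show ?thesis
    unfolding stratum_def
    by (intro irreducible_image_points[of _ N] polyfun_lin polyfun_xcoords polyfun_ycoords lin_cvec)
qed

lemma powersum_points_subset_stratum: "powersum_points k \<subseteq> stratum k (3 * k)"
proof
  fix z assume "z \<in> powersum_points k"
  then obtain \<xi> \<eta> t a b where z: "z = pt \<xi> \<eta>" and nz: "nonzero_upto n \<xi>" "nonzero_upto m \<eta>"
    and \<xi>: "\<And>i. i \<le> n \<Longrightarrow> \<xi> i = (\<Sum>r<k. a r * t r ^ i)" and \<eta>: "\<And>j. j \<le> m \<Longrightarrow> \<eta> j = (\<Sum>r<k. b r * t r ^ j)"
    unfolding powersum_points_def by blast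
  define u where "u = trunc (3 * k) (interleave b a t)"
  have eq: "xcoords k u i = (\<Sum>r<k. a r * t r ^ i)" "ycoords k u i = (\<Sum>r<k. b r * t r ^ i)" for i
    unfolding u_def xcoords_def ycoords_def by (auto simp: trunc_def interleave_simps intro!: sum.cong)
  have "z = pt (xcoords k u) (ycoords k u)" unfolding z by (rule pt_cong) (simp_all add: eq \<xi> \<eta>)
  moreover have "nonzero_upto n (xcoords k u)" "nonzero_upto m (ycoords k u)"
    using nz \<xi> \<eta> unfolding nonzero_upto_def eq by auto
  moreover have "u i = 0" if "i \<ge> 3 * k" for i using that by (simp add: u_def trunc_def)
  ultimately show "z \<in> stratum k (3 * k)" unfolding stratum_iff by blast
qed

text \<open>Here \<open>j\<close> blocks are complete, and the product of the linear factors of their nodes is the annihilator. The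
incomplete block, if it has a coefficient in a factor, has node 0, and the shift in that factor makes it
invisible.\<close>

lemma stratum_subset_locus:
  assumes r: "r < 3" "u = (if r = 2 then 1 else 0)" "w = (if r = 0 then 0 else 1)"
    and le: "u + j \<le> n + 1" "w + j \<le> m + 1"
  shows "stratum k (3 * j + r) \<subseteq> locus j u w"
proof
  fix z assume "z \<in> stratum k (3 * j + r)"
  then obtain v where v: "\<And>i. i \<ge> 3 * j + r \<Longrightarrow> v i = 0" "nonzero_upto n (xcoords k v)"
    "nonzero_upto m (ycoords k v)" and z: "z = pt (xcoords k v) (ycoords k v)"
    unfolding stratum_iff by blast
  define q where "q = (\<Prod>i<j. [:- v (3 * i + 2), 1:])"
  have q: "q \<noteq> 0" "degree q = j" by (auto simp: q_def degree_prod_sum_eq)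
  have root: "poly q (v (3 * i + 2)) = 0" if "i < j" for i
    using that by (auto simp: q_def poly_prod intro!: bexI[of _ i])
  have "v (3 * i + 1) * v (3 * i + 2) ^ u * poly q (v (3 * i + 2)) = 0" for i
  proof -
    consider "i < j" | "i = j" "r = 2" | "v (3 * i + 1) = 0" using v(1)[of "3 * i + 1"] r(1) by linarith
    then show ?thesis
    proof cases
      case 2
      then show ?thesis using v(1)[of "3 * i + 2"] r(2) by simp
    qed (use root in simp_all)
  qed
  then have "annihilates n j u q (xcoords k v)"
    by (intro annihilates_power_sum[where R = "{..<k}" and a = "\<lambda>i. v (3 * i + 1)" and t = "\<lambda>i. v (3 * i + 2)"])
      (simp_all add: q xcoords_def)
  moreover have "v (3 * i) * v (3 * i + 2) ^ w * poly q (v (3 * i + 2)) = 0" for i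
  proof -
    consider "i < j" | "i = j" "r \<noteq> 0" | "v (3 * i) = 0" using v(1)[of "3 * i"] r(1) by linarith
    then show ?thesis
    proof cases
      case 2
      then show ?thesis using v(1)[of "3 * i + 2"] r(1,3) by simp
    qed (use root in simp_all)
  qed
  then have "annihilates m j w q (ycoords k v)"
    by (intro annihilates_power_sum[where R = "{..<k}" and a = "\<lambda>i. v (3 * i)" and t = "\<lambda>i. v (3 * i + 2)"])
      (simp_all add: q ycoords_def)
  ultimately show "z \<in> locus j u w"
    unfolding z using pt_in_locus_iff[OF le v(2,3)] q by auto
qed

text \<open>The stratum with one more parameter contains a point without annihilator of degree at most \<open>j\<close>. Distribute the
nodes \<open>0, \<dots>, j\<close> over two sets \<open>I\<close> and \<open>J\<close>, the supports of the coefficients in the two factors,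
which are set to 1. The system provides \<open>cI\<close> and \<open>cJ\<close> equations for them, and the bound on
\<open>3 * j + r\<close> says that \<open>cI + cJ \<ge> j + 1\<close>, so \<open>I\<close> and \<open>J\<close> can be chosen of sizes at most
\<open>cI\<close> and \<open>cJ\<close> covering all nodes.\<close>

lemma stratum_not_subset_locus:
  assumes r: "r < 3" "u = (if r = 2 then 1 else 0)" "w = (if r = 0 then 0 else 1)"
    and j: "j < k" "k \<le> n" "k \<le> m" and N: "2 \<le> 3 * j + r" "3 * j + r \<le> n + m + 1"
  shows "\<not> stratum k (3 * j + r + 1) \<subseteq> locus j u w"
proof -
  have le: "u + j \<le> n" "w + j \<le> m" "u + w = r" using r j by (auto split: if_splits)
  define cI where "cI = n + 1 - (u + j)"
  define cJ where "cJ = m + 1 - (w + j)"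
  have c: "1 \<le> cI" "1 \<le> cJ" "j + 1 \<le> cI + cJ" using le N j unfolding cI_def cJ_def by linarith+
  \<comment> \<open>The node \<open>j\<close> must lie in a set whose factor shows it: \<open>J\<close> if \<open>r = 0\<close>, and \<open>I\<close> if \<open>r = 1\<close>.\<close>
  define I where "I = (if r = 1 then {i. i \<le> j \<and> j < i + cI} else {i. i \<le> j \<and> i < cI} - (if r = 0 then {j} else {}))"
  define J where "J = (if r = 1 then {i. i \<le> j \<and> i < cJ} else {i. i \<le> j \<and> j < i + cJ})"
  have high: "card {i. i \<le> j \<and> j < i + c} \<le> c" for c
  proof -
    have "{i. i \<le> j \<and> j < i + c} \<subseteq> {j + 1 - c..j}" by auto
    from card_mono[OF _ this] show ?thesis by simp
  qed
  have low: "card {i. i \<le> j \<and> i < c} \<le> c" for c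
    using card_mono[of "{..<c}" "{i. i \<le> j \<and> i < c}"] by auto
  have cards: "card I \<le> cI" "card J \<le> cJ"
    using high low order_trans[OF card_Diff1_le low] unfolding I_def J_def by auto
  have sub: "I \<subseteq> {..j}" "J \<subseteq> {..j}" unfolding I_def J_def by auto
  have j0: "r \<noteq> 2 \<Longrightarrow> 1 \<le> j" using N r by linarith
  have ne: "I \<noteq> {}" "J \<noteq> {}"
  proof -
    have "(if r = 1 then j else 0) \<in> I" using c j0 r(1) unfolding I_def by auto
    then show "I \<noteq> {}" by blast
    have "(if r = 1 then 0 else j) \<in> J" using c unfolding J_def by auto
    then show "J \<noteq> {}" by blast
  qed
  \<comment> \<open>The last node is still forced to be 0 unless the new parameter is that node.\<close>
  define t :: "nat \<Rightarrow> 'a" where "t i = (if i = j \<and> r \<noteq> 2 then 0 else of_nat (Suc i))" for i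
  have t0: "t i \<noteq> 0" if "i \<noteq> j \<or> r = 2" for i using that by (auto simp: t_def simp del: of_nat_Suc)
  have inj: "inj_on t {..j}"
  proof (rule inj_onI)
    fix i l assume "t i = t l"
    then show "i = l" using t0[of i] t0[of l] by (auto simp: t_def simp del: of_nat_Suc split: if_splits)
  qed
  have cover: "s \<in> I \<and> (u = 0 \<or> t s \<noteq> 0) \<or> s \<in> J \<and> (w = 0 \<or> t s \<noteq> 0)" if "s \<le> j" for s
  proof (cases "s = j \<and> r \<noteq> 2")
    case True
    then show ?thesis using c r by (cases "r = 0") (auto simp: I_def J_def)
  next
    case False
    then have "t s \<noteq> 0" using t0 by blast
    moreover have "s \<in> I \<or> s \<in> J" using False that c(3) unfolding I_def J_def by auto
    ultimately show ?thesis by blast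
  qed
  define a :: "nat \<Rightarrow> 'a" where "a i = (if i \<in> I then 1 else 0)" for i
  define b :: "nat \<Rightarrow> 'a" where "b i = (if i \<in> J then 1 else 0)" for i
  define v where "v = interleave b a (\<lambda>i. if i \<le> j then t i else 0)"
  have v0: "v i = 0" if i: "i \<ge> 3 * j + r + 1" for i
  proof -
    define d where "d = i div 3"
    have "i mod 3 = 0 \<or> i mod 3 = 1 \<or> i mod 3 = 2" by presburger
    then have cases: "i = 3 * d \<or> i = Suc (3 * d) \<or> i = Suc (Suc (3 * d))" unfolding d_def by presburger
    have gt: "a d = 0 \<and> b d = 0" if "d > j" using that sub unfolding a_def b_def by auto
    from cases show ?thesis
    proof (elim disjE)
      assume e: "i = 3 * d"
      then have "d > j" using i by linarith
      then show ?thesis using gt unfolding e v_def interleave_simps by simp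
    next
      assume e: "i = Suc (3 * d)"
      then have "d > j \<or> d = j \<and> r = 0" using i by linarith
      then have "a d = 0" using gt by (auto simp: a_def I_def)
      then show ?thesis unfolding e v_def interleave_simps by simp
    next
      assume e: "i = Suc (Suc (3 * d))"
      then have "d > j \<or> d = j \<and> r \<noteq> 2" using i r(1) by linarith
      then show ?thesis unfolding e v_def interleave_simps by (auto simp: t_def)
    qed
  qed
  have coords: "xcoords k v i = (\<Sum>s\<in>I. t s ^ i)" "ycoords k v i = (\<Sum>s\<in>J. t s ^ i)" for i
  proof -
    have I: "I \<subseteq> {..<k}" "J \<subseteq> {..<k}" using sub j(1) by auto
    show "xcoords k v i = (\<Sum>s\<in>I. t s ^ i)" unfolding v_def coords_interleave
      using I(1) sub(1) by (intro sum.mono_neutral_cong_right) (auto simp: a_def)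
    show "ycoords k v i = (\<Sum>s\<in>J. t s ^ i)" unfolding v_def coords_interleave
      using I(2) sub(2) by (intro sum.mono_neutral_cong_right) (auto simp: b_def)
  qed
  have "finite I" "finite J" using sub finite_subset by blast+
  then have "xcoords k v 0 \<noteq> 0" "ycoords k v 0 \<noteq> 0" using ne by (simp_all add: coords)
  then have nz: "nonzero_upto n (xcoords k v)" "nonzero_upto m (ycoords k v)"
    unfolding nonzero_upto_def by (auto intro!: exI[of _ 0])
  have "pt (xcoords k v) (ycoords k v) \<in> stratum k (3 * j + r + 1)"
    unfolding stratum_iff using v0 nz by blast
  moreover have "pt (xcoords k v) (ycoords k v) \<notin> locus j u w"
  proof
    assume "pt (xcoords k v) (ycoords k v) \<in> locus j u w"
    moreover have "u + j \<le> n + 1" "w + j \<le> m + 1" using le by auto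
    ultimately obtain q where q: "q \<noteq> 0" "degree q \<le> j" "annihilates n j u q (xcoords k v)"
      "annihilates m j w q (ycoords k v)"
      using pt_in_locus_iff[OF _ _ nz] by blast
    have "q = 0"
      by (rule annihilator_eq_0[OF inj sub cards[unfolded cI_def cJ_def] coords q(2-4) cover])
    then show False using q(1) by simp
  qed
  ultimately show ?thesis by blast
qed

lemma stratum_chain:
  assumes k: "1 \<le> k" "k \<le> n" "k \<le> m" and i: "i + 3 \<le> 3 * k" "i + 3 \<le> n + m + 2"
  shows "zariski n m closure_of stratum k (i + 2) \<subset> zariski n m closure_of stratum k (i + 3)"
proof -
  define j r where "j = (i + 2) div 3" and "r = (i + 2) mod 3"
  have jr: "i + 2 = 3 * j + r" "r < 3" unfolding j_def r_def by auto
  define u w where "u = (if r = 2 then 1 else 0 :: nat)" and "w = (if r = 0 then 0 else 1 :: nat)"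
  have j: "j < k" using i(1) jr by linarith
  have le: "u + j \<le> n + 1" "w + j \<le> m + 1" using j k unfolding u_def w_def by auto
  have "stratum k (i + 2) \<subseteq> locus j u w"
    unfolding jr(1) by (rule stratum_subset_locus[OF jr(2) u_def w_def le])
  then have "zariski n m closure_of stratum k (i + 2) \<subseteq> locus j u w"
    by (rule closure_of_minimal[OF _ closedin_locus[OF le]])
  moreover have "\<not> stratum k (i + 3) \<subseteq> locus j u w"
    using stratum_not_subset_locus[OF jr(2) u_def w_def j k(2,3)] jr(1) i(2)
    by (simp add: numeral_3_eq_3 flip: jr(1))
  moreover have "stratum k (i + 3) \<subseteq> zariski n m closure_of stratum k (i + 3)"
    by (rule closure_of_subset) (simp add: topspace_zariski stratum_Proj)
  moreover have "zariski n m closure_of stratum k (i + 2) \<subseteq> zariski n m closure_of stratum k (i + 3)"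
    by (intro closure_of_mono stratum_mono) simp
  ultimately show ?thesis by blast
qed

text \<open>The cone over the stratum is covered by the \<open>3 * k\<close> parameters themselves: rescaling a representative in
either factor amounts to rescaling its coefficients.\<close>

lemma chain_in_stratum_closure:
  assumes chain: "\<forall>i\<le>d. closedin (zariski n m) (Z i) \<and> irreducible_in (zariski n m) (Z i)"
      "\<forall>i<d. Z i \<subset> Z (Suc i)"
    and sub: "Z d \<subseteq> zariski n m closure_of stratum k (3 * k)"
  shows "d + 2 \<le> 3 * k"
proof (rule chain_le_parameters[OF chain stratum_Proj sub])
  let ?\<Phi> = "\<lambda>u. case_sum (lin n A (xcoords k (trunc (3 * k) u))) (lin m A' (ycoords k (trunc (3 * k) u)))"
  show "(\<lambda>u. ?\<Phi> u s) \<in> polyfun (3 * k)" for s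
    by (cases s) (simp_all add: polyfun_lin polyfun_xcoords polyfun_ycoords)
  show "cone (stratum k (3 * k)) \<subseteq> range ?\<Phi>"
  proof
    fix e assume "e \<in> cone (stratum k (3 * k))"
    then obtain v w z where e: "e = case_sum v w" and vw: "v \<in> fst z" "w \<in> snd z" and "z \<in> stratum k (3 * k)"
      unfolding cone_def by blast
    then obtain u where nz: "nonzero_upto n (xcoords k u)" "nonzero_upto m (ycoords k u)"
      and z: "z = pt (xcoords k u) (ycoords k u)" unfolding stratum_iff by blast
    obtain c where c: "v = vscale c (lin n A (xcoords k u))"
      using vw(1) pclass_eq[OF lin_cvec lin_nonzero[THEN iffD2, OF nz(1)]] unfolding z pt_def by auto
    obtain c' where c': "w = vscale c' (lin m A' (ycoords k u))"
      using vw(2) pclass_eq[OF lin_cvec lin_nonzero'[THEN iffD2, OF nz(2)]] unfolding z pt_def by auto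
    define u' where "u' = interleave (\<lambda>r. c' * u (3 * r)) (\<lambda>r. c * u (3 * r + 1)) (\<lambda>r. u (3 * r + 2))"
    have "xcoords k (trunc (3 * k) u') = (\<lambda>i. c * xcoords k u i)"
      unfolding xcoords_def u'_def sum_distrib_left
      by (intro ext sum.cong) (auto simp: trunc_def interleave_simps mult.assoc)
    moreover have "ycoords k (trunc (3 * k) u') = (\<lambda>i. c' * ycoords k u i)"
      unfolding ycoords_def u'_def sum_distrib_left
      by (intro ext sum.cong) (auto simp: trunc_def interleave_simps mult.assoc)
    ultimately have "e = ?\<Phi> u'" unfolding e c c' by (simp only: lin_scale)
    then show "e \<in> range ?\<Phi>" by blast
  qed
qed

end

text \<open>The cone over the whole product is parametrized by its \<open>n + m + 2\<close> coordinates.\<close>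

lemma chain_in_product:
  fixes Z :: "nat \<Rightarrow> 'a::field_char_0 bipoint set"
  assumes chain: "\<forall>i\<le>d. closedin (zariski n m) (Z i) \<and> irreducible_in (zariski n m) (Z i)"
      "\<forall>i<d. Z i \<subset> Z (Suc i)"
  shows "d \<le> n + m"
proof -
  let ?P = "Proj n \<times> Proj m :: 'a bipoint set"
  let ?\<Phi> = "\<lambda>u. case_sum (\<lambda>i. if i \<le> n then u i else 0) (\<lambda>j. if j \<le> m then u (n + 1 + j) else 0 :: 'a)"
  have "Z d \<subseteq> zariski n m closure_of ?P"
    using chain(1) closedin_subset[of "zariski n m" "Z d"]
    by (metis closure_of_topspace order_refl topspace_zariski)
  then have "d + 2 \<le> n + m + 2"
  proof (rule chain_le_parameters[OF chain order_refl])
    show "(\<lambda>u. ?\<Phi> u s) \<in> polyfun (n + m + 2)" for s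
    proof (cases s)
      case (Inl i)
      then show ?thesis by (cases "i \<le> n") (auto intro: polyfun.intros)
    next
      case (Inr j)
      then show ?thesis by (cases "j \<le> m") (auto intro: polyfun.intros)
    qed
    show "cone ?P \<subseteq> range ?\<Phi>"
    proof
      fix e assume "e \<in> cone ?P"
      then obtain v w P Q where e: "e = case_sum v w" and vw: "v \<in> P" "w \<in> Q" "P \<in> Proj n" "Q \<in> Proj m"
        unfolding cone_def by auto
      have cv: "v \<in> cvec n" "w \<in> cvec m" using Proj_memD vw by blast+
      define u where "u l = (if l \<le> n then v l else w (l - (n + 1)))" for l
      have "e = ?\<Phi> u"
        unfolding e u_def using cv by (intro ext) (auto simp: cvec_def split: sum.split)
      then show "e \<in> range ?\<Phi>" by (rule range_eqI[of e ?\<Phi> u])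
    qed
  qed
  then show ?thesis by simp
qed

theorem proposition3p4:
  fixes n k :: nat
    and p :: "nat \<Rightarrow> 'a::{alg_closed_field, field_char_0} bipoint"
    and C :: "'a bipoint set"
    and x y :: "nat \<Rightarrow> 'a bipoly"
  assumes "1 \<le> n" and "1 \<le> k" and "k \<le> n"
    and "general_configuration n p"
    and "distinguished_curve n p C"
    and "homogeneous_coordinates n (n + 1) x y"
    and "C = zero_locus n (n + 1) (minors 2 (M n 1 x y))"
  shows "irreducible_in (zariski n (n + 1)) (bilinear_secant n (n + 1) k C)
    \<and> variety_dim n (n + 1) (bilinear_secant n (n + 1) k C) = enat (min (3 * k - 2) (2 * n + 1))
    \<and> bilinear_secant n (n + 1) k C =
        zero_locus n (n + 1) (ideal.span (minors (k + 1) (M n k x y)))"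
proof -
  obtain A A' where frame: "frame n (n + 1) x y A A'" by (rule frame_exists[OF assms(6)])
  interpret frame n "n + 1" x y A A' by (rule frame)
  let ?T = "zariski n (n + 1) :: 'a bipoint topology"
  let ?V = "locus k 0 0"
  have k: "1 \<le> k" "k \<le> n" "k \<le> n + 1" "k \<le> (n + 1) + 1" using assms by auto
  have M: "M n k x y = hankel k (n + 1 - (0 + k)) (n + 1 + 1 - (0 + k)) (\<lambda>i. x (0 + i)) (\<lambda>i. y (0 + i))"
    if "k \<le> n" for k
  proof -
    have sizes: "n + 1 - k = n - k + 1" "n + 1 + 1 - k = n - k + 2" using that by auto
    show ?thesis unfolding M_def hankel_def add_0 sizes ..
  qed
  have locus: "zero_locus n (n + 1) (minors (k + 1) (M n k x y)) = locus k 0 0" if "k \<le> n" for k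
    unfolding locus_def M[OF that] ..
  have C: "C = locus 1 0 0" using locus[OF assms(1)] assms(7) by (simp add: numeral_2_eq_2)
  have secant: "bilinear_secant n (n + 1) k C = ?T closure_of secant_union k"
    unfolding bilinear_secant_def bilinear_join_def secant_union_def C ..
  have closed: "closedin ?T ?V" using k by (intro closedin_locus) auto
  have up: "?T closure_of secant_union k \<subseteq> ?V"
    using k by (intro closure_of_minimal secant_union_subset_locus closed) auto
  have dense: "?V \<subseteq> ?T closure_of powersum_points k"
    by (rule locus_subset_closure_powersum_points[OF frame k(3,4)])
  have "powersum_points k \<subseteq> secant_union k"
    by (rule powersum_points_subset_secant_union[OF k(3,4)])
  then have "?V \<subseteq> ?T closure_of secant_union k" using dense closure_of_mono by blast
  with up have V: "bilinear_secant n (n + 1) k C = ?V" unfolding secant by blast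
  have "stratum k (3 * k + 0) \<subseteq> ?V" using k by (intro stratum_subset_locus) auto
  then have "?T closure_of stratum k (3 * k) \<subseteq> ?V" using closed by (intro closure_of_minimal) auto
  moreover have "?V \<subseteq> ?T closure_of stratum k (3 * k)"
    using dense closure_of_mono[OF powersum_points_subset_stratum] by blast
  ultimately have Vs: "?V = ?T closure_of stratum k (3 * k)" by blast
  have irr: "irreducible_in ?T ?V"
    unfolding Vs using k by (intro irreducible_stratum) auto
  let ?D = "min (3 * k - 2) (2 * n + 1)"
  \<comment> \<open>The member \<open>i\<close> of the chain has \<open>i + 2\<close> free parameters: the first one, with two, is a single point.\<close>
  have dim: "variety_dim n (n + 1) ?V = enat ?D"
  proof (rule variety_dim_eqI[OF closed])
    fix d Z assume chain: "\<forall>i\<le>d. closedin ?T (Z i) \<and> irreducible_in ?T (Z i)" "\<forall>i<d. Z i \<subset> Z (Suc i)"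
      and "Z d \<subseteq> ?V"
    then have "d + 2 \<le> 3 * k" unfolding Vs by (intro chain_in_stratum_closure[OF chain])
    moreover have "d \<le> n + (n + 1)" by (rule chain_in_product[OF chain])
    ultimately show "d \<le> ?D" by simp
  next
    let ?Z = "\<lambda>i. ?T closure_of stratum k (i + 2)"
    show "\<forall>i\<le>?D. closedin ?T (?Z i) \<and> irreducible_in ?T (?Z i) \<and> ?Z i \<subseteq> ?V"
    proof (intro allI impI conjI)
      fix i assume "i \<le> ?D"
      then have "i \<le> 3 * k - 2" by simp
      then have "i + 2 \<le> 3 * k" using k(1) by arith
      then show "?Z i \<subseteq> ?V" unfolding Vs by (intro closure_of_mono stratum_mono)
      show "irreducible_in ?T (?Z i)" using k by (intro irreducible_stratum) auto
    qed simp
    show "\<forall>i<?D. ?Z i \<subset> ?Z (Suc i)"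
    proof (intro allI impI)
      fix i assume "i < ?D"
      then have i: "i + 3 \<le> 3 * k" "i + 3 \<le> n + (n + 1) + 2" by auto
      have "Suc i + 2 = i + 3" by simp
      then show "?Z i \<subset> ?Z (Suc i)" using stratum_chain[OF k(1-3) i] by (simp only:)
    qed
  qed
  show ?thesis
    unfolding V zero_locus_ideal locus[OF k(2)] using irr dim by blast
qed

end
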